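(* Let $A$ be a noetherian commutative ring, $\mathfrak{a}$-adically complete with respect to an ideal $\mathfrak{a}$, and let $A_0 := A/\mathfrak{a}$. Let $M \in \mathsf{D}(\mathsf{Mod}\, A)_{\mathfrak{a}\text{-com}}$ and $i_0 \in \mathbb{Z}$ be such that $\mathrm{H}^i(M) = 0$ for all $i > i_0$, and $\mathrm{H}^{i_0}(A_0 \otimes^{\mathrm{L}}_A M)$ is a finitely generated $A_0$-module. Then $\mathrm{H}^{i_0}(M)$ is a finitely generated $A$-module.
   Context: For an $A$-module $M$, $\Lambda_{\mathfrak{a}}(M) := \varprojlim_i M/\mathfrak{a}^i M$, with canonical homomorphism $\tau_M : M \to \Lambda_{\mathfrak{a}}(M)$. The left derived functor $\mathrm{L}\Lambda_{\mathfrak{a}}$ on $\mathsf{D}(\mathsf{Mod}\, A)$ is computed by $\mathrm{L}\Lambda_{\mathfrak{a}}(M) = \Lambda_{\mathfrak{a}}(Q)$ for a K-projective resolution $Q \to M$, and the canonical morphism $\tau^{\mathrm{L}}_M : M \to \mathrm{L}\Lambda_{\mathfrak{a}}(M)$ is represented by $\tau_Q$. $\mathsf{D}(\mathsf{Mod}\, A)_{\mathfrak{a}\text{-com}}$ is the full subcategory of $\mathsf{D}(\mathsf{Mod}\, A)$ of cohomologically $\mathfrak{a}$-adically complete complexes, i.e. those $M$ for which $\tau^{\mathrm{L}}_M$ is an isomorphism. *)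

theory Defs
  imports "HOL-Algebra.Algebra" "HOL.Hull"
begin

section \<open>Modules\<close>

text \<open>The record of modules extends the record of rings; the fields \<open>mult\<close> and \<open>one\<close> are
  irrelevant for a module and are unspecified.\<close>

definition make_module ::
  "'b set \<Rightarrow> 'b \<Rightarrow> ('b \<Rightarrow> 'b \<Rightarrow> 'b) \<Rightarrow> ('a \<Rightarrow> 'b \<Rightarrow> 'b) \<Rightarrow> ('a, 'b) module" where
  "make_module S z p s =
     \<lparr>carrier = S, monoid.mult = undefined, one = undefined, ring.zero = z, ring.add = p, smult = s\<rparr>"

definition self_module :: "('a, 'r) ring_scheme \<Rightarrow> ('a, 'a) module" where
  "self_module R = make_module (carrier R) \<zero>\<^bsub>R\<^esub> (\<lambda>x y. x \<oplus>\<^bsub>R\<^esub> y) (\<lambda>r x. r \<otimes>\<^bsub>R\<^esub> x)"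

definition mod_hom ::
  "('a, 'r) ring_scheme \<Rightarrow> ('a, 'b) module \<Rightarrow> ('a, 'c) module \<Rightarrow> ('b \<Rightarrow> 'c) set" where
  "mod_hom R M N = {f \<in> carrier M \<rightarrow> carrier N.
     (\<forall>x\<in>carrier M. \<forall>y\<in>carrier M. f (x \<oplus>\<^bsub>M\<^esub> y) = f x \<oplus>\<^bsub>N\<^esub> f y) \<and>
     (\<forall>r\<in>carrier R. \<forall>x\<in>carrier M. f (r \<odot>\<^bsub>M\<^esub> x) = r \<odot>\<^bsub>N\<^esub> f x)}"

definition module_span ::
  "('a, 'r) ring_scheme \<Rightarrow> ('a, 'b) module \<Rightarrow> 'b set \<Rightarrow> 'b set" where
  "module_span R M S = (\<lambda>N. submodule N R M) hull S"

definition fin_gen_module :: "('a, 'r) ring_scheme \<Rightarrow> ('a, 'b) module \<Rightarrow> bool" where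
  "fin_gen_module R M \<longleftrightarrow>
     module R M \<and> (\<exists>S. finite S \<and> S \<subseteq> carrier M \<and> module_span R M S = carrier M)"

text \<open>The quotient of \<open>M\<close> by a submodule \<open>N\<close>; its elements are the cosets of \<open>N\<close>.\<close>

definition quotient_module :: "('a, 'b) module \<Rightarrow> 'b set \<Rightarrow> ('a, 'b set) module" where
  "quotient_module M N = make_module (a_rcosets\<^bsub>M\<^esub> N) N (set_add M)
     (\<lambda>r K. \<Union>x\<in>K. N +>\<^bsub>M\<^esub> (r \<odot>\<^bsub>M\<^esub> x))"

text \<open>The map \<open>M/N \<rightarrow> M'/N'\<close> induced by a homomorphism \<open>f : M \<rightarrow> M'\<close> with \<open>f(N) \<subseteq> N'\<close>: all the
  cosets in the union coincide.\<close>

definition quotient_map ::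
  "('a, 'c) module \<Rightarrow> 'c set \<Rightarrow> ('b \<Rightarrow> 'c) \<Rightarrow> 'b set \<Rightarrow> 'c set" where
  "quotient_map M' N' f K = (\<Union>x\<in>K. N' +>\<^bsub>M'\<^esub> f x)"


section \<open>Adic completion\<close>

definition ideal_power_times ::
  "('a, 'r) ring_scheme \<Rightarrow> 'a set \<Rightarrow> nat \<Rightarrow> ('a, 'b) module \<Rightarrow> 'b set" where
  "ideal_power_times R I n M =
     module_span R M {r \<odot>\<^bsub>M\<^esub> x | r x. r \<in> I [^]\<^bsub>ideals_set R\<^esub> n \<and> x \<in> carrier M}"

text \<open>The inverse limit of the modules \<open>M/I\<^sup>nM\<close>, as the module of compatible sequences.\<close>

definition completion ::
  "('a, 'r) ring_scheme \<Rightarrow> 'a set \<Rightarrow> ('a, 'b) module \<Rightarrow> ('a, nat \<Rightarrow> 'b set) module" where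
  "completion R I M =
     (let N = (\<lambda>n. ideal_power_times R I n M); Q = (\<lambda>n. quotient_module M (N n)) in
      make_module
        {x. \<forall>n. x n \<in> carrier (Q n) \<and> quotient_map M (N n) (\<lambda>u. u) (x (Suc n)) = x n}
        (\<lambda>n. \<zero>\<^bsub>Q n\<^esub>)
        (\<lambda>x y n. x n \<oplus>\<^bsub>Q n\<^esub> y n)
        (\<lambda>r x n. r \<odot>\<^bsub>Q n\<^esub> x n))"

definition completion_unit ::
  "('a, 'r) ring_scheme \<Rightarrow> 'a set \<Rightarrow> ('a, 'b) module \<Rightarrow> 'b \<Rightarrow> (nat \<Rightarrow> 'b set)" where
  "completion_unit R I M x = (\<lambda>n. ideal_power_times R I n M +>\<^bsub>M\<^esub> x)"

definition completion_map ::
  "('a, 'r) ring_scheme \<Rightarrow> 'a set \<Rightarrow> ('a, 'c) module \<Rightarrow> ('b \<Rightarrow> 'c) \<Rightarrow>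
     (nat \<Rightarrow> 'b set) \<Rightarrow> (nat \<Rightarrow> 'c set)" where
  "completion_map R I M' f x = (\<lambda>n. quotient_map M' (ideal_power_times R I n M') f (x n))"

definition adically_complete_ring :: "('a, 'r) ring_scheme \<Rightarrow> 'a set \<Rightarrow> bool" where
  "adically_complete_ring R I \<longleftrightarrow>
     bij_betw (completion_unit R I (self_module R))
       (carrier R) (carrier (completion R I (self_module R)))"


section \<open>Extension of scalars\<close>

definition free_module :: "('a, 'r) ring_scheme \<Rightarrow> 's set \<Rightarrow> ('a, 's \<Rightarrow> 'a) module" where
  "free_module R S = make_module
     {f. finite {s. f s \<noteq> \<zero>\<^bsub>R\<^esub>} \<and> (\<forall>s\<in>S. f s \<in> carrier R) \<and> (\<forall>s. s \<notin> S \<longrightarrow> f s = \<zero>\<^bsub>R\<^esub>)}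
     (\<lambda>s. \<zero>\<^bsub>R\<^esub>) (\<lambda>f g s. f s \<oplus>\<^bsub>R\<^esub> g s) (\<lambda>r f s. r \<otimes>\<^bsub>R\<^esub> f s)"

definition free_basis :: "('a, 'r) ring_scheme \<Rightarrow> 's \<Rightarrow> 's \<Rightarrow> 'a" where
  "free_basis R s = (\<lambda>t. if t = s then \<one>\<^bsub>R\<^esub> else \<zero>\<^bsub>R\<^esub>)"

definition free_map :: "('a, 'r) ring_scheme \<Rightarrow> ('s \<Rightarrow> 't) \<Rightarrow> ('s \<Rightarrow> 'a) \<Rightarrow> ('t \<Rightarrow> 'a)" where
  "free_map R g f = (\<lambda>t. \<Oplus>\<^bsub>R\<^esub>s\<in>{s. f s \<noteq> \<zero>\<^bsub>R\<^esub> \<and> g s = t}. f s)"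

text \<open>For a ring homomorphism \<open>\<phi> : A \<rightarrow> B\<close>, a \<open>B\<close>-module \<open>M\<close> and an \<open>A\<close>-module \<open>N\<close>, the
  \<open>B\<close>-module \<open>M \<otimes>\<^sub>A N\<close> is the free \<open>B\<close>-module on the symbols \<open>(m, n)\<close> modulo the relations below.
  For \<open>\<phi> = id\<close> this is the usual tensor product of modules over a commutative ring.\<close>

definition tensor_relations ::
  "('a, 'r) ring_scheme \<Rightarrow> ('b, 's) ring_scheme \<Rightarrow> ('a \<Rightarrow> 'b) \<Rightarrow>
     ('b, 'm) module \<Rightarrow> ('a, 'n) module \<Rightarrow> ('m \<times> 'n \<Rightarrow> 'b) set" where
  "tensor_relations A B \<phi> M N =
     (let F = free_module B (carrier M \<times> carrier N); e = free_basis B in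
      {e (m \<oplus>\<^bsub>M\<^esub> m', n) \<ominus>\<^bsub>F\<^esub> (e (m, n) \<oplus>\<^bsub>F\<^esub> e (m', n)) | m m' n.
         m \<in> carrier M \<and> m' \<in> carrier M \<and> n \<in> carrier N} \<union>
      {e (m, n \<oplus>\<^bsub>N\<^esub> n') \<ominus>\<^bsub>F\<^esub> (e (m, n) \<oplus>\<^bsub>F\<^esub> e (m, n')) | m n n'.
         m \<in> carrier M \<and> n \<in> carrier N \<and> n' \<in> carrier N} \<union>
      {e (b \<odot>\<^bsub>M\<^esub> m, n) \<ominus>\<^bsub>F\<^esub> b \<odot>\<^bsub>F\<^esub> e (m, n) | b m n.
         b \<in> carrier B \<and> m \<in> carrier M \<and> n \<in> carrier N} \<union>
      {e (m, a \<odot>\<^bsub>N\<^esub> n) \<ominus>\<^bsub>F\<^esub> \<phi> a \<odot>\<^bsub>F\<^esub> e (m, n) | a m n.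
         a \<in> carrier A \<and> m \<in> carrier M \<and> n \<in> carrier N})"

definition tensor_kernel ::
  "('a, 'r) ring_scheme \<Rightarrow> ('b, 's) ring_scheme \<Rightarrow> ('a \<Rightarrow> 'b) \<Rightarrow>
     ('b, 'm) module \<Rightarrow> ('a, 'n) module \<Rightarrow> ('m \<times> 'n \<Rightarrow> 'b) set" where
  "tensor_kernel A B \<phi> M N =
     module_span B (free_module B (carrier M \<times> carrier N)) (tensor_relations A B \<phi> M N)"

definition tensor_module ::
  "('a, 'r) ring_scheme \<Rightarrow> ('b, 's) ring_scheme \<Rightarrow> ('a \<Rightarrow> 'b) \<Rightarrow>
     ('b, 'm) module \<Rightarrow> ('a, 'n) module \<Rightarrow> ('b, ('m \<times> 'n \<Rightarrow> 'b) set) module" where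
  "tensor_module A B \<phi> M N =
     quotient_module (free_module B (carrier M \<times> carrier N)) (tensor_kernel A B \<phi> M N)"

text \<open>The map \<open>id \<otimes> f : M \<otimes>\<^sub>A N \<rightarrow> M \<otimes>\<^sub>A N'\<close> for \<open>f : N \<rightarrow> N'\<close>.\<close>

definition tensor_map ::
  "('a, 'r) ring_scheme \<Rightarrow> ('b, 's) ring_scheme \<Rightarrow> ('a \<Rightarrow> 'b) \<Rightarrow> ('b, 'm) module \<Rightarrow>
     ('a, 'c) module \<Rightarrow> ('n \<Rightarrow> 'c) \<Rightarrow> ('m \<times> 'n \<Rightarrow> 'b) set \<Rightarrow> ('m \<times> 'c \<Rightarrow> 'b) set" where
  "tensor_map A B \<phi> M N' f =
     quotient_map (free_module B (carrier M \<times> carrier N')) (tensor_kernel A B \<phi> M N')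
       (free_map B (\<lambda>(m, n). (m, f n)))"


section \<open>Complexes\<close>

record ('a, 'b) cochain =
  Obj :: "int \<Rightarrow> ('a, 'b) module"
  Dif :: "int \<Rightarrow> 'b \<Rightarrow> 'b"

definition cochain_complex :: "('a, 'r) ring_scheme \<Rightarrow> ('a, 'b) cochain \<Rightarrow> bool" where
  "cochain_complex R C \<longleftrightarrow>
     (\<forall>i. module R (Obj C i)) \<and>
     (\<forall>i. Dif C i \<in> mod_hom R (Obj C i) (Obj C (i + 1))) \<and>
     (\<forall>i. \<forall>x\<in>carrier (Obj C i). Dif C (i + 1) (Dif C i x) = \<zero>\<^bsub>Obj C (i + 2)\<^esub>)"

definition chain_map ::
  "('a, 'r) ring_scheme \<Rightarrow> ('a, 'b) cochain \<Rightarrow> ('a, 'c) cochain \<Rightarrow> (int \<Rightarrow> 'b \<Rightarrow> 'c) \<Rightarrow> bool" where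
  "chain_map R C D f \<longleftrightarrow>
     (\<forall>i. f i \<in> mod_hom R (Obj C i) (Obj D i)) \<and>
     (\<forall>i. \<forall>x\<in>carrier (Obj C i). f (i + 1) (Dif C i x) = Dif D i (f i x))"

definition cocycles :: "('a, 'b) cochain \<Rightarrow> int \<Rightarrow> ('a, 'b) module" where
  "cocycles C i =
     (Obj C i)\<lparr>carrier := {x \<in> carrier (Obj C i). Dif C i x = \<zero>\<^bsub>Obj C (i + 1)\<^esub>}\<rparr>"

definition coboundaries :: "('a, 'b) cochain \<Rightarrow> int \<Rightarrow> 'b set" where
  "coboundaries C i = Dif C (i - 1) ` carrier (Obj C (i - 1))"

definition cohomology :: "('a, 'b) cochain \<Rightarrow> int \<Rightarrow> ('a, 'b set) module" where
  "cohomology C i = quotient_module (cocycles C i) (coboundaries C i)"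

definition cohomology_vanishes :: "('a, 'b) cochain \<Rightarrow> int \<Rightarrow> bool" where
  "cohomology_vanishes C i \<longleftrightarrow> carrier (cohomology C i) = {\<zero>\<^bsub>cohomology C i\<^esub>}"

definition acyclic_complex :: "('a, 'b) cochain \<Rightarrow> bool" where
  "acyclic_complex C \<longleftrightarrow> (\<forall>i. cohomology_vanishes C i)"

definition quasi_isomorphism ::
  "('a, 'r) ring_scheme \<Rightarrow> ('a, 'b) cochain \<Rightarrow> ('a, 'c) cochain \<Rightarrow> (int \<Rightarrow> 'b \<Rightarrow> 'c) \<Rightarrow> bool" where
  "quasi_isomorphism R C D f \<longleftrightarrow>
     chain_map R C D f \<and>
     (\<forall>i. bij_betw (quotient_map (cocycles D i) (coboundaries D i) (f i))
            (carrier (cohomology C i)) (carrier (cohomology D i)))"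

definition completion_complex ::
  "('a, 'r) ring_scheme \<Rightarrow> 'a set \<Rightarrow> ('a, 'b) cochain \<Rightarrow> ('a, nat \<Rightarrow> 'b set) cochain" where
  "completion_complex R I C =
     \<lparr>Obj = (\<lambda>i. completion R I (Obj C i)),
      Dif = (\<lambda>i. completion_map R I (Obj C (i + 1)) (Dif C i))\<rparr>"

text \<open>\<open>B \<otimes>\<^sub>A C\<close>, a complex of \<open>B\<close>-modules.\<close>

definition base_change_complex ::
  "('a, 'r) ring_scheme \<Rightarrow> ('b, 's) ring_scheme \<Rightarrow> ('a \<Rightarrow> 'b) \<Rightarrow> ('a, 'n) cochain \<Rightarrow>
     ('b, ('b \<times> 'n \<Rightarrow> 'b) set) cochain" where
  "base_change_complex A B \<phi> C =
     \<lparr>Obj = (\<lambda>i. tensor_module A B \<phi> (self_module B) (Obj C i)),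
      Dif = (\<lambda>i. tensor_map A B \<phi> (self_module B) (Obj C (i + 1)) (Dif C i))\<rparr>"

text \<open>The degree \<open>n\<close> part of the Hom complex is the product over \<open>i\<close> of the modules of
  homomorphisms \<open>C\<^sup>i \<rightarrow> D\<^sup>i\<^sup>+\<^sup>n\<close>, and \<open>d(f) = d\<^sub>D \<circ> f - (-1)\<^sup>n f \<circ> d\<^sub>C\<close>. Homomorphisms are made
  extensional, so that equality of functions is equality on the carrier.\<close>

definition hom_complex ::
  "('a, 'r) ring_scheme \<Rightarrow> ('a, 'b) cochain \<Rightarrow> ('a, 'c) cochain \<Rightarrow>
     ('a, int \<Rightarrow> 'b \<Rightarrow> 'c) cochain" where
  "hom_complex R C D =
     \<lparr>Obj = (\<lambda>n. make_module
        {f. \<forall>i. f i \<in> mod_hom R (Obj C i) (Obj D (i + n)) \<inter> extensional (carrier (Obj C i))}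
        (\<lambda>i. \<lambda>x\<in>carrier (Obj C i). \<zero>\<^bsub>Obj D (i + n)\<^esub>)
        (\<lambda>f g i. \<lambda>x\<in>carrier (Obj C i). f i x \<oplus>\<^bsub>Obj D (i + n)\<^esub> g i x)
        (\<lambda>r f i. \<lambda>x\<in>carrier (Obj C i). r \<odot>\<^bsub>Obj D (i + n)\<^esub> f i x)),
      Dif = (\<lambda>n f i. \<lambda>x\<in>carrier (Obj C i).
        if even n
        then Dif D (i + n) (f i x) \<ominus>\<^bsub>Obj D (i + n + 1)\<^esub> f (i + 1) (Dif C i x)
        else Dif D (i + n) (f i x) \<oplus>\<^bsub>Obj D (i + n + 1)\<^esub> f (i + 1) (Dif C i x))\<rparr>"


section \<open>K-projective resolutions and derived functors\<close>

text \<open>\<open>P\<close> is K-projective if \<open>Hom(P, N)\<close> is acyclic for every acyclic complex \<open>N\<close>. In HOL the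
  complexes \<open>N\<close> must have their elements in a fixed type. The type of lists below has
  cardinality \<open>max(|'a|, |'b|, \<aleph>\<^sub>0)\<close>, which loses nothing: the image of a cocycle of
  \<open>Hom(P, N)\<close> lies in an acyclic subcomplex of \<open>N\<close> of at most this cardinality, and a cochain that
  bounds it there also bounds it in \<open>N\<close>.\<close>

definition K_projective ::
  "('a, 'r) ring_scheme \<Rightarrow> ('a, 'b) cochain \<Rightarrow> bool" where
  "K_projective R P \<longleftrightarrow>
     cochain_complex R P \<and>
     (\<forall>N :: ('a, ('a + 'b) list) cochain.
        cochain_complex R N \<and> acyclic_complex N \<longrightarrow> acyclic_complex (hom_complex R P N))"

definition K_projective_resolution ::
  "('a, 'r) ring_scheme \<Rightarrow> ('a, 'm) cochain \<Rightarrow> ('a, 'b) cochain \<Rightarrow> (int \<Rightarrow> 'b \<Rightarrow> 'm) \<Rightarrow> bool" where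
  "K_projective_resolution R M Q q \<longleftrightarrow> K_projective R Q \<and> quasi_isomorphism R Q M q"

text \<open>Every complex \<open>M\<close> of modules with elements in \<open>'m\<close> has a K-projective (even semi-free)
  resolution of cardinality at most \<open>max(|'a|, |'m|, \<aleph>\<^sub>0)\<close>, hence one with elements in the type
  \<open>('a + 'm) list\<close>. Any two resolutions are homotopy equivalent over \<open>M\<close>, so the notions below do not
  depend on the resolution \<open>Q\<close>.

  The canonical morphism \<open>M \<rightarrow> L\<Lambda>(M)\<close> of the derived category is represented by
  \<open>\<tau>\<^sub>Q : Q \<rightarrow> \<Lambda>(Q)\<close>; it is an isomorphism iff this chain map is a quasi-isomorphism.\<close>

definition cohomologically_complete ::
  "('a, 'r) ring_scheme \<Rightarrow> 'a set \<Rightarrow> ('a, 'm) cochain \<Rightarrow> bool" where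
  "cohomologically_complete R I M \<longleftrightarrow>
     (\<exists>(Q :: ('a, ('a + 'm) list) cochain) q.
        K_projective_resolution R M Q q \<and>
        quasi_isomorphism R Q (completion_complex R I Q) (\<lambda>i. completion_unit R I (Obj Q i)))"

text \<open>\<open>T\<close> is a complex \<open>B \<otimes>\<^sub>A Q\<close> computing the derived tensor product of \<open>B\<close> and \<open>M\<close> over \<open>A\<close>.\<close>

definition derived_base_change ::
  "('a, 'r) ring_scheme \<Rightarrow> ('b, 's) ring_scheme \<Rightarrow> ('a \<Rightarrow> 'b) \<Rightarrow> ('a, 'm) cochain \<Rightarrow>
     ('b, ('b \<times> ('a + 'm) list \<Rightarrow> 'b) set) cochain \<Rightarrow> bool" where
  "derived_base_change A B \<phi> M T \<longleftrightarrow>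
     (\<exists>(Q :: ('a, ('a + 'm) list) cochain) q.
        K_projective_resolution A M Q q \<and> T = base_change_complex A B \<phi> Q)"

end

(* Let Q be a K-projective resolution of M and Z the cocycles of Q in degree i0, the top degree of
   the cohomology. Replacing everything of Q below degree i0 by Z in degree i0 - 1 gives an acyclic
   complex to which Q maps; the contraction of this map, which exists because Q is K-projective,
   restricts to a retraction of the top term of Q onto Z. Hence H^i0(Q) modulo the ideal is a
   quotient of H^i0(A0 (x) Q), so it is finitely generated.

   Generators modulo the ideal lift to generators: a cocycle z is, modulo successively higher powers
   of the ideal, a combination of cocycles z_j plus a coboundary. The coefficients converge in A,
   and z minus the limit combination becomes a coboundary in the completion of Q, hence is one in Q
   since Q -> Lambda(Q) is injective on cohomology. *)
theory Submission
  imports Defs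
begin

section \<open>Modules\<close>

text \<open>The terms of a K-projective complex need not vanish above the top degree of its
  cohomology, so Z may be a proper submodule of the top term, and a tensor in A0 (x) Q may involve
  elements that are not cocycles. Right exactness of the tensor product alone therefore does not
  relate the two cohomology modules; the retraction does, because it extends the class map from Z to
  the whole term.

  In the lifting argument the remainder at stage k is kept in the k-th power of the ideal times Z
  itself, not merely in the intersection of Z with that power times Q. This is what allows the next
  stage to start. The cochains whose boundaries are split off need not converge in Q; their partial
  sums only define an element of a completed term, while the finitely many coefficients converge in
  A.

  The resolution that witnesses completeness and the one that computes the derived tensor product
  are given independently. They are compared through the cohomology of M.\<close>

lemmas make_module_simps [simp] =
  make_module_def [THEN arg_cong [where f = carrier], simplified]
  make_module_def [THEN arg_cong [where f = ring.zero], simplified]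
  make_module_def [THEN arg_cong [where f = ring.add], simplified]
  make_module_def [THEN arg_cong [where f = smult], simplified]

section \<open>Homomorphisms and submodules\<close>

lemma mod_homI:
  assumes "\<And>x. x \<in> carrier M \<Longrightarrow> f x \<in> carrier N"
    and "\<And>x y. x \<in> carrier M \<Longrightarrow> y \<in> carrier M \<Longrightarrow> f (x \<oplus>\<^bsub>M\<^esub> y) = f x \<oplus>\<^bsub>N\<^esub> f y"
    and "\<And>r x. r \<in> carrier R \<Longrightarrow> x \<in> carrier M \<Longrightarrow> f (r \<odot>\<^bsub>M\<^esub> x) = r \<odot>\<^bsub>N\<^esub> f x"
  shows "f \<in> mod_hom R M N"
  using assms by (auto simp: mod_hom_def)

lemma mod_hom_closed: "f \<in> mod_hom R M N \<Longrightarrow> x \<in> carrier M \<Longrightarrow> f x \<in> carrier N"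
  by (auto simp: mod_hom_def)

lemma mod_hom_add:
  "f \<in> mod_hom R M N \<Longrightarrow> x \<in> carrier M \<Longrightarrow> y \<in> carrier M \<Longrightarrow> f (x \<oplus>\<^bsub>M\<^esub> y) = f x \<oplus>\<^bsub>N\<^esub> f y"
  by (auto simp: mod_hom_def)

lemma mod_hom_smult:
  "f \<in> mod_hom R M N \<Longrightarrow> r \<in> carrier R \<Longrightarrow> x \<in> carrier M \<Longrightarrow> f (r \<odot>\<^bsub>M\<^esub> x) = r \<odot>\<^bsub>N\<^esub> f x"
  by (auto simp: mod_hom_def)

lemma mod_hom_comp:
  "f \<in> mod_hom R M N \<Longrightarrow> g \<in> mod_hom R N P \<Longrightarrow> (\<lambda>x. g (f x)) \<in> mod_hom R M P"
  by (auto simp: mod_hom_def Pi_def)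

lemma mod_hom_zero:
  assumes "module R M" "module R N" "f \<in> mod_hom R M N"
  shows "f \<zero>\<^bsub>M\<^esub> = \<zero>\<^bsub>N\<^esub>"
proof -
  interpret M: module R M by fact
  interpret N: module R N by fact
  have "f (\<zero>\<^bsub>R\<^esub> \<odot>\<^bsub>M\<^esub> \<zero>\<^bsub>M\<^esub>) = \<zero>\<^bsub>R\<^esub> \<odot>\<^bsub>N\<^esub> f \<zero>\<^bsub>M\<^esub>"
    using assms(3) by (rule mod_hom_smult) auto
  then show ?thesis
    using mod_hom_closed[OF assms(3), of "\<zero>\<^bsub>M\<^esub>"] by simp
qed

lemma mod_hom_uminus:
  assumes "module R M" "module R N" "f \<in> mod_hom R M N" "x \<in> carrier M"
  shows "f (\<ominus>\<^bsub>M\<^esub> x) = \<ominus>\<^bsub>N\<^esub> f x"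
proof -
  interpret M: module R M by fact
  interpret N: module R N by fact
  have "f (\<ominus>\<^bsub>R\<^esub> \<one>\<^bsub>R\<^esub> \<odot>\<^bsub>M\<^esub> x) = \<ominus>\<^bsub>R\<^esub> \<one>\<^bsub>R\<^esub> \<odot>\<^bsub>N\<^esub> f x"
    using assms(3) by (rule mod_hom_smult) (use assms in auto)
  then show ?thesis
    using mod_hom_closed[OF assms(3,4)] assms(4) by (simp add: M.smult_l_minus N.smult_l_minus)
qed

lemma mod_hom_minus:
  assumes "module R M" "module R N" "f \<in> mod_hom R M N" "x \<in> carrier M" "y \<in> carrier M"
  shows "f (x \<ominus>\<^bsub>M\<^esub> y) = f x \<ominus>\<^bsub>N\<^esub> f y"
proof -
  interpret M: module R M by fact
  show ?thesis
    using assms by (simp add: a_minus_def mod_hom_add mod_hom_uminus)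
qed

text \<open>Pins the record type of \<open>M\<close> to the one without extension fields, on which
  \<open>mod_hom\<close>, \<open>module_span\<close> and \<open>quotient_module\<close> are
  defined.\<close>

locale plain_module = module R M
  for R :: "('a, 'r) ring_scheme" (structure) and M :: "('a, 'b) module" (structure)

lemma (in plain_module) minus_eq_zero_iff:
  assumes "x \<in> carrier M" "y \<in> carrier M"
  shows "x \<ominus>\<^bsub>M\<^esub> y = \<zero>\<^bsub>M\<^esub> \<longleftrightarrow> x = y"
  using assms M.minus_equality[of x "\<ominus>\<^bsub>M\<^esub> y"] by (auto simp: a_minus_def M.r_neg)

text \<open>Negation is multiplication by \<open>\<ominus> \<one>\<close>, so closure under scalars
  already yields closure under inverses.\<close>

lemma (in plain_module) submoduleI':
  assumes "H \<subseteq> carrier M" "\<zero>\<^bsub>M\<^esub> \<in> H"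
    and "\<And>a b. a \<in> H \<Longrightarrow> b \<in> H \<Longrightarrow> a \<oplus>\<^bsub>M\<^esub> b \<in> H"
    and sm: "\<And>a x. a \<in> carrier R \<Longrightarrow> x \<in> H \<Longrightarrow> a \<odot>\<^bsub>M\<^esub> x \<in> H"
  shows "submodule H R M"
proof (rule submoduleI)
  fix a assume "a \<in> H"
  then have "\<ominus>\<^bsub>M\<^esub> a = (\<ominus> \<one>) \<odot>\<^bsub>M\<^esub> a"
    using assms(1) by (auto simp: smult_l_minus)
  then show "\<ominus>\<^bsub>M\<^esub> a \<in> H" using sm[OF _ \<open>a \<in> H\<close>] by simp
qed (use assms in auto)

lemma (in plain_module) submodule_zero: "submodule H R M \<Longrightarrow> \<zero>\<^bsub>M\<^esub> \<in> H"
  using subgroup.one_closed[OF submodule.axioms(1)] by fastforce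

lemma submodule_restrict:
  assumes "module R M" "submodule H R M"
  shows "module R (M\<lparr>carrier := H\<rparr>)"
  using assms by (simp add: submodule.submodule_is_module)

lemma submodule_vimage:
  assumes "module R M" "module R N" "f \<in> mod_hom R M N" "submodule H R N"
  shows "submodule {x \<in> carrier M. f x \<in> H} R M"
proof -
  interpret M: plain_module R M by (rule plain_module.intro) fact
  interpret N: plain_module R N by (rule plain_module.intro) fact
  show ?thesis
    using assms N.submodule_zero[OF assms(4)] N.submoduleE[OF assms(4)]
    by (intro M.submoduleI') (auto simp: mod_hom_zero mod_hom_add mod_hom_smult)
qed

lemma submodule_image:
  assumes "module R M" "module R N" "f \<in> mod_hom R M N" "submodule H R M"
  shows "submodule (f ` H) R N"
proof -
  interpret M: plain_module R M by (rule plain_module.intro) fact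
  interpret N: plain_module R N by (rule plain_module.intro) fact
  have sub: "H \<subseteq> carrier M" using assms(4) M.submoduleE by blast
  show ?thesis
  proof (rule N.submoduleI')
    show "\<zero>\<^bsub>N\<^esub> \<in> f ` H"
      using M.submodule_zero[OF assms(4)] mod_hom_zero[OF assms(1-3)] by (metis imageI)
    fix a b assume "a \<in> f ` H" "b \<in> f ` H"
    then obtain x y where "x \<in> H" "y \<in> H" "a = f x" "b = f y" by auto
    then show "a \<oplus>\<^bsub>N\<^esub> b \<in> f ` H"
      using mod_hom_add[OF assms(3) subsetD[OF sub] subsetD[OF sub], of x y]
        M.submoduleE(5)[OF assms(4), of x y]
      by (intro image_eqI[of _ _ "x \<oplus>\<^bsub>M\<^esub> y"]) auto
  next
    fix r b assume "r \<in> carrier R" "b \<in> f ` H"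
    then obtain y where "y \<in> H" "b = f y" by auto
    then show "r \<odot>\<^bsub>N\<^esub> b \<in> f ` H"
      using mod_hom_smult[OF assms(3) _ subsetD[OF sub], of r y] M.submoduleE(4)[OF assms(4), of r y]
        \<open>r \<in> carrier R\<close>
      by (intro image_eqI[of _ _ "r \<odot>\<^bsub>M\<^esub> y"]) auto
  qed (use sub mod_hom_closed[OF assms(3)] in auto)
qed

lemma (in plain_module) submodule_singleton_zero: "submodule {\<zero>\<^bsub>M\<^esub>} R M"
  by (rule submoduleI') auto

lemma (in plain_module) submodule_span:
  assumes "S \<subseteq> carrier M"
  shows "submodule (module_span R M S) R M"
proof -
  have *: "module_span R M S = \<Inter>{H. submodule H R M \<and> S \<subseteq> H}"
    by (simp add: module_span_def hull_def)
  \<comment> \<open>The whole module belongs to the family, which keeps the intersection inside the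
    carrier.\<close>
  have "carrier M \<in> {H. submodule H R M \<and> S \<subseteq> H}"
    using assms carrier_is_submodule by auto
  then show ?thesis unfolding *
    by (intro submoduleI') (auto intro: submodule_zero simp: submoduleE)
qed

lemma module_span_superset: "S \<subseteq> module_span R M S"
  by (auto simp: module_span_def hull_inc)

lemma module_span_minimal: "submodule H R M \<Longrightarrow> S \<subseteq> H \<Longrightarrow> module_span R M S \<subseteq> H"
  by (simp add: module_span_def hull_minimal)

section \<open>Quotient modules\<close>

lemma a_r_coset_mem: "y \<in> N +>\<^bsub>M\<^esub> x \<longleftrightarrow> (\<exists>n\<in>N. y = n \<oplus>\<^bsub>M\<^esub> x)"
  by (auto simp: a_r_coset_def')

lemma (in plain_module) submodule_subgroup: "submodule N R M \<Longrightarrow> subgroup N (add_monoid M)"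
  by (simp add: submodule_def)

lemma (in plain_module) coset_self: "submodule N R M \<Longrightarrow> x \<in> carrier M \<Longrightarrow> x \<in> N +>\<^bsub>M\<^esub> x"
  using submodule_zero by (force simp: a_r_coset_mem)

lemma (in plain_module) coset_eqI:
  assumes "submodule N R M" "x \<in> carrier M" "y \<in> carrier M" "x \<ominus>\<^bsub>M\<^esub> y \<in> N"
  shows "N +>\<^bsub>M\<^esub> x = N +>\<^bsub>M\<^esub> y"
proof -
  have "x = (x \<ominus>\<^bsub>M\<^esub> y) \<oplus>\<^bsub>M\<^esub> y"
    using assms by (simp add: a_minus_def M.a_assoc M.l_neg)
  then have "x \<in> N +>\<^bsub>M\<^esub> y" using assms(4) a_r_coset_mem by metis
  then show ?thesis
    using M.a_repr_independence assms submodule_subgroup by metis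
qed

lemma (in plain_module) coset_eqD:
  assumes "submodule N R M" "x \<in> carrier M" "y \<in> carrier M" "N +>\<^bsub>M\<^esub> x = N +>\<^bsub>M\<^esub> y"
  shows "x \<ominus>\<^bsub>M\<^esub> y \<in> N"
proof -
  obtain n where n: "n \<in> N" "x = n \<oplus>\<^bsub>M\<^esub> y"
    using coset_self[OF assms(1,2)] assms(4) by (auto simp: a_r_coset_mem)
  then have "n \<in> carrier M" using submoduleE(1)[OF assms(1)] by auto
  then have "x \<ominus>\<^bsub>M\<^esub> y = n" using n assms by (simp add: a_minus_def M.a_assoc M.r_neg)
  then show ?thesis using n by simp
qed

lemma (in plain_module) coset_eq_self_iff:
  assumes "submodule N R M" "x \<in> carrier M"
  shows "N +>\<^bsub>M\<^esub> x = N \<longleftrightarrow> x \<in> N"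
  using M.a_coset_join1 M.a_coset_join2 assms submodule_subgroup by metis

text \<open>Two representatives differ by some n in \<open>N\<close>, and \<open>f n\<close> in
  \<open>N'\<close> leaves the coset unchanged, so the union ranges over a single coset and may be
  evaluated at any representative.\<close>

lemma quotient_map_coset:
  assumes "module R M" "module R M'" "submodule N R M" "submodule N' R M'"
    and f: "f \<in> mod_hom R M M'" "f ` N \<subseteq> N'" and x: "x \<in> carrier M"
  shows "quotient_map M' N' f (N +>\<^bsub>M\<^esub> x) = N' +>\<^bsub>M'\<^esub> f x"
proof -
  interpret M: plain_module R M by (rule plain_module.intro) fact
  interpret M': plain_module R M' by (rule plain_module.intro) fact
  have "N' +>\<^bsub>M'\<^esub> f y = N' +>\<^bsub>M'\<^esub> f x" if y: "y \<in> N +>\<^bsub>M\<^esub> x" for y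
  proof -
    obtain n where n: "n \<in> N" "y = n \<oplus>\<^bsub>M\<^esub> x" using y by (auto simp: a_r_coset_mem)
    then have nc: "n \<in> carrier M" using M.submoduleE(1)[OF assms(3)] by auto
    have "f y = f n \<oplus>\<^bsub>M'\<^esub> f x" using f n nc x by (simp add: mod_hom_add)
    then have "f y \<ominus>\<^bsub>M'\<^esub> f x = f n"
      using mod_hom_closed[OF f(1)] nc x
      by (simp add: a_minus_def M'.M.a_assoc M'.M.r_neg)
    then show ?thesis
      using f n nc x by (intro M'.coset_eqI) (use assms(4) mod_hom_closed[OF f(1)] in auto)
  qed
  moreover have "x \<in> N +>\<^bsub>M\<^esub> x" using M.coset_self assms by blast
  ultimately show ?thesis unfolding quotient_map_def by blast
qed

context plain_module begin

lemma quotient_carrier: "carrier (quotient_module M N) = (\<lambda>x. N +>\<^bsub>M\<^esub> x) ` carrier M"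
  by (auto simp: quotient_module_def A_RCOSETS_def')

lemma quotient_zero: "\<zero>\<^bsub>quotient_module M N\<^esub> = N"
  by (simp add: quotient_module_def)

lemma quotient_add:
  assumes N: "submodule N R M" and "x \<in> carrier M" "y \<in> carrier M"
  shows "(N +>\<^bsub>M\<^esub> x) \<oplus>\<^bsub>quotient_module M N\<^esub> (N +>\<^bsub>M\<^esub> y) = N +>\<^bsub>M\<^esub> (x \<oplus>\<^bsub>M\<^esub> y)"
proof -
  interpret abelian_subgroup N M
    by (rule abelian_subgroupI2)
      (use M.a_comm_group submodule_subgroup[OF N] in auto)
  show ?thesis using assms by (simp add: quotient_module_def a_rcos_sum)
qed

lemma quotient_smult:
  assumes N: "submodule N R M" and "r \<in> carrier R" "x \<in> carrier M"
  shows "r \<odot>\<^bsub>quotient_module M N\<^esub> (N +>\<^bsub>M\<^esub> x) = N +>\<^bsub>M\<^esub> (r \<odot>\<^bsub>M\<^esub> x)"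
proof -
  \<comment> \<open>Multiplication by \<open>r\<close> is linear because the ring is commutative,
    and the union defining the action on cosets is \<open>quotient_map\<close> for this
    endomorphism.\<close>
  have "(\<lambda>y. r \<odot>\<^bsub>M\<^esub> y) \<in> mod_hom R M M"
    using assms by (intro mod_homI) (auto simp: smult_r_distr smult_assoc1[symmetric] m_comm)
  from quotient_map_coset[OF _ _ N N this _ assms(3)] module_axioms show ?thesis
    using submoduleE(4)[OF N] assms by (auto simp: quotient_module_def quotient_map_def)
qed

lemma module_quotient:
  assumes N: "submodule N R M"
  shows "module R (quotient_module M N)"
proof (rule moduleI)
  show "cring R" by (rule R.cring_axioms)
  show "abelian_group (quotient_module M N)"
  proof (rule abelian_groupI)
    fix x assume "x \<in> carrier (quotient_module M N)"
    then obtain a where a: "a \<in> carrier M" "x = N +>\<^bsub>M\<^esub> a" by (auto simp: quotient_carrier)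
    have z: "N = N +>\<^bsub>M\<^esub> \<zero>\<^bsub>M\<^esub>" using submoduleE(1)[OF N] by simp
    have "(N +>\<^bsub>M\<^esub> (\<ominus>\<^bsub>M\<^esub> a)) \<oplus>\<^bsub>quotient_module M N\<^esub> x = \<zero>\<^bsub>quotient_module M N\<^esub>"
      using a z by (simp add: quotient_add[OF N] quotient_zero M.l_neg)
    then show "\<exists>y\<in>carrier (quotient_module M N). y \<oplus>\<^bsub>quotient_module M N\<^esub> x = \<zero>\<^bsub>quotient_module M N\<^esub>"
      using a by (auto simp: quotient_carrier)
    show "\<zero>\<^bsub>quotient_module M N\<^esub> \<oplus>\<^bsub>quotient_module M N\<^esub> x = x"
      using quotient_add[OF N, of "\<zero>\<^bsub>M\<^esub>" a] a z by (simp add: quotient_zero)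
  next
    have "N = N +>\<^bsub>M\<^esub> \<zero>\<^bsub>M\<^esub>" using submoduleE(1)[OF N] by simp
    then show "\<zero>\<^bsub>quotient_module M N\<^esub> \<in> carrier (quotient_module M N)"
      by (auto simp: quotient_zero quotient_carrier)
  qed (auto simp: quotient_carrier quotient_add[OF N] M.a_ac)
qed (auto simp: quotient_carrier quotient_add[OF N] quotient_smult[OF N] smult_l_distr smult_r_distr smult_assoc1)

lemma coset_hom:
  assumes N: "submodule N R M"
  shows "a_r_coset M N \<in> mod_hom R M (quotient_module M N)"
  by (intro mod_homI) (auto simp: quotient_carrier quotient_add[OF N] quotient_smult[OF N])

end

lemma quotient_map_hom:
  assumes "module R M" "module R M'" "submodule N R M" "submodule N' R M'"
    and f: "f \<in> mod_hom R M M'" "f ` N \<subseteq> N'"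
  shows "quotient_map M' N' f \<in> mod_hom R (quotient_module M N) (quotient_module M' N')"
proof -
  interpret M: plain_module R M by (rule plain_module.intro) fact
  interpret M': plain_module R M' by (rule plain_module.intro) fact
  note [simp] = quotient_map_coset[OF assms] mod_hom_closed[OF f(1)]
    mod_hom_add[OF f(1)] mod_hom_smult[OF f(1)]
    M.quotient_carrier M'.quotient_carrier
    M.quotient_add[OF assms(3)] M'.quotient_add[OF assms(4)]
    M.quotient_smult[OF assms(3)] M'.quotient_smult[OF assms(4)]
  show ?thesis
    by (intro mod_homI) auto
qed

text \<open>The induced map evaluates \<open>f\<close> at a chosen representative; \<open>wd\<close>
  makes the choice immaterial, because two representatives differ by an element of \<open>N\<close>,
  which \<open>f\<close> kills.\<close>

lemma quotient_lift:
  assumes "module R M" "module R Y" "submodule N R M"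
    and f: "f \<in> mod_hom R M Y" "\<And>x. x \<in> N \<Longrightarrow> f x = \<zero>\<^bsub>Y\<^esub>"
  shows "\<exists>g \<in> mod_hom R (quotient_module M N) Y. \<forall>x\<in>carrier M. g (N +>\<^bsub>M\<^esub> x) = f x"
proof -
  interpret M: plain_module R M by (rule plain_module.intro) fact
  interpret Y: plain_module R Y by (rule plain_module.intro) fact
  have wd: "f x = f y" if "x \<in> carrier M" "y \<in> carrier M" "N +>\<^bsub>M\<^esub> x = N +>\<^bsub>M\<^esub> y" for x y
  proof -
    have "f (x \<ominus>\<^bsub>M\<^esub> y) = \<zero>\<^bsub>Y\<^esub>" using M.coset_eqD[OF assms(3) that] f by simp
    then have "f x \<ominus>\<^bsub>Y\<^esub> f y = \<zero>\<^bsub>Y\<^esub>" using mod_hom_minus[OF assms(1,2) f(1)] that by simp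
    then show ?thesis
      using Y.minus_eq_zero_iff[of "f x" "f y"] mod_hom_closed[OF f(1)] that by simp
  qed
  define g where "g K = f (SOME x. x \<in> carrier M \<and> N +>\<^bsub>M\<^esub> x = K)" for K
  have g: "g (N +>\<^bsub>M\<^esub> x) = f x" if "x \<in> carrier M" for x
  proof -
    have "(SOME y. y \<in> carrier M \<and> N +>\<^bsub>M\<^esub> y = N +>\<^bsub>M\<^esub> x) \<in> carrier M \<and>
      N +>\<^bsub>M\<^esub> (SOME y. y \<in> carrier M \<and> N +>\<^bsub>M\<^esub> y = N +>\<^bsub>M\<^esub> x) = N +>\<^bsub>M\<^esub> x"
      by (rule someI[where x = x]) (use that in auto)
    then show ?thesis unfolding g_def using wd that by blast
  qed
  have "g \<in> mod_hom R (quotient_module M N) Y"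
    by (intro mod_homI)
      (auto simp: M.quotient_carrier M.quotient_add[OF assms(3)]
        M.quotient_smult[OF assms(3)] g mod_hom_closed[OF f(1)] mod_hom_add[OF f(1)]
        mod_hom_smult[OF f(1)])
  then show ?thesis using g by blast
qed

text \<open>Finite generation of M/IM, expressed inside M so that no module over a quotient ring has
  to be formed. \<open>I\<close> is an arbitrary set of scalars: the ideal in the intermediate
  statements and the empty set for finite generation itself, so that one transfer lemma serves
  both.\<close>

definition generated_mod :: "('a, 'r) ring_scheme \<Rightarrow> 'a set \<Rightarrow> ('a, 'b) module \<Rightarrow> bool" where
  "generated_mod R I M \<longleftrightarrow> (\<exists>S. finite S \<and> S \<subseteq> carrier M \<and>
     module_span R M (S \<union> {r \<odot>\<^bsub>M\<^esub> x | r x. r \<in> I \<and> x \<in> carrier M}) = carrier M)"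

lemma fin_gen_module_iff: "fin_gen_module R M \<longleftrightarrow> module R M \<and> generated_mod R {} M"
  by (simp add: fin_gen_module_def generated_mod_def)

text \<open>The preimage of the span of \<open>G\<close> is a submodule that contains the generators
  of \<open>M\<close>, hence all of \<open>M\<close>; surjectivity turns this into a statement about
  \<open>N\<close>.\<close>

lemma generated_mod_surj:
  assumes "module R M" "module R N" and f: "f \<in> mod_hom R M N" "f ` carrier M = carrier N"
    and I: "I \<subseteq> carrier R" and gen: "generated_mod R I M"
  shows "generated_mod R I N"
proof -
  interpret M: plain_module R M by (rule plain_module.intro) fact
  interpret N: plain_module R N by (rule plain_module.intro) fact
  obtain S where S: "finite S" "S \<subseteq> carrier M"
    "module_span R M (S \<union> {r \<odot>\<^bsub>M\<^esub> x | r x. r \<in> I \<and> x \<in> carrier M}) = carrier M"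
    using gen by (auto simp: generated_mod_def)
  define G where "G = f ` S \<union> {r \<odot>\<^bsub>N\<^esub> x | r x. r \<in> I \<and> x \<in> carrier N}"
  have G: "G \<subseteq> carrier N"
    using S(2) I mod_hom_closed[OF f(1)] by (auto simp: G_def)
  have "submodule {x \<in> carrier M. f x \<in> module_span R N G} R M"
    by (rule submodule_vimage) (use assms N.submodule_span[OF G] in auto)
  then have "carrier M \<subseteq> {x \<in> carrier M. f x \<in> module_span R N G}"
  proof (subst S(3)[symmetric], rule module_span_minimal)
    have "r \<odot>\<^bsub>N\<^esub> f x \<in> G" if "r \<in> I" "x \<in> carrier M" for r x
      using that mod_hom_closed[OF f(1)] by (auto simp: G_def)
    moreover have "f ` S \<subseteq> G" by (auto simp: G_def)
    ultimately show "S \<union> {r \<odot>\<^bsub>M\<^esub> x | r x. r \<in> I \<and> x \<in> carrier M}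
        \<subseteq> {x \<in> carrier M. f x \<in> module_span R N G}"
      using S(2) I module_span_superset[of G R N]
      by (auto simp: mod_hom_smult[OF f(1) subsetD[OF I]])
  qed
  then have "carrier N \<subseteq> module_span R N G" unfolding f(2)[symmetric] by blast
  moreover have "module_span R N G \<subseteq> carrier N"
    by (intro module_span_minimal N.carrier_is_submodule G)
  ultimately show ?thesis
    unfolding generated_mod_def G_def using S mod_hom_closed[OF f(1)]
    by (intro exI[of _ "f ` S"]) auto
qed

lemma mod_hom_inverse:
  assumes "module R M" and f: "f \<in> mod_hom R M N" "bij_betw f (carrier M) (carrier N)"
  shows "inv_into (carrier M) f \<in> mod_hom R N M"
proof (rule mod_homI)
  interpret M: plain_module R M by (rule plain_module.intro) fact
  let ?g = "inv_into (carrier M) f"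
  have inj: "inj_on f (carrier M)" and im: "f ` carrier M = carrier N"
    using f(2) by (auto simp: bij_betw_def)
  have g: "?g y \<in> carrier M" "f (?g y) = y" if "y \<in> carrier N" for y
    using that im by (metis inv_into_into, metis f_inv_into_f)
  show "?g y \<in> carrier M" if "y \<in> carrier N" for y using g that by blast
  show "?g (x \<oplus>\<^bsub>N\<^esub> y) = ?g x \<oplus>\<^bsub>M\<^esub> ?g y" if "x \<in> carrier N" "y \<in> carrier N" for x y
    by (rule inv_into_f_eq[OF inj]) (use g that mod_hom_add[OF f(1)] in auto)
  show "?g (r \<odot>\<^bsub>N\<^esub> y) = r \<odot>\<^bsub>M\<^esub> ?g y" if "r \<in> carrier R" "y \<in> carrier N" for r y
    by (rule inv_into_f_eq[OF inj]) (use g that mod_hom_smult[OF f(1)] in auto)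
qed

section \<open>Cohomology\<close>

lemma cocycles_sel [simp]:
  "carrier (cocycles C i) = {x \<in> carrier (Obj C i). Dif C i x = \<zero>\<^bsub>Obj C (i + 1)\<^esub>}"
  "ring.zero (cocycles C i) = ring.zero (Obj C i)"
  "ring.add (cocycles C i) = ring.add (Obj C i)"
  "smult (cocycles C i) = smult (Obj C i)"
  by (auto simp: cocycles_def)

locale complex =
  fixes R :: "('a, 'r) ring_scheme" and C :: "('a, 'b) cochain"
  assumes cochain_complex: "cochain_complex R C"
begin

lemma module_Obj: "module R (Obj C i)"
  using cochain_complex by (simp add: cochain_complex_def)

sublocale Obj: plain_module R "Obj C i" for i
  by (rule plain_module.intro) (rule module_Obj)

lemma Dif_hom: "Dif C i \<in> mod_hom R (Obj C i) (Obj C (i + 1))"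
  using cochain_complex by (simp add: cochain_complex_def)

text \<open>Instance at \<open>i - 1\<close> with the target normalised to \<open>Obj C i\<close>,
  the form in which coboundaries use the differential.\<close>

lemma Dif_hom': "Dif C (i - 1) \<in> mod_hom R (Obj C (i - 1)) (Obj C i)"
  using Dif_hom[of "i - 1"] by simp

lemma Dif_Dif: "x \<in> carrier (Obj C i) \<Longrightarrow> Dif C (i + 1) (Dif C i x) = \<zero>\<^bsub>Obj C (i + 2)\<^esub>"
  using cochain_complex by (simp add: cochain_complex_def)

lemma Dif_Dif': "x \<in> carrier (Obj C (i - 1)) \<Longrightarrow> Dif C i (Dif C (i - 1) x) = \<zero>\<^bsub>Obj C (i + 1)\<^esub>"
  using Dif_Dif[of x "i - 1"] by (simp add: algebra_simps)

lemma submodule_cocycles: "submodule (carrier (cocycles C i)) R (Obj C i)"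
  using submodule_vimage[OF module_Obj module_Obj Dif_hom Obj.submodule_singleton_zero] by simp

lemma module_cocycles: "module R (cocycles C i)"
  using submodule_restrict[OF module_Obj submodule_cocycles] by (simp add: cocycles_def)

sublocale Z: plain_module R "cocycles C i" for i
  by (rule plain_module.intro) (rule module_cocycles)

lemma Dif_hom_cocycles: "Dif C (i - 1) \<in> mod_hom R (Obj C (i - 1)) (cocycles C i)"
  using mod_hom_closed[OF Dif_hom'] mod_hom_add[OF Dif_hom'] mod_hom_smult[OF Dif_hom'] Dif_Dif'
  by (intro mod_homI) auto

lemma submodule_coboundaries: "submodule (coboundaries C i) R (cocycles C i)"
  unfolding coboundaries_def
  by (rule submodule_image[OF module_Obj module_cocycles Dif_hom_cocycles Obj.carrier_is_submodule])

lemma module_cohomology: "module R (cohomology C i)"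
  unfolding cohomology_def by (rule Z.module_quotient[OF submodule_coboundaries])

lemma class_hom: "a_r_coset (cocycles C i) (coboundaries C i) \<in> mod_hom R (cocycles C i) (cohomology C i)"
  unfolding cohomology_def by (rule Z.coset_hom[OF submodule_coboundaries])

lemma cohomology_carrier:
  "carrier (cohomology C i) = a_r_coset (cocycles C i) (coboundaries C i) ` carrier (cocycles C i)"
  unfolding cohomology_def by (rule Z.quotient_carrier)

lemma cohomology_zero: "\<zero>\<^bsub>cohomology C i\<^esub> = coboundaries C i"
  unfolding cohomology_def by (rule Z.quotient_zero)

text \<open>Replaces the coset formulation of vanishing by exactness in degree \<open>i\<close>, the
  form in which acyclicity is checked below.\<close>

lemma cohomology_vanishes_iff:
  "cohomology_vanishes C i \<longleftrightarrow> carrier (cocycles C i) \<subseteq> coboundaries C i"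
proof -
  \<comment> \<open>The zero class always exists, so only the absence of further classes is at
    stake.\<close>
  have 0: "coboundaries C i \<in> carrier (cohomology C i)"
    using module_cohomology[of i] cohomology_zero[of i]
    by (metis abelian_monoid.zero_closed abelian_group.axioms(1) module.axioms(2))
  have "cohomology_vanishes C i \<longleftrightarrow>
      (\<forall>z\<in>carrier (cocycles C i). coboundaries C i +>\<^bsub>cocycles C i\<^esub> z = coboundaries C i)"
    using 0 unfolding cohomology_vanishes_def cohomology_zero
    by (auto simp: cohomology_carrier simp del: cocycles_sel)
  also have "\<dots> \<longleftrightarrow> carrier (cocycles C i) \<subseteq> coboundaries C i"
    using Z.coset_eq_self_iff[OF submodule_coboundaries] by blast
  finally show ?thesis .
qed

end

section \<open>Maps induced on cohomology and quasi-isomorphisms\<close>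

lemma chain_map_cocycles:
  assumes "cochain_complex R C" "cochain_complex R D" "chain_map R C D f"
  shows "f i \<in> mod_hom R (cocycles C i) (cocycles D i)"
proof -
  interpret C: complex R C by (rule complex.intro) fact
  interpret D: complex R D by (rule complex.intro) fact
  have f: "f i \<in> mod_hom R (Obj C i) (Obj D i)" for i
    using assms by (simp add: chain_map_def)
  have "Dif D i (f i x) = \<zero>\<^bsub>Obj D (i + 1)\<^esub>"
    if "x \<in> carrier (Obj C i)" "Dif C i x = \<zero>\<^bsub>Obj C (i + 1)\<^esub>" for x
  proof -
    have "Dif D i (f i x) = f (i + 1) (Dif C i x)"
      using assms(3) that(1) by (simp add: chain_map_def)
    then show ?thesis
      using that(2) mod_hom_zero[OF C.module_Obj D.module_Obj f, of "i + 1"] by simp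
  qed
  then show ?thesis
    using mod_hom_closed[OF f] mod_hom_add[OF f] mod_hom_smult[OF f]
    by (intro mod_homI) auto
qed

lemma chain_map_coboundaries:
  assumes "chain_map R C D f"
  shows "f i ` coboundaries C i \<subseteq> coboundaries D i"
proof -
  have "f i (Dif C (i - 1) x) = Dif D (i - 1) (f (i - 1) x)"
    "f (i - 1) x \<in> carrier (Obj D (i - 1))" if "x \<in> carrier (Obj C (i - 1))" for x
  proof -
    have "\<And>i x. x\<in>carrier (Obj C i) \<Longrightarrow> f (i + 1) (Dif C i x) = Dif D i (f i x)"
      using assms by (auto simp: chain_map_def)
    from this[of x "i - 1"] that show "f i (Dif C (i - 1) x) = Dif D (i - 1) (f (i - 1) x)" by simp
    show "f (i - 1) x \<in> carrier (Obj D (i - 1))"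
      using assms that by (auto simp: chain_map_def intro: mod_hom_closed)
  qed
  then show ?thesis by (auto simp: coboundaries_def)
qed

lemma chain_map_cohomology:
  assumes "cochain_complex R C" "cochain_complex R D" "chain_map R C D f"
  shows "quotient_map (cocycles D i) (coboundaries D i) (f i)
    \<in> mod_hom R (cohomology C i) (cohomology D i)"
proof -
  interpret C: complex R C by (rule complex.intro) fact
  interpret D: complex R D by (rule complex.intro) fact
  show ?thesis
    unfolding cohomology_def
    by (rule quotient_map_hom[OF C.module_cocycles D.module_cocycles C.submodule_coboundaries
        D.submodule_coboundaries chain_map_cocycles[OF assms] chain_map_coboundaries[OF assms(3)]])
qed

text \<open>The induced bijection and its inverse are both linear and surjective, so generators can
  be pushed either way. This is how different resolutions of one complex are compared.\<close>

lemma generated_mod_quasi_isomorphism: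
  assumes "cochain_complex R C" "cochain_complex R D" "quasi_isomorphism R C D f" "I \<subseteq> carrier R"
  shows "generated_mod R I (cohomology C i) \<longleftrightarrow> generated_mod R I (cohomology D i)"
proof -
  interpret C: complex R C by (rule complex.intro) fact
  interpret D: complex R D by (rule complex.intro) fact
  let ?h = "quotient_map (cocycles D i) (coboundaries D i) (f i)"
  have h: "?h \<in> mod_hom R (cohomology C i) (cohomology D i)"
    "bij_betw ?h (carrier (cohomology C i)) (carrier (cohomology D i))"
    using assms(3) chain_map_cohomology[OF assms(1,2)] by (auto simp: quasi_isomorphism_def)
  note inv = mod_hom_inverse[OF C.module_cohomology h] bij_betw_inv_into[OF h(2)]
  show ?thesis
    using generated_mod_surj[OF C.module_cohomology D.module_cohomology h(1) bij_betw_imp_surj_on[OF h(2)] assms(4)]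
      generated_mod_surj[OF D.module_cohomology C.module_cohomology inv(1) bij_betw_imp_surj_on[OF inv(2)] assms(4)]
    by blast
qed

text \<open>Every class of \<open>C\<close> has the same image as the zero class, since the target
  has one element, and the induced map is injective.\<close>

lemma cohomology_vanishes_quasi_isomorphism:
  assumes "cochain_complex R C" "quasi_isomorphism R C D f" "cohomology_vanishes D i"
  shows "cohomology_vanishes C i"
proof -
  interpret C: complex R C by (rule complex.intro) fact
  interpret H: plain_module R "cohomology C i" by (rule plain_module.intro) (rule C.module_cohomology)
  let ?h = "quotient_map (cocycles D i) (coboundaries D i) (f i)"
  have h: "inj_on ?h (carrier (cohomology C i))"
     "?h ` (carrier (cohomology C i)) = {\<zero>\<^bsub>cohomology D i\<^esub>}"
    using assms(2,3) by (auto simp: quasi_isomorphism_def bij_betw_def cohomology_vanishes_def)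
  have "x = \<zero>\<^bsub>cohomology C i\<^esub>" if "x \<in> carrier (cohomology C i)" for x
  proof (rule inj_onD[OF h(1) _ that H.M.zero_closed])
    have "?h x \<in> {\<zero>\<^bsub>cohomology D i\<^esub>}" "?h \<zero>\<^bsub>cohomology C i\<^esub> \<in> {\<zero>\<^bsub>cohomology D i\<^esub>}"
      using that H.M.zero_closed unfolding h(2)[symmetric] by blast+
    then show "?h x = ?h \<zero>\<^bsub>cohomology C i\<^esub>" by simp
  qed
  then show ?thesis by (auto simp: cohomology_vanishes_def)
qed

section \<open>Free modules\<close>

lemma free_module_sel [simp]:
  "carrier (free_module R S) =
     {f. finite {s. f s \<noteq> \<zero>\<^bsub>R\<^esub>} \<and> (\<forall>s\<in>S. f s \<in> carrier R) \<and> (\<forall>s. s \<notin> S \<longrightarrow> f s = \<zero>\<^bsub>R\<^esub>)}"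
  "\<zero>\<^bsub>free_module R S\<^esub> = (\<lambda>s. \<zero>\<^bsub>R\<^esub>)"
  "f \<oplus>\<^bsub>free_module R S\<^esub> g = (\<lambda>s. f s \<oplus>\<^bsub>R\<^esub> g s)"
  "r \<odot>\<^bsub>free_module R S\<^esub> f = (\<lambda>s. r \<otimes>\<^bsub>R\<^esub> f s)"
  by (simp_all add: free_module_def)

context cring begin

lemma free_module_apply: "f \<in> carrier (free_module R S) \<Longrightarrow> f s \<in> carrier R"
  by (cases "s \<in> S") auto

lemma module_free_module: "module R (free_module R S)"
proof (rule moduleI)
  show "cring R" by (rule is_cring)
  have fin: "finite {s. f s \<oplus> g s \<noteq> \<zero>}" if "finite {s. f s \<noteq> \<zero>}" "finite {s. g s \<noteq> \<zero>}" for f g :: "'c \<Rightarrow> 'a"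
    by (rule finite_subset[OF _ finite_UnI[OF that]]) auto
  show "abelian_group (free_module R S)"
  proof (rule abelian_groupI)
    fix f assume f: "f \<in> carrier (free_module R S)"
    have "(\<lambda>s. \<ominus> f s) \<in> carrier (free_module R S)"
      using f by (auto elim!: rev_finite_subset)
    moreover have "(\<lambda>s. \<ominus> f s) \<oplus>\<^bsub>free_module R S\<^esub> f = \<zero>\<^bsub>free_module R S\<^esub>"
      using free_module_apply[OF f] by (simp add: l_neg)
    ultimately show "\<exists>g\<in>carrier (free_module R S). g \<oplus>\<^bsub>free_module R S\<^esub> f = \<zero>\<^bsub>free_module R S\<^esub>"
      by blast
    show "\<zero>\<^bsub>free_module R S\<^esub> \<oplus>\<^bsub>free_module R S\<^esub> f = f"
      using free_module_apply[OF f] by simp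
  next
    fix f g h assume "f \<in> carrier (free_module R S)" "g \<in> carrier (free_module R S)"
    note fg = free_module_apply[OF this(1)] free_module_apply[OF this(2)]
    then show "f \<oplus>\<^bsub>free_module R S\<^esub> g = g \<oplus>\<^bsub>free_module R S\<^esub> f" by (simp add: a_comm)
  next
    fix f g h assume "f \<in> carrier (free_module R S)" "g \<in> carrier (free_module R S)"
    note fg = free_module_apply[OF this(1)] free_module_apply[OF this(2)]
    assume "h \<in> carrier (free_module R S)"
    from fg free_module_apply[OF this]
    show "f \<oplus>\<^bsub>free_module R S\<^esub> g \<oplus>\<^bsub>free_module R S\<^esub> h = f \<oplus>\<^bsub>free_module R S\<^esub> (g \<oplus>\<^bsub>free_module R S\<^esub> h)"
      by (simp add: a_assoc)
  qed (auto simp: fin)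
next
  fix f assume f: "f \<in> carrier (free_module R S)"
  show "\<one> \<odot>\<^bsub>free_module R S\<^esub> f = f" using free_module_apply[OF f] by simp
next
  fix a f assume a: "a \<in> carrier R" and f: "f \<in> carrier (free_module R S)"
  show "a \<odot>\<^bsub>free_module R S\<^esub> f \<in> carrier (free_module R S)"
    using a f by (auto elim!: rev_finite_subset)
  fix b assume b: "b \<in> carrier R"
  show "(a \<oplus> b) \<odot>\<^bsub>free_module R S\<^esub> f = a \<odot>\<^bsub>free_module R S\<^esub> f \<oplus>\<^bsub>free_module R S\<^esub> b \<odot>\<^bsub>free_module R S\<^esub> f"
    using a b free_module_apply[OF f] by (simp add: l_distr)
  show "(a \<otimes> b) \<odot>\<^bsub>free_module R S\<^esub> f = a \<odot>\<^bsub>free_module R S\<^esub> (b \<odot>\<^bsub>free_module R S\<^esub> f)"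
    using a b free_module_apply[OF f] by (simp add: m_assoc)
next
  fix a f g
  assume "a \<in> carrier R" "f \<in> carrier (free_module R S)" "g \<in> carrier (free_module R S)"
  then show "a \<odot>\<^bsub>free_module R S\<^esub> (f \<oplus>\<^bsub>free_module R S\<^esub> g) =
      a \<odot>\<^bsub>free_module R S\<^esub> f \<oplus>\<^bsub>free_module R S\<^esub> a \<odot>\<^bsub>free_module R S\<^esub> g"
    using free_module_apply[of f S] free_module_apply[of g S] by (simp add: r_distr)
qed

lemma free_basis_closed: "s \<in> S \<Longrightarrow> free_basis R s \<in> carrier (free_module R S)"
  by (auto simp: free_basis_def intro: finite_subset[of _ "{s}"])

text \<open>Induction on a finite set containing the support, clearing one coordinate at a time. The
  assumption concerns the components of \<open>f\<close> and not the basis vectors, so that it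
  applies to submodules such as I^n F, which may contain the components without containing the
  basis.\<close>

lemma free_module_mem_submoduleI:
  assumes H: "submodule H R (free_module R S)" and f: "f \<in> carrier (free_module R S)"
    and e: "\<And>s. s \<in> S \<Longrightarrow> f s \<odot>\<^bsub>free_module R S\<^esub> free_basis R s \<in> H"
  shows "f \<in> H"
proof -
  interpret F: plain_module R "free_module R S"
    by (rule plain_module.intro) (rule module_free_module)
  have "g \<in> H" if "finite U" "g \<in> carrier (free_module R S)" "{s. g s \<noteq> \<zero>} \<subseteq> U"
    "\<And>s. s \<in> S \<Longrightarrow> g s \<odot>\<^bsub>free_module R S\<^esub> free_basis R s \<in> H" for g U
    using that
  proof (induction U arbitrary: g)
    case empty
    then have "g = \<zero>\<^bsub>free_module R S\<^esub>" by auto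
    then show ?case using F.submodule_zero[OF H] by simp
  next
    case (insert u U)
    show ?case
    proof (cases "u \<in> S")
      case False
      then have "{s. g s \<noteq> \<zero>} \<subseteq> U" using insert.prems(1,2) by auto
      then show ?thesis by (rule insert.IH[OF insert.prems(1) _ insert.prems(3)])
    next
      case True
      define g' where "g' = g(u := \<zero>)"
      have "{s. g' s \<noteq> \<zero>} \<subseteq> {s. g s \<noteq> \<zero>}" by (auto simp: g'_def)
      then have g': "g' \<in> carrier (free_module R S)"
        using insert.prems(1) True finite_subset[of "{s. g' s \<noteq> \<zero>}" "{s. g s \<noteq> \<zero>}"]
        by (simp del: Collect_mono_iff) (simp add: g'_def)
      have *: "g' s \<odot>\<^bsub>free_module R S\<^esub> free_basis R s \<in> H" if "s \<in> S" for s
        using insert.prems(3)[OF that] F.submodule_zero[OF H]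
          F.smult_l_null[OF free_basis_closed[OF that]] by (cases "s = u") (simp_all add: g'_def del: free_module_sel)
      have "{s. g' s \<noteq> \<zero>} \<subseteq> U" using insert.prems(2) by (auto simp: g'_def)
      then have "g' \<in> H" by (rule insert.IH[OF g' _ *])
      then have "g u \<odot>\<^bsub>free_module R S\<^esub> free_basis R u \<oplus>\<^bsub>free_module R S\<^esub> g' \<in> H"
        using F.submoduleE(5)[OF H] insert.prems(3)[OF True] by blast
      moreover have "g u \<odot>\<^bsub>free_module R S\<^esub> free_basis R u \<oplus>\<^bsub>free_module R S\<^esub> g' = g"
        using free_module_apply[OF insert.prems(1)] by (auto simp: g'_def free_basis_def)
      ultimately show ?thesis by simp
    qed
  qed
  then show ?thesis using f e by auto
qed

lemma free_module_induct:
  assumes H: "submodule H R (free_module R S)" and e: "\<And>s. s \<in> S \<Longrightarrow> free_basis R s \<in> H"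
  shows "carrier (free_module R S) \<subseteq> H"
proof
  interpret F: plain_module R "free_module R S"
    by (rule plain_module.intro) (rule module_free_module)
  fix f assume f: "f \<in> carrier (free_module R S)"
  show "f \<in> H"
    using F.submoduleE(4)[OF H free_module_apply[OF f] e]
    by (rule free_module_mem_submoduleI[OF H f])
qed

lemma free_module_lift:
  assumes Y: "module R Y" and g: "g \<in> S \<rightarrow> carrier Y"
  shows "\<exists>h \<in> mod_hom R (free_module R S) Y. \<forall>s\<in>S. h (free_basis R s) = g s"
proof -
  interpret Y: plain_module R Y by (rule plain_module.intro) fact
  define h where "h f = (\<Oplus>\<^bsub>Y\<^esub>s\<in>{s. f s \<noteq> \<zero>}. f s \<odot>\<^bsub>Y\<^esub> g s)" for f
  \<comment> \<open>Supports of different functions give different index sets; padding with zeros to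
    any finite \<open>U\<close> in \<open>S\<close> makes the sums comparable.\<close>
  have h: "h f = (\<Oplus>\<^bsub>Y\<^esub>s\<in>U. f s \<odot>\<^bsub>Y\<^esub> g s)"
    if "f \<in> carrier (free_module R S)" "finite U" "U \<subseteq> S" "{s. f s \<noteq> \<zero>} \<subseteq> U" for f U
    unfolding h_def
  proof (rule Y.M.add.finprod_mono_neutral_cong_left)
    show "(\<lambda>s. f s \<odot>\<^bsub>Y\<^esub> g s) \<in> U \<rightarrow> carrier Y"
      using g that(3) free_module_apply[OF that(1)] by auto
    fix s assume "s \<in> U - {s. f s \<noteq> \<zero>}"
    then show "f s \<odot>\<^bsub>Y\<^esub> g s = \<zero>\<^bsub>Y\<^esub>" using g that(3) by (auto simp: Pi_iff subset_iff)
  qed (use that in auto)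
  have sup: "finite {s. f s \<noteq> \<zero>}" "{s. f s \<noteq> \<zero>} \<subseteq> S" if "f \<in> carrier (free_module R S)" for f
    using that by auto
  have cl: "(\<lambda>s. f s \<odot>\<^bsub>Y\<^esub> g s) \<in> U \<rightarrow> carrier Y"
    if "f \<in> carrier (free_module R S)" "U \<subseteq> S" for f U
    using g that(2) free_module_apply[OF that(1)] by auto
  interpret F: plain_module R "free_module R S"
    by (rule plain_module.intro) (rule module_free_module)
  have "h \<in> mod_hom R (free_module R S) Y"
  proof (rule mod_homI)
    fix f assume f: "f \<in> carrier (free_module R S)"
    note * = sup[OF f]
    show "h f \<in> carrier Y" unfolding h_def by (rule Y.M.finsum_closed) (rule cl[OF f *(2)])
    fix r assume r: "r \<in> carrier R"
    have nz: "f s \<noteq> \<zero>" if "r \<otimes> f s \<noteq> \<zero>" for s using that r by auto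
    have "h (r \<odot>\<^bsub>free_module R S\<^esub> f) = (\<Oplus>\<^bsub>Y\<^esub>s\<in>{s. f s \<noteq> \<zero>}. (r \<otimes> f s) \<odot>\<^bsub>Y\<^esub> g s)"
      using h[OF F.smult_closed[OF r f] *] nz by (auto simp: subset_iff)
    also have "\<dots> = (\<Oplus>\<^bsub>Y\<^esub>s\<in>{s. f s \<noteq> \<zero>}. r \<odot>\<^bsub>Y\<^esub> (f s \<odot>\<^bsub>Y\<^esub> g s))"
      using g *(2) r free_module_apply[OF f]
      by (intro Y.M.finsum_cong') (auto intro!: Y.smult_assoc1 simp: Pi_iff subset_iff)
    also have "\<dots> = r \<odot>\<^bsub>Y\<^esub> h f"
      unfolding h_def by (rule Y.finsum_smult_ldistr[OF *(1) r cl[OF f *(2)], symmetric])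
    finally show "h (r \<odot>\<^bsub>free_module R S\<^esub> f) = r \<odot>\<^bsub>Y\<^esub> h f" .
  next
    fix f f' assume f: "f \<in> carrier (free_module R S)" "f' \<in> carrier (free_module R S)"
    let ?U = "{s. f s \<noteq> \<zero>} \<union> {s. f' s \<noteq> \<zero>}"
    have U: "finite ?U" "?U \<subseteq> S" using sup[OF f(1)] sup[OF f(2)] by auto
    have nz: "{s. f s \<oplus> f' s \<noteq> \<zero>} \<subseteq> ?U" by auto
    have "h (f \<oplus>\<^bsub>free_module R S\<^esub> f') = (\<Oplus>\<^bsub>Y\<^esub>s\<in>?U. (f s \<oplus> f' s) \<odot>\<^bsub>Y\<^esub> g s)"
      using h[OF F.M.a_closed[OF f] U] nz by simp
    also have "\<dots> = (\<Oplus>\<^bsub>Y\<^esub>s\<in>?U. f s \<odot>\<^bsub>Y\<^esub> g s \<oplus>\<^bsub>Y\<^esub> f' s \<odot>\<^bsub>Y\<^esub> g s)"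
      using g U(2) cl[OF f(1) U(2)] cl[OF f(2) U(2)] free_module_apply[OF f(1)] free_module_apply[OF f(2)]
      by (intro Y.M.finsum_cong') (auto intro!: Y.smult_l_distr simp: Pi_iff subset_iff)
    also have "\<dots> = h f \<oplus>\<^bsub>Y\<^esub> h f'"
      using h[OF f(1) U] h[OF f(2) U] Y.M.finsum_addf[OF cl[OF f(1) U(2)] cl[OF f(2) U(2)]] by simp
    finally show "h (f \<oplus>\<^bsub>free_module R S\<^esub> f') = h f \<oplus>\<^bsub>Y\<^esub> h f'" .
  qed
  moreover have "h (free_basis R s) = g s" if "s \<in> S" for s
  proof -
    have "h (free_basis R s) = (\<Oplus>\<^bsub>Y\<^esub>t\<in>{s}. free_basis R s t \<odot>\<^bsub>Y\<^esub> g t)"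
      using that free_basis_closed[OF that] by (intro h) (auto simp: free_basis_def)
    also have "\<dots> = free_basis R s s \<odot>\<^bsub>Y\<^esub> g s"
      using funcset_mem[OF g that] by (simp add: free_basis_def)
    finally show ?thesis using funcset_mem[OF g that] by (simp add: free_basis_def)
  qed
  ultimately show ?thesis by blast
qed

lemma free_map_hom:
  assumes g: "g \<in> S \<rightarrow> T"
  shows "free_map R g \<in> mod_hom R (free_module R S) (free_module R T)"
    and "\<And>s. s \<in> S \<Longrightarrow> free_map R g (free_basis R s) = free_basis R (g s)"
proof -
  \<comment> \<open>Again the support may be enlarged to any finite \<open>U\<close>, which gives
    the fibre sums of two functions the same index set.\<close>
  have eq: "free_map R g f t = (\<Oplus>s\<in>{s\<in>U. g s = t}. f s)"
    if "f \<in> carrier (free_module R S)" "finite U" "{s. f s \<noteq> \<zero>} \<subseteq> U" for f U t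
    unfolding free_map_def
    by (rule add.finprod_mono_neutral_cong_left)
      (use that free_module_apply[OF that(1)] in auto)
  have sup: "finite {s. f s \<noteq> \<zero>}" if "f \<in> carrier (free_module R S)" for f
    using that by auto
  interpret F: plain_module R "free_module R S"
    by (rule plain_module.intro) (rule module_free_module)
  show "free_map R g \<in> mod_hom R (free_module R S) (free_module R T)"
  proof (rule mod_homI)
    fix f assume f: "f \<in> carrier (free_module R S)"
    have "{t. free_map R g f t \<noteq> \<zero>} \<subseteq> g ` {s. f s \<noteq> \<zero>}"
    proof
      fix t assume t: "t \<in> {t. free_map R g f t \<noteq> \<zero>}"
      \<comment> \<open>A nonzero fibre sum has a nonempty index set, so the new support lies in the
        image of the old one and is finite.\<close>
      have "{s. f s \<noteq> \<zero> \<and> g s = t} \<noteq> {}"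
      proof
        assume "{s. f s \<noteq> \<zero> \<and> g s = t} = {}"
        then have "free_map R g f t = \<zero>" unfolding free_map_def by (simp only: finsum_empty)
        with t show False by simp
      qed
      then show "t \<in> g ` {s. f s \<noteq> \<zero>}" by auto
    qed
    then have "finite {t. free_map R g f t \<noteq> \<zero>}" "\<And>t. t \<notin> T \<Longrightarrow> free_map R g f t = \<zero>"
      using finite_subset[OF _ finite_imageI[OF sup[OF f]]] f g by (blast, fastforce)
    moreover have "free_map R g f t \<in> carrier R" for t
      unfolding free_map_def using free_module_apply[OF f] by (intro finsum_closed) auto
    ultimately show "free_map R g f \<in> carrier (free_module R T)" by auto
    fix r assume r: "r \<in> carrier R"
    show "free_map R g (r \<odot>\<^bsub>free_module R S\<^esub> f) = r \<odot>\<^bsub>free_module R T\<^esub> free_map R g f"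
    proof
      fix t
      have nz: "f s \<noteq> \<zero>" if "r \<otimes> f s \<noteq> \<zero>" for s using that r by auto
      have "free_map R g (r \<odot>\<^bsub>free_module R S\<^esub> f) t = (\<Oplus>s\<in>{s\<in>{s. f s \<noteq> \<zero>}. g s = t}. r \<otimes> f s)"
        using eq[OF F.smult_closed[OF r f] sup[OF f]] nz by (auto simp: subset_iff)
      also have "\<dots> = r \<otimes> (\<Oplus>s\<in>{s\<in>{s. f s \<noteq> \<zero>}. g s = t}. f s)"
        using sup[OF f] r free_module_apply[OF f] by (intro finsum_rdistr[symmetric]) auto
      finally show "free_map R g (r \<odot>\<^bsub>free_module R S\<^esub> f) t = (r \<odot>\<^bsub>free_module R T\<^esub> free_map R g f) t"
        by (simp add: free_map_def)
    qed
  next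
    fix f f' assume f: "f \<in> carrier (free_module R S)" "f' \<in> carrier (free_module R S)"
    let ?U = "{s. f s \<noteq> \<zero>} \<union> {s. f' s \<noteq> \<zero>}"
    have U: "finite ?U" using sup[OF f(1)] sup[OF f(2)] by auto
    show "free_map R g (f \<oplus>\<^bsub>free_module R S\<^esub> f') = free_map R g f \<oplus>\<^bsub>free_module R T\<^esub> free_map R g f'"
    proof
      fix t
      have nz: "{s. f s \<oplus> f' s \<noteq> \<zero>} \<subseteq> ?U" by auto
      have "free_map R g (f \<oplus>\<^bsub>free_module R S\<^esub> f') t = (\<Oplus>s\<in>{s\<in>?U. g s = t}. f s \<oplus> f' s)"
        using eq[OF F.M.a_closed[OF f] U] nz by simp
      also have "\<dots> = (\<Oplus>s\<in>{s\<in>?U. g s = t}. f s) \<oplus> (\<Oplus>s\<in>{s\<in>?U. g s = t}. f' s)"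
        using free_module_apply[OF f(1)] free_module_apply[OF f(2)] by (intro finsum_addf) auto
      also have "\<dots> = free_map R g f t \<oplus> free_map R g f' t"
        using eq[OF f(1) U] eq[OF f(2) U] by simp
      finally show "free_map R g (f \<oplus>\<^bsub>free_module R S\<^esub> f') t =
          (free_map R g f \<oplus>\<^bsub>free_module R T\<^esub> free_map R g f') t" by simp
    qed
  qed
  fix s assume s: "s \<in> S"
  show "free_map R g (free_basis R s) = free_basis R (g s)"
  proof
    fix t
    have "free_map R g (free_basis R s) t = (\<Oplus>u\<in>{u\<in>{s}. g u = t}. free_basis R s u)"
      by (rule eq[OF free_basis_closed[OF s]]) (auto simp: free_basis_def)
    also have "\<dots> = free_basis R (g s) t"
      by (cases "g s = t") (auto simp: free_basis_def Collect_conv_if)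
    finally show "free_map R g (free_basis R s) t = free_basis R (g s) t" .
  qed
qed

end

declare free_module_sel [simp del]

section \<open>Extension of scalars\<close>

lemma self_module_sel [simp]:
  "carrier (self_module R) = carrier R"
  "\<zero>\<^bsub>self_module R\<^esub> = \<zero>\<^bsub>R\<^esub>"
  "x \<oplus>\<^bsub>self_module R\<^esub> y = x \<oplus>\<^bsub>R\<^esub> y"
  "r \<odot>\<^bsub>self_module R\<^esub> x = r \<otimes>\<^bsub>R\<^esub> x"
  by (simp_all add: self_module_def)

lemma (in cring) module_self_module: "module R (self_module R)"
  by (intro moduleI abelian_groupI) 
    (auto simp: is_cring a_assoc l_distr r_distr m_assoc intro: a_comm l_neg)

locale scalar_extension =
  A: cring A + B: cring B + M: plain_module B M + N: plain_module A N
  for A :: "('a, 'r) ring_scheme" and B :: "('b, 's) ring_scheme" and \<phi> :: "'a \<Rightarrow> 'b"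
    and M :: "('b, 'm) module" and N :: "('a, 'n) module" +
  assumes \<phi>: "\<phi> \<in> ring_hom A B"
begin

abbreviation (input) "F \<equiv> free_module B (carrier M \<times> carrier N)"
abbreviation (input) "K \<equiv> tensor_kernel A B \<phi> M N"
abbreviation (input) "T \<equiv> tensor_module A B \<phi> M N"

definition pure :: "'m \<Rightarrow> 'n \<Rightarrow> ('m \<times> 'n \<Rightarrow> 'b) set" where
  "pure m n = K +>\<^bsub>F\<^esub> free_basis B (m, n)"

sublocale F: plain_module B F
  by (rule plain_module.intro) (rule B.module_free_module)

lemma \<phi>_closed: "a \<in> carrier A \<Longrightarrow> \<phi> a \<in> carrier B"
  using \<phi> by (auto simp: ring_hom_def)

lemma relations_closed: "tensor_relations A B \<phi> M N \<subseteq> carrier F"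
proof -
  have *: "free_basis B (m, n) \<in> carrier F" if "m \<in> carrier M" "n \<in> carrier N" for m n
    using that by (intro B.free_basis_closed) auto
  show ?thesis
    unfolding tensor_relations_def Let_def
    by (safe; intro F.M.minus_closed F.M.a_closed F.smult_closed * M.M.a_closed N.M.a_closed
        M.smult_closed N.smult_closed \<phi>_closed)
qed

lemma submodule_kernel: "submodule K B F"
  unfolding tensor_kernel_def by (rule F.submodule_span[OF relations_closed])

lemma module_tensor: "module B T"
  unfolding tensor_module_def by (rule F.module_quotient[OF submodule_kernel])

sublocale T: plain_module B T
  by (rule plain_module.intro) (rule module_tensor)

lemma coset_hom: "a_r_coset F K \<in> mod_hom B F T"
  unfolding tensor_module_def by (rule F.coset_hom[OF submodule_kernel])

lemma pure_closed: "m \<in> carrier M \<Longrightarrow> n \<in> carrier N \<Longrightarrow> pure m n \<in> carrier T"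
  unfolding pure_def by (intro mod_hom_closed[OF coset_hom] B.free_basis_closed) auto

text \<open>Pulls \<open>H\<close> back to the free module, where the basis vectors, whose classes
  are the elementary tensors, generate everything.\<close>

lemma tensor_induct:
  assumes H: "submodule H B T"
    and "\<And>m n. m \<in> carrier M \<Longrightarrow> n \<in> carrier N \<Longrightarrow> pure m n \<in> H"
  shows "carrier T \<subseteq> H"
proof -
  have "carrier F \<subseteq> {x \<in> carrier F. K +>\<^bsub>F\<^esub> x \<in> H}"
    by (rule B.free_module_induct[OF submodule_vimage[OF F.module_axioms module_tensor coset_hom H]])
      (use assms(2) in \<open>auto simp: pure_def intro!: B.free_basis_closed\<close>)
  then show ?thesis
    unfolding tensor_module_def F.quotient_carrier by blast
qed

text \<open>The map on the free module prescribed by \<open>\<beta>\<close> on basis vectors kills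
  the relations, since the four assumed identities match their four families, and so it descends to
  the quotient.\<close>

lemma tensor_lift:
  assumes Y: "module B Y"
    and \<beta>: "\<And>m n. m \<in> carrier M \<Longrightarrow> n \<in> carrier N \<Longrightarrow> \<beta> m n \<in> carrier Y"
    and "\<And>m m' n. m \<in> carrier M \<Longrightarrow> m' \<in> carrier M \<Longrightarrow> n \<in> carrier N \<Longrightarrow>
      \<beta> (m \<oplus>\<^bsub>M\<^esub> m') n = \<beta> m n \<oplus>\<^bsub>Y\<^esub> \<beta> m' n"
    and "\<And>m n n'. m \<in> carrier M \<Longrightarrow> n \<in> carrier N \<Longrightarrow> n' \<in> carrier N \<Longrightarrow>
      \<beta> m (n \<oplus>\<^bsub>N\<^esub> n') = \<beta> m n \<oplus>\<^bsub>Y\<^esub> \<beta> m n'"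
    and "\<And>b m n. b \<in> carrier B \<Longrightarrow> m \<in> carrier M \<Longrightarrow> n \<in> carrier N \<Longrightarrow>
      \<beta> (b \<odot>\<^bsub>M\<^esub> m) n = b \<odot>\<^bsub>Y\<^esub> \<beta> m n"
    and "\<And>a m n. a \<in> carrier A \<Longrightarrow> m \<in> carrier M \<Longrightarrow> n \<in> carrier N \<Longrightarrow>
      \<beta> m (a \<odot>\<^bsub>N\<^esub> n) = \<phi> a \<odot>\<^bsub>Y\<^esub> \<beta> m n"
  shows "\<exists>h \<in> mod_hom B T Y. \<forall>m\<in>carrier M. \<forall>n\<in>carrier N. h (pure m n) = \<beta> m n"
proof -
  interpret Y: plain_module B Y by (rule plain_module.intro) fact
  have "(\<lambda>(m, n). \<beta> m n) \<in> carrier M \<times> carrier N \<rightarrow> carrier Y"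
    using \<beta> by auto
  from B.free_module_lift[OF Y this] obtain g where g: "g \<in> mod_hom B F Y"
    "\<And>m n. m \<in> carrier M \<Longrightarrow> n \<in> carrier N \<Longrightarrow> g (free_basis B (m, n)) = \<beta> m n"
    by fastforce
  have e: "free_basis B (m, n) \<in> carrier F" if "m \<in> carrier M" "n \<in> carrier N" for m n
    using that by (intro B.free_basis_closed) auto
  note simps = mod_hom_minus[OF F.module_axioms Y g(1)] mod_hom_add[OF g(1)] mod_hom_smult[OF g(1)]
    mod_hom_uminus[OF F.module_axioms Y g(1)]
    e g(2) \<phi>_closed assms Y.minus_eq_zero_iff
  have "tensor_relations A B \<phi> M N \<subseteq> {x \<in> carrier F. g x \<in> {\<zero>\<^bsub>Y\<^esub>}}"
    using relations_closed
    unfolding tensor_relations_def Let_def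
    by (auto simp: simps)
  then have "K \<subseteq> {x \<in> carrier F. g x \<in> {\<zero>\<^bsub>Y\<^esub>}}"
    unfolding tensor_kernel_def
    by (intro module_span_minimal
        submodule_vimage[OF F.module_axioms Y g(1) Y.submodule_singleton_zero])
  then obtain h where "h \<in> mod_hom B T Y" "\<And>x. x \<in> carrier F \<Longrightarrow> h (K +>\<^bsub>F\<^esub> x) = g x"
    using quotient_lift[OF F.module_axioms Y submodule_kernel g(1)]
    unfolding tensor_module_def by blast
  with e g(2) show ?thesis unfolding pure_def by (intro bexI[of _ h]) simp_all
qed

text \<open>For the scalar zero the last family of relations contains e(m, 0) - 0 e(m, 0), so the
  basis vector at (m, 0) itself lies in the kernel.\<close>

lemma pure_zero:
  assumes "m \<in> carrier M"
  shows "pure m \<zero>\<^bsub>N\<^esub> = \<zero>\<^bsub>T\<^esub>"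
proof -
  have e: "free_basis B (m, \<zero>\<^bsub>N\<^esub>) \<in> carrier F"
    using assms by (intro B.free_basis_closed) auto
  have "\<phi> \<zero>\<^bsub>A\<^esub> = \<zero>\<^bsub>B\<^esub>"
    using ring_hom_zero[OF \<phi> A.ring_axioms B.ring_axioms] .
  then have "free_basis B (m, \<zero>\<^bsub>A\<^esub> \<odot>\<^bsub>N\<^esub> \<zero>\<^bsub>N\<^esub>) \<ominus>\<^bsub>F\<^esub> \<phi> \<zero>\<^bsub>A\<^esub> \<odot>\<^bsub>F\<^esub> free_basis B (m, \<zero>\<^bsub>N\<^esub>)
      = free_basis B (m, \<zero>\<^bsub>N\<^esub>)"
    using e by (simp add: a_minus_def)
  moreover have "free_basis B (m, \<zero>\<^bsub>A\<^esub> \<odot>\<^bsub>N\<^esub> \<zero>\<^bsub>N\<^esub>) \<ominus>\<^bsub>F\<^esub> \<phi> \<zero>\<^bsub>A\<^esub> \<odot>\<^bsub>F\<^esub> free_basis B (m, \<zero>\<^bsub>N\<^esub>)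
      \<in> tensor_relations A B \<phi> M N"
    unfolding tensor_relations_def Let_def using assms by blast
  ultimately have "free_basis B (m, \<zero>\<^bsub>N\<^esub>) \<in> K"
    unfolding tensor_kernel_def by (intro subsetD[OF module_span_superset]) (simp only:)
  then show ?thesis
    unfolding pure_def tensor_module_def F.quotient_zero
    using F.coset_eq_self_iff[OF submodule_kernel e] by blast
qed

text \<open>The elements with such an \<open>E\<close> form a submodule, since two finite sets can
  be united, and every elementary tensor is among them. It serves to extract finitely many elements
  of a term of the complex from a cocycle of its base change.\<close>

lemma in_span_of_finitely_many_pure:
  assumes "t \<in> carrier T"
  shows "\<exists>E. finite E \<and> E \<subseteq> carrier N \<and>
    t \<in> module_span B T ((\<lambda>(m, n). pure m n) ` (carrier M \<times> E))"
proof -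
  let ?P = "\<lambda>E t. finite E \<and> E \<subseteq> carrier N \<and> t \<in> module_span B T ((\<lambda>(m, n). pure m n) ` (carrier M \<times> E))"
  have sub: "submodule (module_span B T ((\<lambda>(m, n). pure m n) ` (carrier M \<times> E))) B T"
    if "E \<subseteq> carrier N" for E
    using that pure_closed by (intro T.submodule_span) auto
  have mono: "module_span B T ((\<lambda>(m, n). pure m n) ` (carrier M \<times> E)) \<subseteq>
     module_span B T ((\<lambda>(m, n). pure m n) ` (carrier M \<times> E'))" if "E \<subseteq> E'" for E E'
    unfolding module_span_def by (rule hull_mono) (use that in auto)
  have "carrier T \<subseteq> {t \<in> carrier T. \<exists>E. ?P E t}"
  proof (rule tensor_induct)
    show "submodule {t \<in> carrier T. \<exists>E. ?P E t} B T"
    proof (rule T.submoduleI')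
      have "?P {} \<zero>\<^bsub>T\<^esub>" using T.submodule_zero[OF sub[of "{}"]] by simp
      then show "\<zero>\<^bsub>T\<^esub> \<in> {t \<in> carrier T. \<exists>E. ?P E t}" by blast
      fix a b assume "a \<in> {t \<in> carrier T. \<exists>E. ?P E t}" "b \<in> {t \<in> carrier T. \<exists>E. ?P E t}"
      then obtain E E' where E: "?P E a" "?P E' b" "a \<in> carrier T" "b \<in> carrier T" by blast
      then have EE: "E \<union> E' \<subseteq> carrier N" by blast
      have "?P (E \<union> E') (a \<oplus>\<^bsub>T\<^esub> b)"
        using T.submoduleE(5)[OF sub[OF EE], of a b] E mono[of E "E \<union> E'"] mono[of E' "E \<union> E'"]
        by blast
      then show "a \<oplus>\<^bsub>T\<^esub> b \<in> {t \<in> carrier T. \<exists>E. ?P E t}" using E by blast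
    next
      fix r a assume "r \<in> carrier B" "a \<in> {t \<in> carrier T. \<exists>E. ?P E t}"
      then show "r \<odot>\<^bsub>T\<^esub> a \<in> {t \<in> carrier T. \<exists>E. ?P E t}"
        using T.submoduleE(4)[OF sub] T.smult_closed by blast
    qed auto
    fix m n assume mn: "m \<in> carrier M" "n \<in> carrier N"
    then have "?P {n} (pure m n)"
      by (auto intro!: subsetD[OF module_span_superset])
    then show "pure m n \<in> {t \<in> carrier T. \<exists>E. ?P E t}" using mn pure_closed by blast
  qed
  then show ?thesis using assms by blast
qed

end

text \<open>On basis vectors the map sends (m, n) to (m, f n), which turns each family of relations
  into the same family over \<open>N'\<close>; hence kernel goes to kernel.\<close>

lemma tensor_map_hom:
  assumes "scalar_extension A B \<phi> M N" "scalar_extension A B \<phi> M N'" and f: "f \<in> mod_hom A N N'"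
  shows "tensor_map A B \<phi> M N' f \<in> mod_hom B (tensor_module A B \<phi> M N) (tensor_module A B \<phi> M N')"
    and "\<And>m n. m \<in> carrier M \<Longrightarrow> n \<in> carrier N \<Longrightarrow>
      tensor_map A B \<phi> M N' f (scalar_extension.pure A B \<phi> M N m n) =
      scalar_extension.pure A B \<phi> M N' m (f n)"
proof -
  interpret N: scalar_extension A B \<phi> M N by fact
  interpret N': scalar_extension A B \<phi> M N' by fact
  let ?h = "free_map B (\<lambda>(m, n). (m, f n))"
  have fm: "(\<lambda>(m, n). (m, f n)) \<in> carrier M \<times> carrier N \<rightarrow> carrier M \<times> carrier N'"
    using mod_hom_closed[OF f] by auto
  note h = N.B.free_map_hom[OF fm]
  have hb: "?h (free_basis B (m, n)) = free_basis B (m, f n)" if "m \<in> carrier M" "n \<in> carrier N" for m n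
    using h(2)[of "(m, n)"] that by simp
  have e: "free_basis B (m, n) \<in> carrier (free_module B (carrier M \<times> carrier N))"
    if "m \<in> carrier M" "n \<in> carrier N" for m n
    using that by (intro N.B.free_basis_closed) auto
  have "?h x \<in> tensor_relations A B \<phi> M N'" if "x \<in> tensor_relations A B \<phi> M N" for x
  proof -
    note simps = mod_hom_minus[OF N.F.module_axioms N'.F.module_axioms h(1)] mod_hom_add[OF h(1)]
      mod_hom_smult[OF h(1)] e hb N.\<phi>_closed mod_hom_add[OF f] mod_hom_smult[OF f]
    show ?thesis
      using that unfolding tensor_relations_def Let_def Un_iff
      apply (elim disjE)
         apply (rule disjI1, rule disjI1, rule disjI1)
         apply (use mod_hom_closed[OF f] in \<open>force simp: simps\<close>)
        apply (rule disjI1, rule disjI1, rule disjI2)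
        apply (use mod_hom_closed[OF f] in \<open>force simp: simps\<close>)
       apply (rule disjI1, rule disjI2)
       apply (use mod_hom_closed[OF f] in \<open>force simp: simps\<close>)
      apply (rule disjI2)
      apply (use mod_hom_closed[OF f] in \<open>force simp: simps\<close>)
      done
  qed
  then have "tensor_relations A B \<phi> M N \<subseteq> {x \<in> carrier (free_module B (carrier M \<times> carrier N)).
      ?h x \<in> tensor_kernel A B \<phi> M N'}"
    using N.relations_closed unfolding tensor_kernel_def
    by (auto intro!: subsetD[OF module_span_superset])
  from module_span_minimal[OF submodule_vimage[OF N.F.module_axioms N'.F.module_axioms h(1)
        N'.submodule_kernel] this]
  have k: "?h ` tensor_kernel A B \<phi> M N \<subseteq> tensor_kernel A B \<phi> M N'"
    by (auto simp: tensor_kernel_def)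
  show "tensor_map A B \<phi> M N' f \<in> mod_hom B (tensor_module A B \<phi> M N) (tensor_module A B \<phi> M N')"
    unfolding tensor_map_def tensor_module_def
    by (rule quotient_map_hom[OF N.F.module_axioms N'.F.module_axioms N.submodule_kernel
          N'.submodule_kernel h(1) k])
  fix m n assume mn: "m \<in> carrier M" "n \<in> carrier N"
  show "tensor_map A B \<phi> M N' f (N.pure m n) = N'.pure m (f n)"
    unfolding tensor_map_def N.pure_def N'.pure_def
    using quotient_map_coset[OF N.F.module_axioms N'.F.module_axioms N.submodule_kernel
          N'.submodule_kernel h(1) k e[OF mn]] hb[OF mn] by simp
qed

lemma cochain_complex_base_change:
  assumes C: "cochain_complex A C" and "cring B" "\<phi> \<in> ring_hom A B"
  shows "cochain_complex B (base_change_complex A B \<phi> C)"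
proof -
  interpret C: complex A C by (rule complex.intro) fact
  interpret B: cring B by fact
  have se: "scalar_extension A B \<phi> (self_module B) (Obj C i)" for i
    by (intro scalar_extension.intro plain_module.intro B.module_self_module C.module_Obj
        scalar_extension_axioms.intro assms C.Obj.R.is_cring)
  interpret E: scalar_extension A B \<phi> "self_module B" "Obj C i" for i by (rule se)
  note d = tensor_map_hom[OF se se C.Dif_hom]
  let ?T = "\<lambda>i. tensor_module A B \<phi> (self_module B) (Obj C i)"
  let ?d = "\<lambda>i. tensor_map A B \<phi> (self_module B) (Obj C (i + 1)) (Dif C i)"
  have i2: "i + 1 + 1 = i + 2" for i :: int by simp
  have "?d (i + 1) (?d i t) = \<zero>\<^bsub>?T (i + 2)\<^esub>" if "t \<in> carrier (?T i)" for i t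
  proof -
    have "?d (i + 1) (?d i (E.pure i m n)) \<in> {\<zero>\<^bsub>?T (i + 2)\<^esub>}"
      if "m \<in> carrier (self_module B)" "n \<in> carrier (Obj C i)" for m n
      using d(2)[OF that] d(2)[OF that(1) mod_hom_closed[OF C.Dif_hom that(2)]]
        C.Dif_Dif[OF that(2)] E.pure_zero[OF that(1), of "i + 2"] by (simp add: i2)
    \<comment> \<open>The elements killed by the composite form a submodule, so testing elementary
      tensors is enough.\<close>
    moreover have "submodule {t \<in> carrier (?T i). ?d (i + 1) (?d i t) \<in> {\<zero>\<^bsub>?T (i + 2)\<^esub>}} B (?T i)"
      using submodule_vimage[OF E.module_tensor E.module_tensor mod_hom_comp[OF d(1) d(1)]
          E.T.submodule_singleton_zero, of i] by (simp only: i2)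
    ultimately have "carrier (?T i) \<subseteq> {t \<in> carrier (?T i). ?d (i + 1) (?d i t) \<in> {\<zero>\<^bsub>?T (i + 2)\<^esub>}}"
      using E.pure_closed[of _ _ i] by (intro E.tensor_induct) auto
    then show ?thesis using that by blast
  qed
  then show ?thesis
    using d(1) E.module_tensor by (simp add: cochain_complex_def base_change_complex_def i2)
qed

section \<open>Transport of structure\<close>

text \<open>Meant for an injection \<open>j\<close> with left inverse \<open>k\<close>. Such copies
  are wanted because \<open>K_projective\<close> quantifies over complexes with elements in one
  fixed type.\<close>

definition transport_module :: "('b \<Rightarrow> 'c) \<Rightarrow> ('c \<Rightarrow> 'b) \<Rightarrow> ('a, 'b) module \<Rightarrow> ('a, 'c) module" where
  "transport_module j k M = make_module (j ` carrier M) (j \<zero>\<^bsub>M\<^esub>)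
     (\<lambda>x y. j (k x \<oplus>\<^bsub>M\<^esub> k y)) (\<lambda>r x. j (r \<odot>\<^bsub>M\<^esub> k x))"

lemma transport_module_sel [simp]:
  "carrier (transport_module j k M) = j ` carrier M"
  "\<zero>\<^bsub>transport_module j k M\<^esub> = j \<zero>\<^bsub>M\<^esub>"
  "x \<oplus>\<^bsub>transport_module j k M\<^esub> y = j (k x \<oplus>\<^bsub>M\<^esub> k y)"
  "r \<odot>\<^bsub>transport_module j k M\<^esub> x = j (r \<odot>\<^bsub>M\<^esub> k x)"
  by (simp_all add: transport_module_def)

lemma module_transport_module:
  assumes "module R M" and "\<And>x. k (j x) = x"
  shows "module R (transport_module j k M)"
proof -
  interpret M: plain_module R M by (rule plain_module.intro) fact
  have "\<exists>y\<in>carrier M. j (y \<oplus>\<^bsub>M\<^esub> x) = j \<zero>\<^bsub>M\<^esub>" if "x \<in> carrier M" for x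
    using that M.M.l_neg[OF that] by (intro bexI[of _ "\<ominus>\<^bsub>M\<^esub> x"]) auto
  then show ?thesis
    by (intro moduleI abelian_groupI)
      (auto simp: assms(2) M.R.is_cring M.M.a_ac M.smult_l_distr M.smult_r_distr M.smult_assoc1)
qed

definition transport_complex :: "('b \<Rightarrow> 'c) \<Rightarrow> ('c \<Rightarrow> 'b) \<Rightarrow> ('a, 'b) cochain \<Rightarrow> ('a, 'c) cochain" where
  "transport_complex j k C =
     \<lparr>Obj = (\<lambda>i. transport_module j k (Obj C i)), Dif = (\<lambda>i x. j (Dif C i (k x)))\<rparr>"

lemma transport_complex_sel [simp]:
  "Obj (transport_complex j k C) i = transport_module j k (Obj C i)"
  "Dif (transport_complex j k C) i x = j (Dif C i (k x))"
  by (simp_all add: transport_complex_def)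

lemma cochain_complex_transport:
  assumes "cochain_complex R C" and k: "\<And>x. k (j x) = x"
  shows "cochain_complex R (transport_complex j k C)"
proof -
  interpret complex R C by (rule complex.intro) fact
  show ?thesis
    unfolding cochain_complex_def
    by (auto simp: k module_transport_module[OF module_Obj] Dif_Dif
        mod_hom_closed[OF Dif_hom] mod_hom_add[OF Dif_hom] mod_hom_smult[OF Dif_hom] intro!: mod_homI)
qed

lemma cohomology_vanishes_transport:
  assumes "cochain_complex R C" and k: "\<And>x. k (j x) = x" and "cohomology_vanishes C i"
  shows "cohomology_vanishes (transport_complex j k C) i"
proof -
  interpret C: complex R C by (rule complex.intro) fact
  interpret D: complex R "transport_complex j k C"
    by (rule complex.intro, rule cochain_complex_transport) (fact, rule k)
  have inj: "j x = j y \<longleftrightarrow> x = y" for x y using k by metis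
  have "carrier (cocycles C i) \<subseteq> coboundaries C i"
    using assms(3) C.cohomology_vanishes_iff by blast
  moreover have "coboundaries (transport_complex j k C) i = j ` coboundaries C i"
    by (simp add: coboundaries_def image_image k)
  moreover have "carrier (cocycles (transport_complex j k C) i) = j ` carrier (cocycles C i)"
    by (auto simp: k inj)
  ultimately show ?thesis
    unfolding D.cohomology_vanishes_iff by (simp add: image_mono del: cocycles_sel)
qed

section \<open>K-projective complexes\<close>

lemma hom_complex_sel [simp]:
  "carrier (Obj (hom_complex R C D) n) =
     {f. \<forall>i. f i \<in> mod_hom R (Obj C i) (Obj D (i + n)) \<inter> extensional (carrier (Obj C i))}"
  "\<zero>\<^bsub>Obj (hom_complex R C D) n\<^esub> = (\<lambda>i. \<lambda>x\<in>carrier (Obj C i). \<zero>\<^bsub>Obj D (i + n)\<^esub>)"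
  "f \<oplus>\<^bsub>Obj (hom_complex R C D) n\<^esub> g =
     (\<lambda>i. \<lambda>x\<in>carrier (Obj C i). f i x \<oplus>\<^bsub>Obj D (i + n)\<^esub> g i x)"
  by (simp_all add: hom_complex_def)

text \<open>The two degrees that matter: cocycles of degree 0 are chain maps, and the differential
  out of degree -1, where the sign is plus, is the homotopy formula.\<close>

lemma hom_complex_Dif:
  "Dif (hom_complex R C D) 0 f i = (\<lambda>x\<in>carrier (Obj C i).
     Dif D i (f i x) \<ominus>\<^bsub>Obj D (i + 1)\<^esub> f (i + 1) (Dif C i x))"
  "Dif (hom_complex R C D) (- 1) f i = (\<lambda>x\<in>carrier (Obj C i).
     Dif D (i - 1) (f i x) \<oplus>\<^bsub>Obj D i\<^esub> f (i + 1) (Dif C i x))"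
  by (simp_all add: hom_complex_def)

text \<open>A chain map to an acyclic complex is a cocycle of degree zero in the Hom complex.\<close>

lemma K_projective_null_homotopic:
  fixes N :: "('a, ('a + 'b) list) cochain" and P :: "('a, 'b) cochain"
  assumes P: "K_projective R P" and N: "cochain_complex R N" "acyclic_complex N"
    and f: "chain_map R P N f"
  shows "\<exists>h. (\<forall>i. h i \<in> mod_hom R (Obj P i) (Obj N (i - 1))) \<and>
    (\<forall>i. \<forall>x\<in>carrier (Obj P i). f i x = Dif N (i - 1) (h i x) \<oplus>\<^bsub>Obj N i\<^esub> h (i + 1) (Dif P i x))"
proof -
  interpret N: complex R N by (rule complex.intro) (rule N)
  interpret P: complex R P by (rule complex.intro) (use P in \<open>simp add: K_projective_def\<close>)
  let ?H = "hom_complex R P N"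
  have f': "f i \<in> mod_hom R (Obj P i) (Obj N i)" for i
    using f by (auto simp: chain_map_def)
  have fd: "f (i + 1) (Dif P i x) = Dif N i (f i x)" if "x \<in> carrier (Obj P i)" for i x
    using f that by (auto simp: chain_map_def)
  note [simp] = mod_hom_closed[OF f'] mod_hom_closed[OF P.Dif_hom] mod_hom_closed[OF N.Dif_hom] fd
  \<comment> \<open>Elements of the Hom complex are extensional, so the chain map is cut down to the
    carriers.\<close>
  define F where "F i = restrict (f i) (carrier (Obj P i))" for i
  have "F i \<in> mod_hom R (Obj P i) (Obj N i)" for i
    by (intro mod_homI) (auto simp: F_def mod_hom_add[OF f'] mod_hom_smult[OF f'])
  then have F: "F \<in> carrier (cocycles ?H 0)"
    by (auto simp: hom_complex_Dif F_def fun_eq_iff a_minus_def N.Obj.M.r_neg)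
  \<comment> \<open>Exhibiting zero as a coboundary puts \<open>F\<close> into its own coset.
    Vanishing then identifies that coset with the set of coboundaries, so \<open>F\<close> is one of
    them.\<close>
  define Z where "Z = (\<lambda>i. \<lambda>x\<in>carrier (Obj P i). \<zero>\<^bsub>Obj N (i - 1)\<^esub>)"
  have "Z \<in> carrier (Obj ?H (- 1))"
    by (auto simp: Z_def intro!: mod_homI)
  moreover have "Dif ?H (- 1) Z = (\<lambda>i. \<lambda>x\<in>carrier (Obj P i). \<zero>\<^bsub>Obj N i\<^esub>)"
    using mod_hom_zero[OF N.module_Obj N.module_Obj N.Dif_hom'] by (auto simp: hom_complex_Dif Z_def fun_eq_iff)
  ultimately have 0: "(\<lambda>i. \<lambda>x\<in>carrier (Obj P i). \<zero>\<^bsub>Obj N i\<^esub>) \<in> coboundaries ?H 0"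
    unfolding coboundaries_def diff_0 by (intro image_eqI[OF sym])
  have "(\<lambda>i. \<lambda>x\<in>carrier (Obj P i). \<zero>\<^bsub>Obj N i\<^esub>) \<oplus>\<^bsub>cocycles ?H 0\<^esub> F = F"
    by (auto simp: F_def fun_eq_iff)
  then have "F \<in> coboundaries ?H 0 +>\<^bsub>cocycles ?H 0\<^esub> F"
    unfolding a_r_coset_mem by (rule bexI[OF sym 0])
  moreover have "coboundaries ?H 0 +>\<^bsub>cocycles ?H 0\<^esub> F \<in> carrier (cohomology ?H 0)"
    unfolding cohomology_def quotient_module_def make_module_simps A_RCOSETS_def' using F by blast
  moreover have "cohomology_vanishes ?H 0"
    using P N unfolding K_projective_def acyclic_complex_def by blast
  ultimately have "F \<in> coboundaries ?H 0"
    unfolding cohomology_vanishes_def by (auto simp: cohomology_def quotient_module_def)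
  then obtain h where h: "h \<in> carrier (Obj ?H (- 1))" "F = Dif ?H (- 1) h"
    by (auto simp: coboundaries_def)
  have "f i x = Dif N (i - 1) (h i x) \<oplus>\<^bsub>Obj N i\<^esub> h (i + 1) (Dif P i x)"
    if "x \<in> carrier (Obj P i)" for i x
    using fun_cong[OF fun_cong[OF h(2), of i], of x] that by (simp add: F_def hom_complex_Dif)
  then show ?thesis using h(1) by auto
qed

lemma K_projective_retraction:
  fixes Q :: "('a, 'b) cochain"
  assumes Q: "K_projective R Q" and van: "\<And>i. i > n \<Longrightarrow> cohomology_vanishes Q i"
  shows "\<exists>s \<in> mod_hom R (Obj Q n) (cocycles Q n). \<forall>z\<in>carrier (cocycles Q n). s z = z"
proof -
  have cQ: "cochain_complex R Q" using Q by (simp add: K_projective_def)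
  interpret Q: complex R Q by (rule complex.intro) fact
  \<comment> \<open>The zero modules in low degrees are realised as the zero submodule of
    \<open>Obj Q n\<close>, so that every differential below degree n is the identity function; in
    degree n - 1 this is the inclusion of the cocycles.\<close>
  define L :: "('a, 'b) cochain" where
    "L = \<lparr>Obj = (\<lambda>i. if i \<ge> n then Obj Q i else if i = n - 1 then cocycles Q n
                   else (Obj Q n)\<lparr>carrier := {\<zero>\<^bsub>Obj Q n\<^esub>}\<rparr>),
          Dif = (\<lambda>i. if i \<ge> n then Dif Q i else (\<lambda>x. x))\<rparr>"
  have Obj_L: "i \<ge> n \<Longrightarrow> Obj L i = Obj Q i" "Obj L (n - 1) = cocycles Q n"
    "i < n - 1 \<Longrightarrow> Obj L i = (Obj Q n)\<lparr>carrier := {\<zero>\<^bsub>Obj Q n\<^esub>}\<rparr>"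
    and zero_L: "i < n \<Longrightarrow> \<zero>\<^bsub>Obj L i\<^esub> = \<zero>\<^bsub>Obj Q n\<^esub>"
    and Dif_L: "i \<ge> n \<Longrightarrow> Dif L i = Dif Q i" "i < n \<Longrightarrow> Dif L i = (\<lambda>x. x)" for i
    by (auto simp: L_def)
  \<comment> \<open>Degree n - 2 is listed separately: two successive differentials starting there
    pass through both places at which the definition of \<open>L\<close> changes.\<close>
  have cases: "i \<ge> n \<or> i = n - 1 \<or> i = n - 2 \<or> i < n - 2" for i :: int by linarith
  have d0: "Dif Q n \<zero>\<^bsub>Obj Q n\<^esub> = \<zero>\<^bsub>Obj Q (n + 1)\<^esub>"
    by (rule mod_hom_zero[OF Q.module_Obj Q.module_Obj Q.Dif_hom])
  have L: "cochain_complex R L"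
    unfolding cochain_complex_def
  proof (intro conjI allI ballI)
    fix i
    show "module R (Obj L i)"
      using cases[of i]
      by (auto simp: Obj_L Q.module_Obj Q.module_cocycles
          intro!: submodule_restrict Q.Obj.submodule_singleton_zero)
    show "Dif L i \<in> mod_hom R (Obj L i) (Obj L (i + 1))"
      using cases[of i] Q.Dif_hom[of i] d0
      by (elim disjE) (auto simp: Obj_L Dif_L intro!: mod_homI)
    fix x assume "x \<in> carrier (Obj L i)"
    then show "Dif L (i + 1) (Dif L i x) = \<zero>\<^bsub>Obj L (i + 2)\<^esub>"
      using cases[of i] Q.Dif_Dif[of x i] d0
      by (elim disjE) (auto simp: Obj_L Dif_L zero_L add.commute[of 1 n])
  qed
  interpret L: complex R L by (rule complex.intro) fact
  \<comment> \<open>Exactness holds above n by assumption, in degree n because the image of the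
    inclusion is the kernel of the differential, and in degree n - 1 because the inclusion is
    injective.\<close>
  have vL: "cohomology_vanishes L i" for i
    unfolding L.cohomology_vanishes_iff
  proof
    fix x assume x: "x \<in> carrier (cocycles L i)"
    consider "i > n" | "i = n" | "i = n - 1" | "i < n - 1" by linarith
    then show "x \<in> coboundaries L i"
    proof cases
      case 1
      then show ?thesis
        using x van[OF 1] unfolding Q.cohomology_vanishes_iff
        by (auto simp: Obj_L Dif_L coboundaries_def)
    next
      case 2
      then show ?thesis using x by (auto simp: Obj_L Dif_L coboundaries_def)
    next
      case 3
      then show ?thesis using x by (auto simp: Obj_L Dif_L coboundaries_def)
    next
      case 4
      then show ?thesis using x by (auto simp: Obj_L Dif_L coboundaries_def)
    qed
  qed
  \<comment> \<open>One-element lists embed the elements of \<open>Q\<close> into the type over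
    which K-projectivity quantifies.\<close>
  define j :: "'b \<Rightarrow> ('a + 'b) list" where "j x = [Inr x]" for x
  define k :: "('a + 'b) list \<Rightarrow> 'b" where "k = (\<lambda>x. projr (hd x))"
  have kj: "k (j x) = x" for x by (simp add: j_def k_def)
  have inj: "j x = j y \<longleftrightarrow> x = y" for x y by (simp add: j_def)
  let ?N = "transport_complex j k L"
  have N: "cochain_complex R ?N" "acyclic_complex ?N"
    using cochain_complex_transport[OF L, of k j] cohomology_vanishes_transport[OF L _ vL, of k j] kj
    by (auto simp: acyclic_complex_def)
  \<comment> \<open>The identity from degree n on, the differential of \<open>Q\<close> in degree n
    - 1, where it lands in the cocycles, and zero below. Compatibility out of degree n - 2 is the
    vanishing of the squared differential of \<open>Q\<close>.\<close>
  define f where "f i x = j (if i \<ge> n then x else if i = n - 1 then Dif Q i x else \<zero>\<^bsub>Obj Q n\<^esub>)" for i x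
  have f_ge: "i \<ge> n \<Longrightarrow> f i = j" and f_n: "f (n - 1) x = j (Dif Q (n - 1) x)"
    and f_less: "i < n - 1 \<Longrightarrow> f i x = j \<zero>\<^bsub>Obj Q n\<^esub>" for i x
    by (auto simp: f_def)
  note dh = Q.Dif_hom'[of n]
  have "chain_map R Q ?N f"
    unfolding chain_map_def
  proof (intro conjI allI ballI)
    fix i
    show "f i \<in> mod_hom R (Obj Q i) (Obj ?N i)"
      using cases[of i]
      by (elim disjE) (auto simp: Obj_L f_ge f_n f_less kj Q.Dif_Dif' mod_hom_closed[OF dh]
          mod_hom_add[OF dh] mod_hom_smult[OF dh] intro!: mod_homI)
    fix x assume x: "x \<in> carrier (Obj Q i)"
    have "Dif Q (n - 1) (Dif Q (n - 2) x) = \<zero>\<^bsub>Obj Q n\<^esub>" if "i = n - 2"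
      using Q.Dif_Dif[OF x] that by simp
    then show "f (i + 1) (Dif Q i x) = Dif ?N i (f i x)"
      using cases[of i] by (elim disjE) (auto simp: Dif_L f_ge f_n f_less kj)
  qed
  from K_projective_null_homotopic[OF Q N this] obtain h
    where h: "\<And>i. h i \<in> mod_hom R (Obj Q i) (Obj ?N (i - 1))"
      and eq: "\<And>i x. x \<in> carrier (Obj Q i) \<Longrightarrow>
        f i x = Dif ?N (i - 1) (h i x) \<oplus>\<^bsub>Obj ?N i\<^esub> h (i + 1) (Dif Q i x)"
    by blast
  define s where "s x = k (h n x)" for x
  have hn: "h n x \<in> j ` carrier (cocycles Q n)" if "x \<in> carrier (Obj Q n)" for x
    using mod_hom_closed[OF h that] by (simp add: Obj_L)
  have "s \<in> mod_hom R (Obj Q n) (cocycles Q n)"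
  proof (rule mod_homI)
    show "s x \<in> carrier (cocycles Q n)" if "x \<in> carrier (Obj Q n)" for x
      using hn[OF that] by (auto simp: s_def kj)
    show "s (x \<oplus>\<^bsub>Obj Q n\<^esub> y) = s x \<oplus>\<^bsub>cocycles Q n\<^esub> s y"
      if "x \<in> carrier (Obj Q n)" "y \<in> carrier (Obj Q n)" for x y
      using mod_hom_add[OF h that] by (simp add: s_def kj Obj_L)
    show "s (r \<odot>\<^bsub>Obj Q n\<^esub> x) = r \<odot>\<^bsub>cocycles Q n\<^esub> s x"
      if "r \<in> carrier R" "x \<in> carrier (Obj Q n)" for r x
      using mod_hom_smult[OF h that] by (simp add: s_def kj Obj_L)
  qed
  moreover have "s z = z" if z: "z \<in> carrier (cocycles Q n)" for z
  proof -
    \<comment> \<open>For a cocycle the second term of the homotopy formula vanishes, and in the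
      first the differential of \<open>L\<close> is the inclusion; what remains is z = h z up to the
      embedding \<open>j\<close>.\<close>
    have "h (n + 1) \<zero>\<^bsub>Obj Q (n + 1)\<^esub> = \<zero>\<^bsub>Obj ?N n\<^esub>"
      using mod_hom_zero[OF Q.module_Obj complex.module_Obj[OF complex.intro[OF N(1)]] h, of "n + 1"]
      by simp
    then have "z = s z \<oplus>\<^bsub>Obj Q n\<^esub> \<zero>\<^bsub>Obj Q n\<^esub>"
      using eq[of z n] z by (simp add: f_ge Obj_L Dif_L kj inj s_def)
    moreover have "s z \<in> carrier (Obj Q n)" using hn[of z] z by (auto simp: s_def kj)
    ultimately show ?thesis by simp
  qed
  ultimately show ?thesis by blast
qed

text \<open>A coset acts through any of its representatives, two of which differ by an element of
  \<open>I\<close> and hence act alike. Carrier, zero and addition are kept, so that a map into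
  \<open>Y\<close> can be fed to \<open>tensor_lift\<close> as a map into \<open>Y'\<close>.\<close>

lemma module_over_quotient_ring:
  fixes A :: "('a, 'r) ring_scheme" and Y :: "('a, 'b) module"
  assumes "module A Y" "ideal I A"
    and ann: "\<forall>r\<in>I. \<forall>x\<in>carrier Y. r \<odot>\<^bsub>Y\<^esub> x = \<zero>\<^bsub>Y\<^esub>"
  shows "\<exists>Y' :: ('a set, 'b) module. module (A Quot I) Y' \<and> carrier Y' = carrier Y \<and>
    ring.zero Y' = ring.zero Y \<and> ring.add Y' = ring.add Y \<and>
    (\<forall>r\<in>carrier A. \<forall>x\<in>carrier Y. (I +>\<^bsub>A\<^esub> r) \<odot>\<^bsub>Y'\<^esub> x = r \<odot>\<^bsub>Y\<^esub> x)"
proof -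
  interpret Y: plain_module A Y by (rule plain_module.intro) fact
  interpret I: ideal I A by fact
  define act where "act K x = (SOME r. r \<in> carrier A \<and> I +>\<^bsub>A\<^esub> r = K) \<odot>\<^bsub>Y\<^esub> x" for K x
  have act: "act (I +>\<^bsub>A\<^esub> r) x = r \<odot>\<^bsub>Y\<^esub> x" if r: "r \<in> carrier A" and x: "x \<in> carrier Y" for r x
  proof -
    define r' where "r' = (SOME r'. r' \<in> carrier A \<and> I +>\<^bsub>A\<^esub> r' = I +>\<^bsub>A\<^esub> r)"
    have r': "r' \<in> carrier A" "I +>\<^bsub>A\<^esub> r' = I +>\<^bsub>A\<^esub> r"
      using someI[of "\<lambda>r'. r' \<in> carrier A \<and> I +>\<^bsub>A\<^esub> r' = I +>\<^bsub>A\<^esub> r" r] r by (auto simp: r'_def)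
    then have "r' \<in> I +>\<^bsub>A\<^esub> r" using I.a_rcos_self by blast
    then obtain i where i: "i \<in> I" "r' = i \<oplus>\<^bsub>A\<^esub> r" by (auto simp: a_r_coset_mem)
    then have "r' \<odot>\<^bsub>Y\<^esub> x = r \<odot>\<^bsub>Y\<^esub> x"
      using ann[rule_format, OF i(1) x] r x I.Icarr[OF i(1)] by (simp add: Y.smult_l_distr)
    then show ?thesis by (simp add: act_def r'_def)
  qed
  define Y' :: "('a set, 'b) module" where
    "Y' = make_module (carrier Y) \<zero>\<^bsub>Y\<^esub> (ring.add Y) act"
  note [simp] = ring_hom_mult[OF I.rcos_ring_hom, symmetric] ring_hom_add[OF I.rcos_ring_hom, symmetric]
    ring_hom_one[OF I.rcos_ring_hom, symmetric]
  have Q: "carrier (A Quot I) = (\<lambda>r. I +>\<^bsub>A\<^esub> r) ` carrier A"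
    by (auto simp: FactRing_def A_RCOSETS_def')
  have "abelian_group Y'"
    using Y.M.abelian_group_axioms Y.M.l_neg
    by (intro abelian_groupI) (auto simp: Y'_def Y.M.a_ac intro!: bexI[of _ "\<ominus>\<^bsub>Y\<^esub> _"])
  then have "module (A Quot I) Y'"
    by (intro moduleI I.quotient_is_cring[OF Y.R.is_cring])
      (auto simp: Q Y'_def act Y.smult_l_distr Y.smult_r_distr Y.smult_assoc1)
  then show ?thesis by (intro exI[of _ Y']) (auto simp: Y'_def act)
qed

text \<open>The candidate generators are divided out. \<open>W\<close> is spanned by I H and the
  images in H of the finitely many elements that occur in representatives of generators of the
  base-changed cohomology. The induced map from that cohomology to H/W vanishes on the generators,
  yet it sends the class of 1 (x) x to the class of x; so H/W is zero.\<close>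

lemma generated_mod_cohomology_base_change:
  fixes Q :: "('a, 'b) cochain" and A :: "('a, 'r) ring_scheme"
  assumes "cring A" "ideal I A" and Q: "K_projective A Q"
    and van: "\<And>i. i > n \<Longrightarrow> cohomology_vanishes Q i"
    and fg: "fin_gen_module (A Quot I) (cohomology (base_change_complex A (A Quot I) (a_r_coset A I) Q) n)"
  shows "generated_mod A I (cohomology Q n)"
proof -
  interpret A: cring A by fact
  interpret I: ideal I A by fact
  let ?B = "A Quot I" and ?\<phi> = "a_r_coset A I"
  let ?T = "base_change_complex A ?B ?\<phi> Q"
  have \<phi>: "?\<phi> \<in> ring_hom A ?B" by (rule I.rcos_ring_hom)
  interpret B: cring ?B by (rule I.quotient_is_cring[OF A.is_cring])
  have cQ: "cochain_complex A Q" using Q by (simp add: K_projective_def)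
  interpret Q: complex A Q by (rule complex.intro) fact
  interpret T: complex ?B ?T
    by (rule complex.intro) (rule cochain_complex_base_change[OF cQ B.is_cring \<phi>])
  have se: "scalar_extension A ?B ?\<phi> (self_module ?B) (Obj Q i)" for i
    by (intro scalar_extension.intro plain_module.intro B.module_self_module Q.module_Obj
        scalar_extension_axioms.intro A.is_cring B.is_cring \<phi>)
  interpret E: scalar_extension A ?B ?\<phi> "self_module ?B" "Obj Q i" for i by (rule se)
  have Obj_T: "Obj ?T i = tensor_module A ?B ?\<phi> (self_module ?B) (Obj Q i)" for i
    by (simp add: base_change_complex_def)
  have Dif_T: "Dif ?T i (E.pure i b m) = E.pure (i + 1) b (Dif Q i m)"
    if "b \<in> carrier ?B" "m \<in> carrier (Obj Q i)" for i b m
    using tensor_map_hom(2)[OF se se Q.Dif_hom, of b m i] that by (simp add: base_change_complex_def)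

  obtain s where s: "s \<in> mod_hom A (Obj Q n) (cocycles Q n)"
    "\<And>z. z \<in> carrier (cocycles Q n) \<Longrightarrow> s z = z"
    using K_projective_retraction[OF Q van] by blast
  let ?H = "cohomology Q n"
  interpret H: plain_module A ?H by (rule plain_module.intro) (rule Q.module_cohomology)
  \<comment> \<open>The retraction extends the class map to the whole term, so that it can be
    applied to the second factors of arbitrary tensors.\<close>
  define \<sigma> where "\<sigma> x = coboundaries Q n +>\<^bsub>cocycles Q n\<^esub> s x" for x
  have \<sigma>: "\<sigma> \<in> mod_hom A (Obj Q n) ?H"
    unfolding \<sigma>_def by (rule mod_hom_comp[OF s(1) Q.class_hom])

  obtain S where S: "finite S" "S \<subseteq> carrier (cohomology ?T n)"
    "module_span ?B (cohomology ?T n) S = carrier (cohomology ?T n)"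
    using fg by (auto simp: fin_gen_module_def)
  \<comment> \<open>Bundles a representing cocycle with a finite set of second factors, so that both
    are chosen at once for each generator.\<close>
  define rep where "rep c z E \<longleftrightarrow> z \<in> carrier (cocycles ?T n) \<and>
      c = coboundaries ?T n +>\<^bsub>cocycles ?T n\<^esub> z \<and> finite E \<and> E \<subseteq> carrier (Obj Q n) \<and>
      z \<in> module_span ?B (Obj ?T n) ((\<lambda>(b, m). E.pure n b m) ` (carrier ?B \<times> E))" for c z E
  have "\<exists>z E. rep c z E" if c: "c \<in> S" for c
  proof -
    obtain z where z: "z \<in> carrier (cocycles ?T n)" "c = coboundaries ?T n +>\<^bsub>cocycles ?T n\<^esub> z"
      using c S(2) by (auto simp: T.cohomology_carrier simp del: cocycles_sel)
    then show ?thesis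
      using E.in_span_of_finitely_many_pure[of z n] by (auto simp: Obj_T rep_def)
  qed
  then obtain z E where "\<And>c. c \<in> S \<Longrightarrow> rep c (z c) (E c)"
    by metis
  then have zE: "\<And>c. c \<in> S \<Longrightarrow> z c \<in> carrier (cocycles ?T n)"
    "\<And>c. c \<in> S \<Longrightarrow> c = coboundaries ?T n +>\<^bsub>cocycles ?T n\<^esub> z c"
    "\<And>c. c \<in> S \<Longrightarrow> finite (E c)" "\<And>c. c \<in> S \<Longrightarrow> E c \<subseteq> carrier (Obj Q n)"
    "\<And>c. c \<in> S \<Longrightarrow> z c \<in> module_span ?B (Obj ?T n) ((\<lambda>(b, m). E.pure n b m) ` (carrier ?B \<times> E c))"
    unfolding rep_def by blast+
  define U where "U = (\<Union>c\<in>S. E c)"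
  have U: "finite U" "U \<subseteq> carrier (Obj Q n)"
    using zE(3,4) S(1) by (auto simp: U_def)
  define G where "G = \<sigma> ` U \<union> {r \<odot>\<^bsub>?H\<^esub> x | r x. r \<in> I \<and> x \<in> carrier ?H}"
  have G: "G \<subseteq> carrier ?H"
    using U(2) mod_hom_closed[OF \<sigma>] I.Icarr by (auto simp: G_def)
  define W where "W = module_span A ?H G"
  have W: "submodule W A ?H" unfolding W_def by (rule H.submodule_span[OF G])
  have GW: "G \<subseteq> W" unfolding W_def by (rule module_span_superset)
  let ?Y = "quotient_module ?H W"
  interpret Y: plain_module A ?Y by (rule plain_module.intro) (rule H.module_quotient[OF W])
  define \<tau> where "\<tau> x = W +>\<^bsub>?H\<^esub> \<sigma> x" for x
  have \<tau>: "\<tau> \<in> mod_hom A (Obj Q n) ?Y"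
    unfolding \<tau>_def by (rule mod_hom_comp[OF \<sigma> H.coset_hom[OF W]])
  have \<tau>0: "\<tau> x = \<zero>\<^bsub>?Y\<^esub> \<longleftrightarrow> \<sigma> x \<in> W" if "x \<in> carrier (Obj Q n)" for x
    using H.coset_eq_self_iff[OF W mod_hom_closed[OF \<sigma> that]] by (simp add: \<tau>_def H.quotient_zero)
  \<comment> \<open>Since \<open>W\<close> contains I H, the quotient is annihilated by
    \<open>I\<close> and becomes a module over the quotient ring.\<close>
  have "r \<odot>\<^bsub>?Y\<^esub> y = \<zero>\<^bsub>?Y\<^esub>" if ry: "r \<in> I" "y \<in> carrier ?Y" for r y
  proof -
    obtain x where x: "x \<in> carrier ?H" "y = W +>\<^bsub>?H\<^esub> x"
      using ry(2) by (auto simp: H.quotient_carrier)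
    then have "r \<odot>\<^bsub>?H\<^esub> x \<in> G" using ry(1) by (auto simp: G_def)
    then have "r \<odot>\<^bsub>?H\<^esub> x \<in> W" using GW by blast
    then have "W +>\<^bsub>?H\<^esub> (r \<odot>\<^bsub>?H\<^esub> x) = W"
      using H.coset_eq_self_iff[OF W] x(1) I.Icarr[OF ry(1)] by blast
    then show ?thesis
      using x I.Icarr[OF ry(1)] by (simp add: H.quotient_smult[OF W] H.quotient_zero)
  qed
  then have "\<forall>r\<in>I. \<forall>y\<in>carrier ?Y. r \<odot>\<^bsub>?Y\<^esub> y = \<zero>\<^bsub>?Y\<^esub>" by blast
  from module_over_quotient_ring[OF Y.module_axioms \<open>ideal I A\<close> this]
  obtain Y' :: "('a set, 'b set set) module" where Y': "module ?B Y'" "carrier Y' = carrier ?Y" "ring.zero Y' = ring.zero ?Y"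
    "ring.add Y' = ring.add ?Y"
    "\<And>r x. r \<in> carrier A \<Longrightarrow> x \<in> carrier ?Y \<Longrightarrow> ?\<phi> r \<odot>\<^bsub>Y'\<^esub> x = r \<odot>\<^bsub>?Y\<^esub> x"
    by blast
  interpret Y': plain_module ?B Y' by (rule plain_module.intro) (rule Y')
  have \<tau>c: "\<tau> x \<in> carrier Y'" if "x \<in> carrier (Obj Q n)" for x
    using mod_hom_closed[OF \<tau> that] by (simp add: Y'(2))
  have \<tau>a: "\<tau> (a \<odot>\<^bsub>Obj Q n\<^esub> x) = ?\<phi> a \<odot>\<^bsub>Y'\<^esub> \<tau> x" if "a \<in> carrier A" "x \<in> carrier (Obj Q n)" for a x
    using mod_hom_smult[OF \<tau> that] mod_hom_closed[OF \<tau> that(2)] that Y'(5) by simp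
  have \<phi>c: "?\<phi> a \<in> carrier ?B" if "a \<in> carrier A" for a
    using ring_hom_closed[OF \<phi> that] .
  \<comment> \<open>Semilinearity of b (x) m \<mapsto> b \<tau>(m) in its second argument requires
    interchanging two scalars.\<close>
  have comm: "b \<odot>\<^bsub>Y'\<^esub> (b' \<odot>\<^bsub>Y'\<^esub> y) = b' \<odot>\<^bsub>Y'\<^esub> (b \<odot>\<^bsub>Y'\<^esub> y)"
    if "b \<in> carrier ?B" "b' \<in> carrier ?B" "y \<in> carrier Y'" for b b' y
    using that by (simp add: Y'.smult_assoc1[symmetric] B.m_comm)
  have "\<exists>h\<in>mod_hom ?B (Obj ?T n) Y'. \<forall>b\<in>carrier (self_module ?B). \<forall>m\<in>carrier (Obj Q n).
      h (E.pure n b m) = b \<odot>\<^bsub>Y'\<^esub> \<tau> m"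
    unfolding Obj_T
    by (rule E.tensor_lift[OF Y'(1)])
      (simp_all add: \<tau>c Y'.smult_l_distr Y'.smult_r_distr Y'.smult_assoc1 \<tau>a \<phi>c comm
        mod_hom_add[OF \<tau>] Y'(4)[symmetric])
  then obtain h where h: "h \<in> mod_hom ?B (Obj ?T n) Y'"
    "\<And>b m. b \<in> carrier ?B \<Longrightarrow> m \<in> carrier (Obj Q n) \<Longrightarrow> h (E.pure n b m) = b \<odot>\<^bsub>Y'\<^esub> \<tau> m"
    by auto

  \<comment> \<open>Boundaries are cocycles, so the retraction fixes them and their class is zero.
    Consequently \<open>h\<close> will descend to cohomology.\<close>
  have \<tau>d: "\<tau> (Dif Q (n - 1) m) = \<zero>\<^bsub>Y'\<^esub>" if "m \<in> carrier (Obj Q (n - 1))" for m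
  proof -
    have d: "Dif Q (n - 1) m \<in> carrier (cocycles Q n)" "Dif Q (n - 1) m \<in> coboundaries Q n"
      using mod_hom_closed[OF Q.Dif_hom_cocycles that] that by (auto simp: coboundaries_def)
    then have "\<sigma> (Dif Q (n - 1) m) = \<zero>\<^bsub>?H\<^esub>"
      using Q.Z.coset_eq_self_iff[OF Q.submodule_coboundaries] by (simp add: \<sigma>_def s(2) Q.cohomology_zero)
    then show ?thesis using \<tau>0[of "Dif Q (n - 1) m"] d(1) H.submodule_zero[OF W] by (simp add: Y'(3))
  qed
  have hd: "h t = \<zero>\<^bsub>Y'\<^esub>" if t: "t \<in> coboundaries ?T n" for t
  proof -
    have dT: "Dif ?T (n - 1) \<in> mod_hom ?B (Obj ?T (n - 1)) (Obj ?T n)" by (rule T.Dif_hom')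
    have "carrier (Obj ?T (n - 1)) \<subseteq> {u \<in> carrier (Obj ?T (n - 1)). h (Dif ?T (n - 1) u) \<in> {\<zero>\<^bsub>Y'\<^esub>}}"
      unfolding Obj_T
    proof (rule E.tensor_induct)
      show "submodule {u \<in> carrier (tensor_module A ?B ?\<phi> (self_module ?B) (Obj Q (n - 1))).
          h (Dif ?T (n - 1) u) \<in> {\<zero>\<^bsub>Y'\<^esub>}} ?B (tensor_module A ?B ?\<phi> (self_module ?B) (Obj Q (n - 1)))"
        using submodule_vimage[OF T.module_Obj Y'(1) mod_hom_comp[OF dT h(1)] Y'.submodule_singleton_zero]
        by (simp add: Obj_T)
      fix b m assume bm: "b \<in> carrier (self_module ?B)" "m \<in> carrier (Obj Q (n - 1))"
      then have "h (Dif ?T (n - 1) (E.pure (n - 1) b m)) = b \<odot>\<^bsub>Y'\<^esub> \<tau> (Dif Q (n - 1) m)"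
        using Dif_T[of b m "n - 1"] h(2)[of b] mod_hom_closed[OF Q.Dif_hom'] by simp
      then show "E.pure (n - 1) b m \<in> {u \<in> carrier (tensor_module A ?B ?\<phi> (self_module ?B) (Obj Q (n - 1))).
          h (Dif ?T (n - 1) u) \<in> {\<zero>\<^bsub>Y'\<^esub>}}"
        using bm \<tau>d E.pure_closed by simp
    qed
    then show ?thesis using t by (auto simp: coboundaries_def)
  qed
  have hZ: "h \<in> mod_hom ?B (cocycles ?T n) Y'"
    using mod_hom_closed[OF h(1)] mod_hom_add[OF h(1)] mod_hom_smult[OF h(1)] by (intro mod_homI) auto
  obtain g where g: "g \<in> mod_hom ?B (cohomology ?T n) Y'"
    "\<And>z. z \<in> carrier (cocycles ?T n) \<Longrightarrow> g (coboundaries ?T n +>\<^bsub>cocycles ?T n\<^esub> z) = h z"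
    using quotient_lift[OF T.module_cocycles Y'(1) T.submodule_coboundaries hZ hd]
    unfolding cohomology_def by blast
  \<comment> \<open>Each generator is represented by a combination of tensors with second factors in
    \<open>E c\<close>, whose images under \<open>\<sigma>\<close> lie in \<open>W\<close> by
    construction.\<close>
  have "S \<subseteq> {c \<in> carrier (cohomology ?T n). g c \<in> {\<zero>\<^bsub>Y'\<^esub>}}"
  proof
    fix c assume c: "c \<in> S"
    have "module_span ?B (Obj ?T n) ((\<lambda>(b, m). E.pure n b m) ` (carrier ?B \<times> E c))
        \<subseteq> {t \<in> carrier (Obj ?T n). h t \<in> {\<zero>\<^bsub>Y'\<^esub>}}"
    proof (rule module_span_minimal[OF submodule_vimage[OF T.module_Obj Y'(1) h(1)
            Y'.submodule_singleton_zero]], clarsimp)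
      fix b m assume bm: "b \<in> carrier ?B" "m \<in> E c"
      then have m: "m \<in> carrier (Obj Q n)" using zE(4)[OF c] by blast
      have "\<sigma> m \<in> W" using bm c GW by (auto simp: G_def U_def)
      then have "\<tau> m = \<zero>\<^bsub>Y'\<^esub>" using \<tau>0[OF m] by (simp add: Y'(3))
      then show "E.pure n b m \<in> carrier (Obj ?T n) \<and> h (E.pure n b m) = \<zero>\<^bsub>Y'\<^esub>"
        using h(2)[OF bm(1) m] bm m E.pure_closed by (simp add: Obj_T)
    qed
    then have "h (z c) = \<zero>\<^bsub>Y'\<^esub>" using zE(5)[OF c] by blast
    then have "g c = \<zero>\<^bsub>Y'\<^esub>" using g(2)[OF zE(1)[OF c]] zE(2)[OF c] by simp
    then show "c \<in> {c \<in> carrier (cohomology ?T n). g c \<in> {\<zero>\<^bsub>Y'\<^esub>}}" using c S(2) by blast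
  qed
  then have g0: "g c = \<zero>\<^bsub>Y'\<^esub>" if "c \<in> carrier (cohomology ?T n)" for c
    using module_span_minimal[OF submodule_vimage[OF T.module_cohomology Y'(1) g(1)
          Y'.submodule_singleton_zero]] S(3) that by blast
  have "c \<in> W" if "c \<in> carrier ?H" for c
  proof -
    obtain x where x: "x \<in> carrier (cocycles Q n)" "c = coboundaries Q n +>\<^bsub>cocycles Q n\<^esub> x"
      using \<open>c \<in> carrier ?H\<close> by (auto simp: Q.cohomology_carrier simp del: cocycles_sel)
    then have xc: "x \<in> carrier (Obj Q n)" by simp
    \<comment> \<open>This tensor is a cocycle, and \<open>h\<close> sends it to
      \<open>\<tau> x\<close>. As \<open>g\<close> is zero, \<open>\<sigma> x\<close> lies in
      \<open>W\<close>, and it is the class of x because the retraction fixes x.\<close>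
    let ?p = "E.pure n \<one>\<^bsub>?B\<^esub> x"
    have p: "?p \<in> carrier (cocycles ?T n)"
      using Dif_T[OF B.one_closed xc] x(1) E.pure_zero[of "\<one>\<^bsub>?B\<^esub>" "n + 1"] E.pure_closed[of "\<one>\<^bsub>?B\<^esub>" x n]
      by (simp add: Obj_T)
    have "\<zero>\<^bsub>Y'\<^esub> = h ?p"
      using g(2)[OF p] g0 p by (auto simp: T.cohomology_carrier simp del: cocycles_sel)
    then have "\<tau> x = \<zero>\<^bsub>?Y\<^esub>" using h(2)[OF B.one_closed xc] \<tau>c[OF xc] by (simp add: Y'(3))
    then show ?thesis using \<tau>0[OF xc] s(2)[OF x(1)] x(2) by (simp add: \<sigma>_def)
  qed
  then have "W = carrier ?H" using H.submoduleE(1)[OF W] by blast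
  then show ?thesis
    unfolding generated_mod_def W_def G_def using U mod_hom_closed[OF \<sigma>]
    by (intro exI[of _ "\<sigma> ` U"]) auto
qed

section \<open>Adic completion\<close>

abbreviation ideal_pow :: "('a, 'r) ring_scheme \<Rightarrow> 'a set \<Rightarrow> nat \<Rightarrow> 'a set" where
  "ideal_pow R I n \<equiv> I [^]\<^bsub>ideals_set R\<^esub> n"

context cring begin

context fixes I assumes I: "ideal I R" begin

lemma ideal_pow_0: "ideal_pow R I 0 = carrier R"
  by (simp add: nat_pow_def ideals_set_def)

lemma ideal_pow_Suc: "ideal_pow R I (Suc n) = ideal_prod R (ideal_pow R I n) I"
  by (simp add: nat_pow_def ideals_set_def)

lemma ideal_ideal_pow: "ideal (ideal_pow R I n) R"
  by (induction n) (simp_all only: ideal_pow_0 ideal_pow_Suc oneideal ideal_prod_is_ideal I)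

lemma ideal_pow_closed: "r \<in> ideal_pow R I n \<Longrightarrow> r \<in> carrier R"
  using ideal.Icarr[OF ideal_ideal_pow] .

lemma ideal_pow_Suc_subset: "ideal_pow R I (Suc n) \<subseteq> ideal_pow R I n"
  unfolding ideal_pow_Suc using ideal_prod_inter[OF ideal_ideal_pow I] by blast

lemma ideal_pow_mult: "r \<in> ideal_pow R I n \<Longrightarrow> s \<in> I \<Longrightarrow> r \<otimes> s \<in> ideal_pow R I (Suc n)"
  unfolding ideal_pow_Suc by (rule ideal_prod.prod)

lemma submodule_ideal_power_times:
  assumes "module R M"
  shows "submodule (ideal_power_times R I n M) R M"
proof -
  interpret M: plain_module R M by (rule plain_module.intro) fact
  show ?thesis
    unfolding ideal_power_times_def
    by (rule M.submodule_span) (auto intro: ideal_pow_closed)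
qed

lemma ideal_power_times_closed: "module R M \<Longrightarrow> x \<in> ideal_power_times R I n M \<Longrightarrow> x \<in> carrier M"
  using module.submoduleE(1)[OF _ submodule_ideal_power_times] by blast

lemma ideal_power_times_minimal:
  assumes "submodule H R M"
    and "\<And>r x. r \<in> ideal_pow R I n \<Longrightarrow> x \<in> carrier M \<Longrightarrow> r \<odot>\<^bsub>M\<^esub> x \<in> H"
  shows "ideal_power_times R I n M \<subseteq> H"
  unfolding ideal_power_times_def using assms by (intro module_span_minimal) auto

end

lemma smult_mem_ideal_power_times: "r \<in> ideal_pow R I n \<Longrightarrow> x \<in> carrier M \<Longrightarrow> r \<odot>\<^bsub>M\<^esub> x \<in> ideal_power_times R I n M"
  unfolding ideal_power_times_def by (intro subsetD[OF module_span_superset]) auto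

context fixes I assumes I: "ideal I R" begin

lemma ideal_power_times_0:
  assumes "module R M"
  shows "ideal_power_times R I 0 M = carrier M"
proof -
  interpret M: plain_module R M by (rule plain_module.intro) fact
  have "x \<in> ideal_power_times R I 0 M" if "x \<in> carrier M" for x
    using smult_mem_ideal_power_times[of \<one> I 0 x M, unfolded ideal_pow_0[OF I]] that by simp
  then show ?thesis using ideal_power_times_closed[OF I assms] by blast
qed

lemma ideal_power_times_Suc_subset:
  assumes "module R M"
  shows "ideal_power_times R I (Suc n) M \<subseteq> ideal_power_times R I n M"
  by (rule ideal_power_times_minimal[OF I submodule_ideal_power_times[OF I assms]])
    (rule smult_mem_ideal_power_times[OF subsetD[OF ideal_pow_Suc_subset[OF I]]])

lemma ideal_power_times_hom:
  assumes "module R M" "module R N" and f: "f \<in> mod_hom R M N"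
  shows "f ` ideal_power_times R I n M \<subseteq> ideal_power_times R I n N"
proof -
  have "ideal_power_times R I n M \<subseteq> {x \<in> carrier M. f x \<in> ideal_power_times R I n N}"
  proof (rule ideal_power_times_minimal[OF I])
    show "submodule {x \<in> carrier M. f x \<in> ideal_power_times R I n N} R M"
      by (rule submodule_vimage[OF assms submodule_ideal_power_times[OF I assms(2)]])
    fix r x assume rx: "r \<in> ideal_pow R I n" "x \<in> carrier M"
    have r: "r \<in> carrier R" by (rule ideal_pow_closed[OF I rx(1)])
    then show "r \<odot>\<^bsub>M\<^esub> x \<in> {x \<in> carrier M. f x \<in> ideal_power_times R I n N}"
      using rx mod_hom_closed[OF f rx(2)] module.smult_closed[OF assms(1) r rx(2)]
      by (auto simp: mod_hom_smult[OF f] intro: smult_mem_ideal_power_times)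
  qed
  then show ?thesis by auto
qed

text \<open>Multiplication by \<open>r\<close> carries s x with s in I to (r s) x, and r s lies in
  the next power. This raises the order of the remainder when a decomposition is multiplied by an
  element of I^n.\<close>

lemma smult_ideal_power_times_1:
  assumes "module R M" and r: "r \<in> ideal_pow R I n" and x: "x \<in> ideal_power_times R I 1 M"
  shows "r \<odot>\<^bsub>M\<^esub> x \<in> ideal_power_times R I (Suc n) M"
proof -
  interpret M: plain_module R M by (rule plain_module.intro) fact
  have rc: "r \<in> carrier R" by (rule ideal_pow_closed[OF I r])
  have hom: "(\<lambda>x. r \<odot>\<^bsub>M\<^esub> x) \<in> mod_hom R M M"
    using rc by (intro mod_homI) (auto simp: M.smult_r_distr M.smult_assoc1[symmetric] m_comm)
  have "ideal_power_times R I 1 M \<subseteq> {x \<in> carrier M. r \<odot>\<^bsub>M\<^esub> x \<in> ideal_power_times R I (Suc n) M}"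
  proof (rule ideal_power_times_minimal[OF I submodule_vimage[OF assms(1,1) hom submodule_ideal_power_times[OF I assms(1)]]])
    fix s x assume s: "s \<in> ideal_pow R I 1" and x: "x \<in> carrier M"
    have "ideal_pow R I 1 \<subseteq> I"
      using ideal_prod_inter[OF oneideal I] ideal_pow_Suc[OF I, of 0] ideal_pow_0[OF I] by simp
    then have "r \<otimes> s \<in> ideal_pow R I (Suc n)" using ideal_pow_mult[OF I r] s by blast
    then have "r \<odot>\<^bsub>M\<^esub> (s \<odot>\<^bsub>M\<^esub> x) \<in> ideal_power_times R I (Suc n) M"
      using smult_mem_ideal_power_times[of "r \<otimes> s" I "Suc n" x M] x rc ideal_pow_closed[OF I s]
      by (simp add: M.smult_assoc1)
    then show "s \<odot>\<^bsub>M\<^esub> x \<in> {x \<in> carrier M. r \<odot>\<^bsub>M\<^esub> x \<in> ideal_power_times R I (Suc n) M}"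
      using x ideal_pow_closed[OF I s] by simp
  qed
  then show ?thesis using x by blast
qed

lemma ideal_power_times_self_module: "ideal_power_times R I n (self_module R) = ideal_pow R I n"
proof
  interpret S: plain_module R "self_module R"
    by (rule plain_module.intro) (rule module_self_module)
  interpret J: ideal "ideal_pow R I n" R by (rule ideal_ideal_pow[OF I])
  have "submodule (ideal_pow R I n) R (self_module R)"
    by (rule S.submoduleI') (use J.Icarr J.I_l_closed in auto)
  then show "ideal_power_times R I n (self_module R) \<subseteq> ideal_pow R I n"
    using J.I_r_closed by (intro ideal_power_times_minimal[OF I]) auto
  show "ideal_pow R I n \<subseteq> ideal_power_times R I n (self_module R)"
    using smult_mem_ideal_power_times[of _ I n "\<one>" "self_module R"] J.Icarr by fastforce
qed

text \<open>Coordinate projections preserve the filtration; conversely an element is the sum of its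
  components, each a scalar from the power times a basis vector. Convergence in a free module can
  thus be checked on coefficients.\<close>

lemma ideal_power_times_free_module:
  assumes "f \<in> carrier (free_module R S)"
  shows "f \<in> ideal_power_times R I n (free_module R S) \<longleftrightarrow> (\<forall>s\<in>S. f s \<in> ideal_pow R I n)"
proof
  assume f: "f \<in> ideal_power_times R I n (free_module R S)"
  show "\<forall>s\<in>S. f s \<in> ideal_pow R I n"
  proof
    fix s assume "s \<in> S"
    then have "(\<lambda>f. f s) \<in> mod_hom R (free_module R S) (self_module R)"
      by (intro mod_homI) (auto simp: free_module_sel)
    from ideal_power_times_hom[OF module_free_module module_self_module this, of n] f
    show "f s \<in> ideal_pow R I n" by (auto simp: ideal_power_times_self_module)
  qed
next
  assume "\<forall>s\<in>S. f s \<in> ideal_pow R I n"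
  then show "f \<in> ideal_power_times R I n (free_module R S)"
    by (intro free_module_mem_submoduleI[OF submodule_ideal_power_times[OF I module_free_module] assms]
        smult_mem_ideal_power_times free_basis_closed) auto
qed

end

end

section \<open>Completion of modules and of complexes\<close>

locale adic_module = plain_module R M + ideal I R
  for R :: "('a, 'r) ring_scheme" (structure) and M :: "('a, 'b) module" (structure) and I
begin

abbreviation (input) "pw n \<equiv> ideal_power_times R I n M"

lemma id_hom: "(\<lambda>x. x) \<in> mod_hom R M M"
  by (rule mod_homI) auto

lemma submodule_pw: "submodule (pw n) R M"
  by (rule R.submodule_ideal_power_times[OF ideal_axioms module_axioms])

lemma module_level: "module R (quotient_module M (pw n))"
  by (rule module_quotient[OF submodule_pw])

lemma transition_coset:
  "x \<in> carrier M \<Longrightarrow> quotient_map M (pw n) (\<lambda>u. u) (pw (Suc n) +>\<^bsub>M\<^esub> x) = pw n +>\<^bsub>M\<^esub> x"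
  using R.ideal_power_times_Suc_subset[OF ideal_axioms module_axioms]
  by (intro quotient_map_coset[OF module_axioms module_axioms submodule_pw submodule_pw id_hom]) auto

lemma transition_hom:
  "quotient_map M (pw n) (\<lambda>u. u) \<in> mod_hom R (quotient_module M (pw (Suc n))) (quotient_module M (pw n))"
  using R.ideal_power_times_Suc_subset[OF ideal_axioms module_axioms]
  by (intro quotient_map_hom[OF module_axioms module_axioms submodule_pw submodule_pw id_hom]) auto

lemma completion_sel:
  "carrier (completion R I M) = {x. \<forall>n. x n \<in> carrier (quotient_module M (pw n)) \<and>
     quotient_map M (pw n) (\<lambda>u. u) (x (Suc n)) = x n}"
  "\<zero>\<^bsub>completion R I M\<^esub> = (\<lambda>n. \<zero>\<^bsub>quotient_module M (pw n)\<^esub>)"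
  "x \<oplus>\<^bsub>completion R I M\<^esub> y = (\<lambda>n. x n \<oplus>\<^bsub>quotient_module M (pw n)\<^esub> y n)"
  "r \<odot>\<^bsub>completion R I M\<^esub> x = (\<lambda>n. r \<odot>\<^bsub>quotient_module M (pw n)\<^esub> x n)"
  by (simp_all add: completion_def)

lemma module_completion: "module R (completion R I M)"
proof -
  interpret L: plain_module R "quotient_module M (pw n)" for n
    by (rule plain_module.intro) (rule module_level)
  note t = mod_hom_add[OF transition_hom] mod_hom_smult[OF transition_hom]
    mod_hom_zero[OF module_level module_level transition_hom]
    mod_hom_uminus[OF module_level module_level transition_hom]
  show ?thesis
  proof (intro moduleI abelian_groupI)
    fix x assume x: "x \<in> carrier (completion R I M)"
    show "\<exists>y\<in>carrier (completion R I M). y \<oplus>\<^bsub>completion R I M\<^esub> x = \<zero>\<^bsub>completion R I M\<^esub>"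
      by (rule bexI[of _ "\<lambda>n. \<ominus>\<^bsub>quotient_module M (pw n)\<^esub> x n"])
        (use x in \<open>auto simp: completion_sel t L.M.l_neg\<close>)
  qed (auto simp: completion_sel t R.is_cring L.M.a_ac L.smult_l_distr L.smult_r_distr L.smult_assoc1)
qed

text \<open>The n-th entry of a point of the limit lives modulo I^n M, so agreement of x (n + 1)
  with x n modulo I^n M is precisely the compatibility between levels n + 1 and n.\<close>

lemma cauchy_completion:
  assumes "\<And>n. x n \<in> carrier M" "\<And>n. x (Suc n) \<ominus>\<^bsub>M\<^esub> x n \<in> pw n"
  shows "(\<lambda>n. pw n +>\<^bsub>M\<^esub> x n) \<in> carrier (completion R I M)"
proof -
  have eq: "pw n +>\<^bsub>M\<^esub> x (Suc n) = pw n +>\<^bsub>M\<^esub> x n" for n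
    by (rule coset_eqI[OF submodule_pw assms(1) assms(1) assms(2)])
  show ?thesis
    unfolding completion_sel quotient_carrier
    by (intro CollectI allI conjI imageI assms(1)) (rule trans[OF transition_coset[OF assms(1)] eq])
qed

end

lemma completion_map_hom:
  assumes "module R M" "module R N" "ideal I R" and f: "f \<in> mod_hom R M N"
  shows "completion_map R I N f \<in> mod_hom R (completion R I M) (completion R I N)"
    and "\<And>x. (\<And>n. x n \<in> carrier M) \<Longrightarrow> completion_map R I N f (\<lambda>n. ideal_power_times R I n M +>\<^bsub>M\<^esub> x n) =
      (\<lambda>n. ideal_power_times R I n N +>\<^bsub>N\<^esub> f (x n))"
proof -
  interpret M: adic_module R M I by (intro adic_module.intro plain_module.intro assms)
  interpret N: adic_module R N I by (intro adic_module.intro plain_module.intro assms)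
  note sub = M.R.ideal_power_times_hom[OF assms(3,1,2) f]
  note q = quotient_map_hom[OF assms(1,2) M.submodule_pw N.submodule_pw f sub]
  note c = quotient_map_coset[OF assms(1,2) M.submodule_pw N.submodule_pw f sub]
  show "completion_map R I N f (\<lambda>n. ideal_power_times R I n M +>\<^bsub>M\<^esub> x n) =
      (\<lambda>n. ideal_power_times R I n N +>\<^bsub>N\<^esub> f (x n))" if "\<And>n. x n \<in> carrier M" for x
    using that by (simp add: completion_map_def c)
  show "completion_map R I N f \<in> mod_hom R (completion R I M) (completion R I N)"
  proof (rule mod_homI)
    fix x assume x: "x \<in> carrier (completion R I M)"
    have "quotient_map N (ideal_power_times R I n N) (\<lambda>u. u)
        (quotient_map N (ideal_power_times R I (Suc n) N) f (x (Suc n))) =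
      quotient_map N (ideal_power_times R I n N) f (x n)" for n
    proof -
      have "x (Suc n) \<in> carrier (quotient_module M (ideal_power_times R I (Suc n) M))"
        using x by (simp add: M.completion_sel)
      then obtain m where m: "m \<in> carrier M" "x (Suc n) = ideal_power_times R I (Suc n) M +>\<^bsub>M\<^esub> m"
        unfolding M.quotient_carrier by blast
      moreover have "x n = quotient_map M (ideal_power_times R I n M) (\<lambda>u. u) (x (Suc n))"
        using x by (simp add: M.completion_sel)
      ultimately show ?thesis
        by (simp add: c M.transition_coset N.transition_coset mod_hom_closed[OF f])
    qed
    then show "completion_map R I N f x \<in> carrier (completion R I N)"
      using x mod_hom_closed[OF q] by (simp add: M.completion_sel N.completion_sel completion_map_def)
  next
    fix x y assume "x \<in> carrier (completion R I M)" "y \<in> carrier (completion R I M)"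
    then show "completion_map R I N f (x \<oplus>\<^bsub>completion R I M\<^esub> y) =
        completion_map R I N f x \<oplus>\<^bsub>completion R I N\<^esub> completion_map R I N f y"
      using mod_hom_add[OF q] by (auto simp: M.completion_sel N.completion_sel completion_map_def)
  next
    fix r x assume "r \<in> carrier R" "x \<in> carrier (completion R I M)"
    then show "completion_map R I N f (r \<odot>\<^bsub>completion R I M\<^esub> x) =
        r \<odot>\<^bsub>completion R I N\<^esub> completion_map R I N f x"
      using mod_hom_smult[OF q] by (auto simp: M.completion_sel N.completion_sel completion_map_def)
  qed
qed

lemma cochain_complex_completion:
  assumes "cochain_complex R C" "ideal I R"
  shows "cochain_complex R (completion_complex R I C)"
proof -
  interpret C: complex R C by (rule complex.intro) fact
  have A: "adic_module R (Obj C i) I" for i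
    by (rule adic_module.intro[OF plain_module.intro[OF C.module_Obj] assms(2)])
  note d = completion_map_hom[OF C.module_Obj C.module_Obj assms(2) C.Dif_hom]
  have i2: "i + 1 + 1 = i + 2" for i :: int by simp
  have "completion_map R I (Obj C (i + 2)) (Dif C (i + 1)) (completion_map R I (Obj C (i + 1)) (Dif C i) x) =
      \<zero>\<^bsub>completion R I (Obj C (i + 2))\<^esub>" if x: "x \<in> carrier (completion R I (Obj C i))" for i x
  proof -
    \<comment> \<open>Representatives are chosen level by level, with no compatibility among them in
      the module, since the completed differential also acts level by level.\<close>
    have "\<forall>n. \<exists>m. m \<in> carrier (Obj C i) \<and> x n = ideal_power_times R I n (Obj C i) +>\<^bsub>Obj C i\<^esub> m"
    proof
      fix n
      have "x n \<in> carrier (quotient_module (Obj C i) (ideal_power_times R I n (Obj C i)))"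
        using x by (simp add: adic_module.completion_sel[OF A])
      then show "\<exists>m. m \<in> carrier (Obj C i) \<and> x n = ideal_power_times R I n (Obj C i) +>\<^bsub>Obj C i\<^esub> m"
        unfolding C.Obj.quotient_carrier by blast
    qed
    from choice[OF this] obtain m where m: "\<And>n. m n \<in> carrier (Obj C i)"
      "x = (\<lambda>n. ideal_power_times R I n (Obj C i) +>\<^bsub>Obj C i\<^esub> m n)"
      by blast
    have "completion_map R I (Obj C (i + 2)) (Dif C (i + 1)) (completion_map R I (Obj C (i + 1)) (Dif C i) x) =
      (\<lambda>n. ideal_power_times R I n (Obj C (i + 2)) +>\<^bsub>Obj C (i + 2)\<^esub> \<zero>\<^bsub>Obj C (i + 2)\<^esub>)"
      unfolding m(2) d(2)[OF m(1)]
      using d(2)[of "\<lambda>n. Dif C i (m n)" "i + 1"] mod_hom_closed[OF C.Dif_hom m(1)] C.Dif_Dif[OF m(1)]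
      by (simp add: i2)
    moreover have "ideal_power_times R I n (Obj C i) +>\<^bsub>Obj C i\<^esub> \<zero>\<^bsub>Obj C i\<^esub> =
        ideal_power_times R I n (Obj C i)" for n i
      by (rule iffD2[OF C.Obj.coset_eq_self_iff[OF adic_module.submodule_pw[OF A] C.Obj.M.zero_closed]
            C.Obj.submodule_zero[OF adic_module.submodule_pw[OF A]]])
    ultimately show ?thesis
      by (simp add: adic_module.completion_sel[OF A] C.Obj.quotient_zero)
  qed
  then show ?thesis
    using d(1) adic_module.module_completion[OF A] by (simp add: cochain_complex_def completion_complex_def i2)
qed

lemma zero_mem_ideal_power_times:
  assumes "cring R" "ideal I R" "module R M"
  shows "\<zero>\<^bsub>M\<^esub> \<in> ideal_power_times R I n M"
  using plain_module.submodule_zero[OF plain_module.intro[OF assms(3)] cring.submodule_ideal_power_times[OF assms]] .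

section \<open>Lifting generators along the completion\<close>

lemma fin_gen_cohomology_of_generated_mod:
  fixes R :: "('a, 'r) ring_scheme" and C :: "('a, 'b) cochain"
  assumes "cring R" "ideal I R" and complete: "adically_complete_ring R I"
    and C: "cochain_complex R C"
    and qi: "quasi_isomorphism R C (completion_complex R I C) (\<lambda>i. completion_unit R I (Obj C i))"
    and gen: "generated_mod R I (cohomology C n)"
  shows "fin_gen_module R (cohomology C n)"
proof -
  interpret R: cring R by fact
  interpret I: ideal I R by fact
  interpret C: complex R C by (rule complex.intro) fact
  let ?P = "Obj C (n - 1)" and ?Z = "cocycles C n" and ?H = "cohomology C n"
  let ?d = "Dif C (n - 1)" and ?cl = "a_r_coset ?Z (coboundaries C n)"
  let ?p = "\<lambda>k M. ideal_power_times R I k M"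
  interpret H: plain_module R ?H by (rule plain_module.intro) (rule C.module_cohomology)
  note d = C.Dif_hom_cocycles[of n]
  note Z = C.module_cocycles[of n]
  note P = C.module_Obj[of "n - 1"]
  note sub = R.submodule_ideal_power_times[OF I.ideal_axioms]
  note sub0 = zero_mem_ideal_power_times[OF R.is_cring I.ideal_axioms]

  obtain S where S: "finite S" "S \<subseteq> carrier ?H"
    "module_span R ?H (S \<union> {r \<odot>\<^bsub>?H\<^esub> x | r x. r \<in> I \<and> x \<in> carrier ?H}) = carrier ?H"
    using gen by (auto simp: generated_mod_def)
  have "\<forall>c\<in>S. \<exists>z. z \<in> carrier ?Z \<and> c = ?cl z"
    using S(2) unfolding C.cohomology_carrier by blast
  from bchoice[OF this] obtain s where s: "\<And>c. c \<in> S \<Longrightarrow> s c \<in> carrier ?Z" "\<And>c. c \<in> S \<Longrightarrow> c = ?cl (s c)"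
    by blast
  let ?F = "free_module R S"
  interpret F: plain_module R ?F by (rule plain_module.intro) (rule R.module_free_module)
  obtain \<phi> where \<phi>: "\<phi> \<in> mod_hom R ?F ?Z" "\<And>c. c \<in> S \<Longrightarrow> \<phi> (free_basis R c) = s c"
    using R.free_module_lift[OF Z, of s S] s(1) by blast

  \<comment> \<open>One approximation step: coefficients and cochain are of order k, and the
    remainder is of order k + 1 inside the cocycle module, so that the step can be repeated on
    it.\<close>
  define dec where "dec k z \<longleftrightarrow> (\<exists>a\<in>?p k ?F. \<exists>u\<in>?p k ?P. \<exists>v\<in>?p (Suc k) ?Z. z = \<phi> a \<oplus>\<^bsub>?Z\<^esub> ?d u \<oplus>\<^bsub>?Z\<^esub> v)" for k z
  have ac: "a \<in> carrier ?F" if "a \<in> ?p k ?F" for a k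
    using R.ideal_power_times_closed[OF I.ideal_axioms F.module_axioms that] .
  have uc: "u \<in> carrier ?P" if "u \<in> ?p k ?P" for u k
    using R.ideal_power_times_closed[OF I.ideal_axioms P that] .
  have vc: "v \<in> carrier ?Z" if "v \<in> ?p k ?Z" for v k
    using R.ideal_power_times_closed[OF I.ideal_axioms Z that] .
  note cl = mod_hom_closed[OF \<phi>(1)] mod_hom_closed[OF d]
  have decI: "dec k (\<phi> a \<oplus>\<^bsub>?Z\<^esub> ?d u \<oplus>\<^bsub>?Z\<^esub> v)" if "a \<in> ?p k ?F" "u \<in> ?p k ?P" "v \<in> ?p (Suc k) ?Z" for k a u v
    using that unfolding dec_def by blast
  have dec_submodule: "submodule {z \<in> carrier ?Z. dec k z} R ?Z" for k
  proof (rule C.Z.submoduleI')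
    show "\<zero>\<^bsub>?Z\<^esub> \<in> {z \<in> carrier ?Z. dec k z}"
      using decI[OF sub0[OF F.module_axioms] sub0[OF P] sub0[OF Z], of k]
        mod_hom_zero[OF F.module_axioms Z \<phi>(1)] mod_hom_zero[OF P Z d] C.Z.M.zero_closed[of n]
        C.Z.M.l_zero[OF C.Z.M.zero_closed, of n]
      by (simp del: cocycles_sel)
  next
    fix x y assume "x \<in> {z \<in> carrier ?Z. dec k z}" "y \<in> {z \<in> carrier ?Z. dec k z}"
    then obtain a u v a' u' v' where
      x: "a \<in> ?p k ?F" "u \<in> ?p k ?P" "v \<in> ?p (Suc k) ?Z" "x = \<phi> a \<oplus>\<^bsub>?Z\<^esub> ?d u \<oplus>\<^bsub>?Z\<^esub> v" and
      y: "a' \<in> ?p k ?F" "u' \<in> ?p k ?P" "v' \<in> ?p (Suc k) ?Z" "y = \<phi> a' \<oplus>\<^bsub>?Z\<^esub> ?d u' \<oplus>\<^bsub>?Z\<^esub> v'"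
      and xy: "x \<in> carrier ?Z" "y \<in> carrier ?Z"
      unfolding dec_def by blast
    have "x \<oplus>\<^bsub>?Z\<^esub> y = \<phi> (a \<oplus>\<^bsub>?F\<^esub> a') \<oplus>\<^bsub>?Z\<^esub> ?d (u \<oplus>\<^bsub>?P\<^esub> u') \<oplus>\<^bsub>?Z\<^esub> (v \<oplus>\<^bsub>?Z\<^esub> v')"
      using cl(1)[OF ac[OF x(1)]] cl(1)[OF ac[OF y(1)]] cl(2)[OF uc[OF x(2)]] cl(2)[OF uc[OF y(2)]]
        vc[OF x(3)] vc[OF y(3)]
      by (simp add: x(4) y(4) mod_hom_add[OF \<phi>(1) ac[OF x(1)] ac[OF y(1)]]
          mod_hom_add[OF d uc[OF x(2)] uc[OF y(2)]] C.Z.M.a_ac del: cocycles_sel)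
    then show "x \<oplus>\<^bsub>?Z\<^esub> y \<in> {z \<in> carrier ?Z. dec k z}"
      using decI[OF F.submoduleE(5)[OF sub[OF F.module_axioms] x(1) y(1)]
          C.Obj.submoduleE(5)[OF sub[OF P] x(2) y(2)] C.Z.submoduleE(5)[OF sub[OF Z] x(3) y(3)]]
        C.Z.M.a_closed[OF xy] by simp
  next
    fix r x assume r: "r \<in> carrier R" and "x \<in> {z \<in> carrier ?Z. dec k z}"
    then obtain a u v where
      x: "a \<in> ?p k ?F" "u \<in> ?p k ?P" "v \<in> ?p (Suc k) ?Z" "x = \<phi> a \<oplus>\<^bsub>?Z\<^esub> ?d u \<oplus>\<^bsub>?Z\<^esub> v"
      and xc: "x \<in> carrier ?Z"
      unfolding dec_def by blast
    have "r \<odot>\<^bsub>?Z\<^esub> x = \<phi> (r \<odot>\<^bsub>?F\<^esub> a) \<oplus>\<^bsub>?Z\<^esub> ?d (r \<odot>\<^bsub>?P\<^esub> u) \<oplus>\<^bsub>?Z\<^esub> (r \<odot>\<^bsub>?Z\<^esub> v)"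
      using cl(1)[OF ac[OF x(1)]] cl(2)[OF uc[OF x(2)]] vc[OF x(3)] r
      by (simp add: x(4) mod_hom_smult[OF \<phi>(1) r ac[OF x(1)]]
          mod_hom_smult[OF d r uc[OF x(2)]] C.Z.smult_r_distr del: cocycles_sel)
    then show "r \<odot>\<^bsub>?Z\<^esub> x \<in> {z \<in> carrier ?Z. dec k z}"
      using decI[OF F.submoduleE(4)[OF sub[OF F.module_axioms] r x(1)]
          C.Obj.submoduleE(4)[OF sub[OF P] r x(2)] C.Z.submoduleE(4)[OF sub[OF Z] r x(3)]]
        C.Z.smult_closed[OF r xc] by simp
  qed blast

  have dec0: "dec 0 z" if z: "z \<in> carrier ?Z" for z
  proof -
    \<comment> \<open>The classes of elements of \<open>?K\<close> form a submodule that contains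
      \<open>S\<close> through the term \<open>a\<close> and I H through the remainder, so every
      class is hit. A coboundary, which lies in \<open>?K\<close> through the term \<open>u\<close>,
      then corrects to the given cocycle.\<close>
    let ?K = "{z \<in> carrier ?Z. dec 0 z}"
    note p0 = R.ideal_power_times_0[OF I.ideal_axioms]
    have "I \<subseteq> ideal_pow R I (Suc 0)"
    proof
      fix r assume "r \<in> I"
      then show "r \<in> ideal_pow R I (Suc 0)"
        using R.ideal_pow_mult[OF I.ideal_axioms, of "\<one>\<^bsub>R\<^esub>" 0 r] I.Icarr[of r]
        by (simp only: R.ideal_pow_0[OF I.ideal_axioms] R.one_closed R.l_one)
    qed
    then have pI: "r \<odot>\<^bsub>?Z\<^esub> x \<in> ?p (Suc 0) ?Z" if "r \<in> I" "x \<in> carrier ?Z" for r x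
      using R.smult_mem_ideal_power_times[of r I "Suc 0" x ?Z] that by blast
    have zero: "\<phi> \<zero>\<^bsub>?F\<^esub> = \<zero>\<^bsub>?Z\<^esub>" "?d \<zero>\<^bsub>?P\<^esub> = \<zero>\<^bsub>?Z\<^esub>"
      by (rule mod_hom_zero[OF F.module_axioms Z \<phi>(1)], rule mod_hom_zero[OF P Z d])
    have K1: "\<phi> a \<in> ?K" if "a \<in> carrier ?F" for a
      using decI[of a 0 "\<zero>\<^bsub>?P\<^esub>" "\<zero>\<^bsub>?Z\<^esub>"] that cl(1)[OF that] sub0[OF Z, of "Suc 0"]
      by (simp add: p0 F.module_axioms P zero del: cocycles_sel)
    have K2: "?d u \<in> ?K" if "u \<in> carrier ?P" for u
      using decI[of "\<zero>\<^bsub>?F\<^esub>" 0 u "\<zero>\<^bsub>?Z\<^esub>"] that cl(2)[OF that] sub0[OF Z, of "Suc 0"]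
      by (simp add: p0 F.module_axioms P zero del: cocycles_sel)
    have K3: "v \<in> ?K" if "v \<in> ?p (Suc 0) ?Z" for v
      using decI[of "\<zero>\<^bsub>?F\<^esub>" 0 "\<zero>\<^bsub>?P\<^esub>" v] that vc[OF that]
      by (simp add: p0 F.module_axioms P zero del: cocycles_sel)
    have "carrier ?H \<subseteq> ?cl ` ?K"
    proof (subst S(3)[symmetric], rule module_span_minimal)
      show "submodule (?cl ` ?K) R ?H"
        by (rule submodule_image[OF Z C.module_cohomology C.class_hom dec_submodule])
      have "c \<in> ?cl ` ?K" if "c \<in> S" for c
        by (rule image_eqI[OF _ K1[OF R.free_basis_closed[OF that]]]) (simp only: \<phi>(2)[OF that] s(2)[OF that, symmetric])
      moreover have "r \<odot>\<^bsub>?H\<^esub> x \<in> ?cl ` ?K" if rx: "r \<in> I" "x \<in> carrier ?H" for r x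
      proof -
        obtain y where y: "y \<in> carrier ?Z" "x = ?cl y"
          using rx(2) unfolding C.cohomology_carrier by blast
        then have "r \<odot>\<^bsub>?H\<^esub> x = ?cl (r \<odot>\<^bsub>?Z\<^esub> y)"
          using mod_hom_smult[OF C.class_hom I.Icarr[OF rx(1)] y(1)] by simp
        then show ?thesis using K3[OF pI[OF rx(1) y(1)]] by blast
      qed
      ultimately show "S \<union> {r \<odot>\<^bsub>?H\<^esub> x | r x. r \<in> I \<and> x \<in> carrier ?H} \<subseteq> ?cl ` ?K"
        by blast
    qed
    moreover have "?cl z \<in> carrier ?H" by (rule mod_hom_closed[OF C.class_hom z])
    ultimately obtain k where k: "k \<in> ?K" "?cl z = ?cl k" by blast
    then have kc: "k \<in> carrier ?Z" by blast
    have "z \<ominus>\<^bsub>?Z\<^esub> k \<in> coboundaries C n"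
      by (rule C.Z.coset_eqD[OF C.submodule_coboundaries z kc k(2)])
    then obtain u where "u \<in> carrier ?P" "z \<ominus>\<^bsub>?Z\<^esub> k = ?d u"
      unfolding coboundaries_def by (rule imageE)
    then have "z \<ominus>\<^bsub>?Z\<^esub> k \<in> ?K" using K2[of u] by simp
    then have "(z \<ominus>\<^bsub>?Z\<^esub> k) \<oplus>\<^bsub>?Z\<^esub> k \<in> ?K"
      using C.Z.submoduleE(5)[OF dec_submodule] k(1) by blast
    moreover have "(z \<ominus>\<^bsub>?Z\<^esub> k) \<oplus>\<^bsub>?Z\<^esub> k = z"
      using z kc by (simp add: a_minus_def C.Z.M.a_assoc C.Z.M.l_neg del: cocycles_sel)
    ultimately show ?thesis by simp
  qed

  have dec: "dec k v" if v: "v \<in> ?p k ?Z" for k v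
  proof -
    have "?p k ?Z \<subseteq> {z \<in> carrier ?Z. dec k z}"
    proof (rule R.ideal_power_times_minimal[OF I.ideal_axioms dec_submodule])
      \<comment> \<open>The decomposition of z at level 0 is multiplied by \<open>r\<close>, and all
        three terms gain order k.\<close>
      fix r z assume r: "r \<in> ideal_pow R I k" and z: "z \<in> carrier ?Z"
      have rc: "r \<in> carrier R" by (rule R.ideal_pow_closed[OF I.ideal_axioms r])
      obtain a u v where
        x: "a \<in> carrier ?F" "u \<in> carrier ?P" "v \<in> ?p 1 ?Z" "z = \<phi> a \<oplus>\<^bsub>?Z\<^esub> ?d u \<oplus>\<^bsub>?Z\<^esub> v"
        using dec0[OF z] ac uc unfolding dec_def One_nat_def by blast
      have "r \<odot>\<^bsub>?Z\<^esub> z = \<phi> (r \<odot>\<^bsub>?F\<^esub> a) \<oplus>\<^bsub>?Z\<^esub> ?d (r \<odot>\<^bsub>?P\<^esub> u) \<oplus>\<^bsub>?Z\<^esub> (r \<odot>\<^bsub>?Z\<^esub> v)"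
        using cl(1)[OF x(1)] cl(2)[OF x(2)] vc[OF x(3)] rc
        by (simp add: x(4) mod_hom_smult[OF \<phi>(1) rc x(1)]
            mod_hom_smult[OF d rc x(2)] C.Z.smult_r_distr del: cocycles_sel)
      then show "r \<odot>\<^bsub>?Z\<^esub> z \<in> {z \<in> carrier ?Z. dec k z}"
        using decI[OF R.smult_mem_ideal_power_times[OF r x(1)] R.smult_mem_ideal_power_times[OF r x(2)]
            R.smult_ideal_power_times_1[OF I.ideal_axioms Z r x(3)]] C.Z.smult_closed[OF rc z] by simp
    qed
    then show ?thesis using v by blast
  qed

  let ?D = "completion_complex R I C"
  interpret D: complex R ?D
    by (rule complex.intro) (rule cochain_complex_completion[OF C I.ideal_axioms])
  \<comment> \<open>Cohomological completeness enters here: the class of y dies in the completed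
    complex, and injectivity on cohomology makes y bound in \<open>C\<close>.\<close>
  have tau_inj: "y \<in> coboundaries C n"
    if y: "y \<in> carrier ?Z" "completion_unit R I (Obj C n) y \<in> coboundaries ?D n" for y
  proof -
    let ?\<tau> = "\<lambda>i. completion_unit R I (Obj C i)"
    let ?q = "quotient_map (cocycles ?D n) (coboundaries ?D n) (?\<tau> n)"
    have cm: "chain_map R C ?D ?\<tau>" and bij: "bij_betw ?q (carrier ?H) (carrier (cohomology ?D n))"
      using qi unfolding quasi_isomorphism_def by blast+
    note \<tau>Z = chain_map_cocycles[OF C D.cochain_complex cm, of n]
    note q = chain_map_cohomology[OF C D.cochain_complex cm, of n]
    have "?q (?cl y) = coboundaries ?D n +>\<^bsub>cocycles ?D n\<^esub> ?\<tau> n y"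
      by (rule quotient_map_coset[OF Z D.module_cocycles C.submodule_coboundaries
            D.submodule_coboundaries \<tau>Z chain_map_coboundaries[OF cm] y(1)])
    also have "\<dots> = \<zero>\<^bsub>cohomology ?D n\<^esub>"
      unfolding D.cohomology_zero
      by (rule iffD2[OF D.Z.coset_eq_self_iff[OF D.submodule_coboundaries mod_hom_closed[OF \<tau>Z y(1)]] y(2)])
    also have "\<dots> = ?q \<zero>\<^bsub>?H\<^esub>"
      by (rule mod_hom_zero[OF C.module_cohomology D.module_cohomology q, symmetric])
    finally have "?cl y = \<zero>\<^bsub>?H\<^esub>"
      by (rule inj_onD[OF bij_betw_imp_inj_on[OF bij] _ mod_hom_closed[OF C.class_hom y(1)] H.M.zero_closed])
    then show ?thesis
      unfolding C.cohomology_zero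
      by (rule iffD1[OF C.Z.coset_eq_self_iff[OF C.submodule_coboundaries y(1)]])
  qed

  have lift: "\<exists>u\<in>carrier ?P. \<exists>\<alpha>\<in>carrier ?F. z = \<phi> \<alpha> \<oplus>\<^bsub>?Z\<^esub> ?d u" if z: "z \<in> carrier ?Z" for z
  proof -
    \<comment> \<open>The state consists of coefficients, cochain and remainder;
      \<open>next_to\<close> records that the first two change by terms of order k, which makes them
      Cauchy sequences.\<close>
    define good where "good k t \<longleftrightarrow> (case t of (a, u, v) \<Rightarrow> a \<in> carrier ?F \<and> u \<in> carrier ?P \<and> v \<in> ?p k ?Z \<and>
      z = \<phi> a \<oplus>\<^bsub>?Z\<^esub> ?d u \<oplus>\<^bsub>?Z\<^esub> v)" for k t
    define next_to where "next_to k t t' \<longleftrightarrow> fst t' \<ominus>\<^bsub>?F\<^esub> fst t \<in> ?p k ?F \<and>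
      fst (snd t') \<ominus>\<^bsub>?P\<^esub> fst (snd t) \<in> ?p k ?P"
      for k and t t' :: "('b set \<Rightarrow> 'a) \<times> 'b \<times> 'b"
    have "\<exists>t. \<forall>k. good k (t k) \<and> next_to k (t k) (t (Suc k))"
    proof (rule dependent_nat_choice)
      \<comment> \<open>Everything starts in the remainder, as the zeroth power of the ideal times Z
        is Z.\<close>
      have "good 0 (\<zero>\<^bsub>?F\<^esub>, \<zero>\<^bsub>?P\<^esub>, z)"
        using z by (simp add: good_def R.ideal_power_times_0[OF I.ideal_axioms Z] mod_hom_zero[OF F.module_axioms Z \<phi>(1)]
            mod_hom_zero[OF P Z d] del: cocycles_sel)
      then show "\<exists>t. good 0 t" by blast
    next
      fix t k assume good: "good k t"
      obtain a u v where t: "t = (a, u, v)" by (cases t)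
      have a: "a \<in> carrier ?F" and u: "u \<in> carrier ?P" and v: "v \<in> ?p k ?Z"
        and zt: "z = \<phi> a \<oplus>\<^bsub>?Z\<^esub> ?d u \<oplus>\<^bsub>?Z\<^esub> v"
        using good unfolding t good_def prod.case by blast+
      obtain a' u' v' where a': "a' \<in> ?p k ?F" and u': "u' \<in> ?p k ?P" and v': "v' \<in> ?p (Suc k) ?Z"
        and vt: "v = \<phi> a' \<oplus>\<^bsub>?Z\<^esub> ?d u' \<oplus>\<^bsub>?Z\<^esub> v'"
        using dec[OF v] unfolding dec_def by blast
      have "z = \<phi> (a \<oplus>\<^bsub>?F\<^esub> a') \<oplus>\<^bsub>?Z\<^esub> ?d (u \<oplus>\<^bsub>?P\<^esub> u') \<oplus>\<^bsub>?Z\<^esub> v'"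
        using cl(1)[OF a] cl(2)[OF u] cl(1)[OF ac[OF a']] cl(2)[OF uc[OF u']] vc[OF v']
        unfolding zt vt mod_hom_add[OF \<phi>(1) a ac[OF a']] mod_hom_add[OF d u uc[OF u']]
        by (simp add: C.Z.M.a_ac del: cocycles_sel)
      then have "good (Suc k) (a \<oplus>\<^bsub>?F\<^esub> a', u \<oplus>\<^bsub>?P\<^esub> u', v')"
        using F.M.a_closed[OF a ac[OF a']] C.Obj.M.a_closed[OF u uc[OF u']] v' by (simp add: good_def)
      moreover have "(a \<oplus>\<^bsub>?F\<^esub> a') \<ominus>\<^bsub>?F\<^esub> a = a'"
        unfolding a_minus_def F.M.a_comm[OF a ac[OF a']]
        by (simp add: F.M.a_assoc F.M.r_neg a ac[OF a'])
      moreover have "(u \<oplus>\<^bsub>?P\<^esub> u') \<ominus>\<^bsub>?P\<^esub> u = u'"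
        unfolding a_minus_def C.Obj.M.a_comm[OF u uc[OF u']]
        by (simp add: C.Obj.M.a_assoc C.Obj.M.r_neg u uc[OF u'])
      ultimately show "\<exists>t'. good (Suc k) t' \<and> next_to k t t'"
        using a' u' by (intro exI[of _ "(a \<oplus>\<^bsub>?F\<^esub> a', u \<oplus>\<^bsub>?P\<^esub> u', v')"]) (simp add: next_to_def t)
    qed
    then obtain t where t: "\<And>k. good k (t k)" "\<And>k. next_to k (t k) (t (Suc k))" by blast
    define a u v where "a k = fst (t k)" and "u k = fst (snd (t k))" and "v k = snd (snd (t k))" for k
    have "good k (a k, u k, v k)" for k using t(1)[of k] by (simp add: a_def u_def v_def)
    then have a: "a k \<in> carrier ?F" and u: "u k \<in> carrier ?P" and v: "v k \<in> ?p k ?Z"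
      and zk: "z = \<phi> (a k) \<oplus>\<^bsub>?Z\<^esub> ?d (u k) \<oplus>\<^bsub>?Z\<^esub> v k"
      for k
      unfolding good_def prod.case by blast+
    have a_next: "a (Suc k) \<ominus>\<^bsub>?F\<^esub> a k \<in> ?p k ?F" and u_next: "u (Suc k) \<ominus>\<^bsub>?P\<^esub> u k \<in> ?p k ?P" for k
      using t(2)[of k] unfolding next_to_def a_def u_def by blast+

    let ?A = "self_module R"
    interpret A: adic_module R ?A I
      by (rule adic_module.intro[OF plain_module.intro[OF R.module_self_module] I.ideal_axioms])
    have ev: "(\<lambda>f. f c) \<in> mod_hom R ?F ?A" for c
      by (rule mod_homI) (use R.free_module_apply[of _ S] in \<open>simp_all add: free_module_sel(3,4)\<close>)
    \<comment> \<open>Completeness of the ring is applied to each coefficient sequence separately,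
      with the ring regarded as a module over itself.\<close>
    have "\<forall>c. \<exists>r. r \<in> carrier R \<and> (\<forall>k. r \<ominus>\<^bsub>?A\<^esub> a k c \<in> ?p k ?A)"
    proof
      fix c
      have ak: "a k c \<in> carrier ?A" for k using R.free_module_apply[OF a] by simp
      have "a (Suc k) c \<ominus>\<^bsub>?A\<^esub> a k c \<in> ?p k ?A" for k
        using R.ideal_power_times_hom[OF I.ideal_axioms F.module_axioms R.module_self_module ev[of c]] a_next[of k]
        unfolding mod_hom_minus[OF F.module_axioms R.module_self_module ev[of c] a a, symmetric] by blast
      then have "(\<lambda>k. ?p k ?A +>\<^bsub>?A\<^esub> a k c) \<in> carrier (completion R I ?A)"
        by (rule A.cauchy_completion[OF ak])
      then have "(\<lambda>k. ?p k ?A +>\<^bsub>?A\<^esub> a k c) \<in> completion_unit R I ?A ` carrier R"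
        using bij_betw_imp_surj_on[OF complete[unfolded adically_complete_ring_def]] by simp
      then obtain r where r: "r \<in> carrier R" "completion_unit R I ?A r = (\<lambda>k. ?p k ?A +>\<^bsub>?A\<^esub> a k c)"
        by (elim imageE) simp
      then have "r \<ominus>\<^bsub>?A\<^esub> a k c \<in> ?p k ?A" for k
        using ak by (intro A.coset_eqD[OF A.submodule_pw]) (auto simp: completion_unit_def fun_eq_iff)
      then show "\<exists>r. r \<in> carrier R \<and> (\<forall>k. r \<ominus>\<^bsub>?A\<^esub> a k c \<in> ?p k ?A)" using r(1) by blast
    qed
    from choice[OF this] obtain r where r: "\<And>c. r c \<in> carrier R" "\<And>c k. r c \<ominus>\<^bsub>?A\<^esub> a k c \<in> ?p k ?A"
      by blast
    \<comment> \<open>Limits were chosen for all indices c; outside \<open>S\<close> the value is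
      reset to zero to obtain an element of the free module, whose support is finite because
      \<open>S\<close> is.\<close>
    define \<alpha> where "\<alpha> c = (if c \<in> S then r c else \<zero>\<^bsub>R\<^esub>)" for c
    have \<alpha>: "\<alpha> \<in> carrier ?F"
      using S(1) r(1) by (auto simp: free_module_sel(1) \<alpha>_def elim: rev_finite_subset)
    have \<alpha>a: "\<alpha> \<ominus>\<^bsub>?F\<^esub> a k \<in> ?p k ?F" for k
    proof -
      have "(\<alpha> \<ominus>\<^bsub>?F\<^esub> a k) c \<in> ideal_pow R I k" if "c \<in> S" for c
        using mod_hom_minus[OF F.module_axioms R.module_self_module ev[of c] \<alpha> a] r(2)[of c k] that
        by (simp add: \<alpha>_def R.ideal_power_times_self_module[OF I.ideal_axioms])
      then show ?thesis
        using R.ideal_power_times_free_module[OF I.ideal_axioms F.M.minus_closed[OF \<alpha> a]] by blast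
    qed

    let ?O = "Obj C n"
    define y where "y = z \<ominus>\<^bsub>?Z\<^esub> \<phi> \<alpha>"
    have y: "y \<in> carrier ?Z" unfolding y_def by (rule C.Z.M.minus_closed[OF z cl(1)[OF \<alpha>]])
    have ZO: "(\<lambda>x. x) \<in> mod_hom R ?Z ?O" by (rule mod_homI) auto
    \<comment> \<open>The difference of the two sides is the remainder \<open>v k\<close> minus
      \<open>\<phi>\<close> of the error in the coefficients; both lie in I^k Z, hence in I^k times
      the ambient term.\<close>
    have y_du: "?p k ?O +>\<^bsub>?O\<^esub> y = ?p k ?O +>\<^bsub>?O\<^esub> ?d (u k)" for k
    proof -
      define w where "w = v k \<ominus>\<^bsub>?Z\<^esub> \<phi> (\<alpha> \<ominus>\<^bsub>?F\<^esub> a k)"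
      have "\<phi> (\<alpha> \<ominus>\<^bsub>?F\<^esub> a k) \<in> ?p k ?Z"
        using R.ideal_power_times_hom[OF I.ideal_axioms F.module_axioms Z \<phi>(1)] \<alpha>a by blast
      then have w: "w \<in> ?p k ?Z"
        unfolding w_def a_minus_def
        by (rule C.Z.submoduleE(5)[OF sub[OF Z] v C.Z.submoduleE(3)[OF sub[OF Z]]])
      then have wO: "w \<in> ?p k ?O"
        using R.ideal_power_times_hom[OF I.ideal_axioms Z C.module_Obj ZO] by blast
      have "y = ?d (u k) \<oplus>\<^bsub>?Z\<^esub> w"
        unfolding y_def w_def mod_hom_minus[OF F.module_axioms Z \<phi>(1) \<alpha> a]
        using cl(1)[OF a[of k]] cl(1)[OF \<alpha>] cl(2)[OF u[of k]] vc[OF v[of k]]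
        by (subst zk[of k]) (simp add: a_minus_def C.Z.M.minus_add C.Z.M.a_ac del: cocycles_sel)
      then have "y \<ominus>\<^bsub>?O\<^esub> ?d (u k) = w"
        using mod_hom_closed[OF C.Dif_hom' u[of k]] R.ideal_power_times_closed[OF I.ideal_axioms C.module_Obj wO]
        by (simp add: a_minus_def C.Obj.M.a_ac C.Obj.M.r_neg)
      then show ?thesis
        using y wO by (intro C.Obj.coset_eqI[OF sub[OF C.module_Obj]] mod_hom_closed[OF C.Dif_hom' u]) auto
    qed
    have P_ad: "adic_module R ?P I"
      by (rule adic_module.intro[OF plain_module.intro[OF P] I.ideal_axioms])
    \<comment> \<open>The cochains \<open>u k\<close> need not converge in \<open>?P\<close>, but
      they define a point of its completion, and the completed differential sends it to the image of
      \<open>y\<close>.\<close>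
    have "(\<lambda>k. ?p k ?P +>\<^bsub>?P\<^esub> u k) \<in> carrier (completion R I ?P)"
      by (rule adic_module.cauchy_completion[OF P_ad u u_next])
    moreover have "completion_unit R I ?O y = completion_map R I ?O ?d (\<lambda>k. ?p k ?P +>\<^bsub>?P\<^esub> u k)"
      unfolding completion_unit_def y_du
      by (rule completion_map_hom(2)[OF P C.module_Obj I.ideal_axioms C.Dif_hom' u, symmetric])
    ultimately have "completion_unit R I ?O y \<in> coboundaries ?D n"
      by (simp add: coboundaries_def completion_complex_def)
    from tau_inj[OF y this] obtain u\<^sub>0 where u\<^sub>0: "u\<^sub>0 \<in> carrier ?P" "y = ?d u\<^sub>0"
      by (auto simp: coboundaries_def)
    have "z = \<phi> \<alpha> \<oplus>\<^bsub>?Z\<^esub> y"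
      unfolding y_def a_minus_def using z cl(1)[OF \<alpha>] C.Z.M.r_neg1[of "\<phi> \<alpha>" n z]
      by (simp add: C.Z.M.a_ac C.Z.M.r_neg1 C.Z.M.r_neg2 del: cocycles_sel)
    then show ?thesis using \<alpha> u\<^sub>0 by blast
  qed

  \<comment> \<open>Coboundaries have zero class, so \<open>lift\<close> says that the finite free
    module maps onto the cohomology.\<close>
  have hom: "(\<lambda>a. ?cl (\<phi> a)) \<in> mod_hom R ?F ?H" by (rule mod_hom_comp[OF \<phi>(1) C.class_hom])
  have "x \<in> (\<lambda>a. ?cl (\<phi> a)) ` carrier ?F" if x: "x \<in> carrier ?H" for x
  proof -
    obtain z where z: "z \<in> carrier ?Z" "x = ?cl z"
      using x unfolding C.cohomology_carrier by blast
    obtain u \<alpha> where u: "u \<in> carrier ?P" and \<alpha>: "\<alpha> \<in> carrier ?F" and eq: "z = \<phi> \<alpha> \<oplus>\<^bsub>?Z\<^esub> ?d u"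
      using lift[OF z(1)] by blast
    have "?cl (?d u) = \<zero>\<^bsub>?H\<^esub>"
      unfolding C.cohomology_zero
      by (rule iffD2[OF C.Z.coset_eq_self_iff[OF C.submodule_coboundaries cl(2)[OF u]]])
        (use u in \<open>auto simp: coboundaries_def\<close>)
    then have "x = ?cl (\<phi> \<alpha>)"
      unfolding z(2) eq mod_hom_add[OF C.class_hom cl(1)[OF \<alpha>] cl(2)[OF u]]
      using H.M.r_zero[OF mod_hom_closed[OF hom \<alpha>]] by simp
    then show ?thesis using \<alpha> by blast
  qed
  then have surj: "(\<lambda>a. ?cl (\<phi> a)) ` carrier ?F = carrier ?H"
    using mod_hom_closed[OF hom] by blast
  have "generated_mod R {} ?F"
  proof -
    have e: "free_basis R ` S \<subseteq> carrier ?F"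
      by (rule image_subsetI) (rule R.free_basis_closed)
    have "carrier ?F \<subseteq> module_span R ?F (free_basis R ` S)"
      by (rule R.free_module_induct[OF F.submodule_span[OF e]])
        (rule subsetD[OF module_span_superset imageI])
    moreover have "module_span R ?F (free_basis R ` S) \<subseteq> carrier ?F"
      by (rule module_span_minimal[OF F.carrier_is_submodule e])
    ultimately have span: "module_span R ?F (free_basis R ` S) = carrier ?F" by blast
    show ?thesis
      unfolding generated_mod_def
      by (rule exI[of _ "free_basis R ` S"]) (simp add: e S(1) span del: free_module_sel)
  qed
  then have "generated_mod R {} ?H"
    by (rule generated_mod_surj[OF F.module_axioms C.module_cohomology hom surj empty_subsetI])
  then show ?thesis
    using C.module_cohomology by (simp add: fin_gen_module_iff)
qed

theorem theorem0p2:
  fixes A :: "'a ring" and \<aa> :: "'a set" and i\<^sub>0 :: int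
    and M :: "('a, 'm) cochain"
    and T :: "('a set, ('a set \<times> ('a + 'm) list \<Rightarrow> 'a set) set) cochain"
  assumes "cring A" and "noetherian_ring A"
    and "ideal \<aa> A" and "adically_complete_ring A \<aa>"
    and "cochain_complex A M" and "cohomologically_complete A \<aa> M"
    and "\<And>i. i > i\<^sub>0 \<Longrightarrow> cohomology_vanishes M i"
    and "derived_base_change A (A Quot \<aa>) (a_r_coset A \<aa>) M T"
    and "fin_gen_module (A Quot \<aa>) (cohomology T i\<^sub>0)"
  shows "fin_gen_module A (cohomology M i\<^sub>0)"
proof -
  have I: "\<aa> \<subseteq> carrier A" using ideal.Icarr[OF assms(3)] by blast
  obtain Q :: "('a, ('a + 'm) list) cochain" and q
    where Q: "K_projective A Q" "quasi_isomorphism A Q M q"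
      and \<tau>: "quasi_isomorphism A Q (completion_complex A \<aa> Q) (\<lambda>i. completion_unit A \<aa> (Obj Q i))"
    using assms(6) unfolding cohomologically_complete_def K_projective_resolution_def by blast
  obtain Q' :: "('a, ('a + 'm) list) cochain" and q'
    where Q': "K_projective A Q'" "quasi_isomorphism A Q' M q'"
      and T: "T = base_change_complex A (A Quot \<aa>) (a_r_coset A \<aa>) Q'"
    using assms(8) unfolding derived_base_change_def K_projective_resolution_def by blast
  have cQ: "cochain_complex A Q" and cQ': "cochain_complex A Q'"
    using Q(1) Q'(1) by (simp_all add: K_projective_def)
  have "cohomology_vanishes Q' i" if "i > i\<^sub>0" for i
    by (rule cohomology_vanishes_quasi_isomorphism[OF cQ' Q'(2) assms(7)[OF that]])
  then have "generated_mod A \<aa> (cohomology Q' i\<^sub>0)"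
    by (rule generated_mod_cohomology_base_change[OF assms(1,3) Q'(1) _ assms(9)[unfolded T]])
  \<comment> \<open>The resolutions \<open>Q'\<close> and \<open>Q\<close> come from separate
    hypotheses, and the completion map is known to be a quasi-isomorphism only for \<open>Q\<close>;
    the passage goes through the cohomology of \<open>M\<close>.\<close>
  then have "generated_mod A \<aa> (cohomology Q i\<^sub>0)"
    using generated_mod_quasi_isomorphism[OF cQ' assms(5) Q'(2) I]
      generated_mod_quasi_isomorphism[OF cQ assms(5) Q(2) I] by blast
  then have "fin_gen_module A (cohomology Q i\<^sub>0)"
    by (rule fin_gen_cohomology_of_generated_mod[OF assms(1,3,4) cQ \<tau>])
  \<comment> \<open>With the empty set of scalars the same transfer carries finite generation from
    \<open>Q\<close> to \<open>M\<close>.\<close>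
  then show ?thesis
    using generated_mod_quasi_isomorphism[OF cQ assms(5) Q(2), of "{}"]
      complex.module_cohomology[OF complex.intro[OF assms(5)]]
    by (simp add: fin_gen_module_iff)
qed

end
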